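(* The distributionally robust two-stage problem $$\mathop{\text{minimize}}_{\bm{x}\in\mathcal{X}}\; c(\bm{x})+\sup_{\mathbb{P}\in\mathcal{P}}\mathbb{E}_{\mathbb{P}}\left[\mathcal{Q}(\bm{x},\tilde{\bm{\xi}})\right]$$ is strongly NP-hard even if there are no first-stage decisions ($N_1=0$), the support $\Xi=\{0,1\}^M$ is the zero-one hypercube, $\mathcal{Q}(\bm{x},\bm{\xi})$ is the optimal value of a linear program ($\mathcal{Y}=\mathbb{R}^{N_2}_+$), and either (i) uncertainty affects only the objective function: $\bm{W}(\bm{\xi})=\bm{W}_0$ and $\bm{T}(\bm{x})=\bm{0}$; or (ii) uncertainty affects only the constraint right-hand sides: $\bm{W}(\bm{\xi})=\bm{W}_0$, $\bm{Q}=\bm{0}$ and $\bm{T}(\bm{x})=\bm{T}_0$. It remains NP-hard even if $N_2=2$ in case (i).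
   Context: $\Xi\subseteq\{0,1\}^M$ is the support; $\hat{\bm{\xi}}^{(1)},\ldots,\hat{\bm{\xi}}^{(N)}\in\Xi$ are given observations and $\hat{\mathbb{P}}_N=\frac1N\sum_{i=1}^N\delta_{\hat{\bm{\xi}}^{(i)}}$. $\mathcal{X}\subseteq\mathbb{R}^{N_1}$ is convex and compact, $c$ is convex. The second-stage loss is $\mathcal{Q}(\bm{x},\bm{\xi})=\inf_{\bm{y}\in\mathcal{Y}}\{\bm{q}(\bm{\xi})^\top\bm{y}:\bm{W}(\bm{\xi})\bm{y}\geq\bm{T}(\bm{x})\bm{\xi}+\bm{h}(\bm{x})\}$, where $\mathcal{Y}\subseteq\mathbb{R}^{N_2}$ is a proper cone, $\bm{q}(\bm{\xi})=\bm{q}_0+\bm{Q}\bm{\xi}$ with $\bm{Q}\in\mathbb{R}^{N_2\times M}$, $\bm{W}(\bm{\xi})=\bm{W}_0+\sum_{j=1}^M\xi_j\bm{W}_j$ with $\bm{W}_j\in\mathbb{R}^{L\times N_2}$, and $\bm{h}:\mathcal{X}\to\mathbb{R}^L$, $\bm{T}:\mathcal{X}\to\mathbb{R}^{L\times M}$ are componentwise closed, proper, convex. The ambiguity set is $\mathcal{P}=\{\mathbb{Q}\in\mathcal{M}(\Xi):d_W(\mathbb{Q},\hat{\mathbb{P}}_N)\leq\varepsilon\}$ with $\varepsilon\geq0$ part of the input, where $\mathcal{M}(\Xi)$ is the set of distributions on $\Xi$ and $d_W(\mathbb{P},\mathbb{P}')=\min_\Pi\sum_{\bm{\xi},\bm{\xi}'\in\Xi}d(\bm{\xi},\bm{\xi}')\Pi(\bm{\xi},\bm{\xi}')$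 over couplings $\Pi$ of $\mathbb{P},\mathbb{P}'$, with $d$ a metric induced by a norm on $\mathbb{R}^M$. The case where $\varepsilon\geq\max_{\bm{\xi},\bm{\xi}'\in\Xi}d(\bm{\xi},\bm{\xi}')$, in which $\mathcal{P}=\mathcal{M}(\Xi)$, is included. When $N_1=0$ the problem is the evaluation of $\sup_{\mathbb{P}\in\mathcal{P}}\mathbb{E}_{\mathbb{P}}[\mathcal{Q}(\tilde{\bm{\xi}})]$. Hardness is with respect to the encoding size of the input data (the matrices, vectors, samples and radius defining the problem), as usual via the decision version (is the optimal value at least a given threshold?).
   Formalization: The norms inducing d (one on each R^M, fixed and not part of the input) are assumed to have diameter on {0,1}^M bounded by a polynomial in M, as all p-norms do; for norms such as 2^(2^M) times the 1-norm, case (i) becomes polynomial-time solvable. *)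

theory Defs
  imports "HOL-Probability.Probability_Mass_Function" "Jordan_Normal_Form.Matrix"
begin

hide_type (open) Finite_Cartesian_Product.vec
hide_const (open) Finite_Cartesian_Product.vec Finite_Cartesian_Product.mat
  Finite_Cartesian_Product.row Finite_Cartesian_Product.column Determinants.det
no_notation Finite_Cartesian_Product.vec_nth (infixl \<open>$\<close> 90)
unbundle no inner_syntax


section \<open>Deterministic multitape Turing machines\<close>

datatype head_move = Move_left | Stay | Move_right

fun shift :: "head_move \<Rightarrow> int" where
  "shift Move_left = -1"
| "shift Stay = 0"
| "shift Move_right = 1"

text \<open>
  States are \<open>{..<tm_states}\<close>, where 0 is initial and 1 is halting. Tape symbols are
  \<open>{..<tm_symbols}\<close>, where 0 is the blank and 1, 2 stand for the bits 0, 1. The transition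
  function maps a state and the list of scanned symbols (one per tape) to the new state and the
  list of written symbols and head moves.
\<close>

record tm =
  tm_tapes :: nat
  tm_states :: nat
  tm_symbols :: nat
  tm_delta :: "nat \<Rightarrow> nat list \<Rightarrow> nat \<times> (nat \<times> head_move) list"

definition tm_wf :: "tm \<Rightarrow> bool" where
  "tm_wf M \<longleftrightarrow> 1 \<le> tm_tapes M \<and> 2 \<le> tm_states M \<and> 3 \<le> tm_symbols M \<and>
     (\<forall>q < tm_states M. \<forall>s. length s = tm_tapes M \<and> set s \<subseteq> {..<tm_symbols M} \<longrightarrow>
        (case tm_delta M q s of (q', as) \<Rightarrow>
           q' < tm_states M \<and> length as = tm_tapes M \<and> (\<forall>a \<in> set as. fst a < tm_symbols M)))"

text \<open>A configuration consists of the state, the head positions and the contents of the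
  two-way infinite tapes.\<close>

type_synonym tm_config = "nat \<times> (nat \<Rightarrow> int) \<times> (nat \<Rightarrow> int \<Rightarrow> nat)"

definition tm_step :: "tm \<Rightarrow> tm_config \<Rightarrow> tm_config" where
  "tm_step M = (\<lambda>(q, pos, tp).
     if q = 1 then (q, pos, tp)
     else case tm_delta M q (map (\<lambda>i. tp i (pos i)) [0..<tm_tapes M]) of (q', as) \<Rightarrow>
       (q',
        (\<lambda>i. if i < tm_tapes M then pos i + shift (snd (as ! i)) else pos i),
        (\<lambda>i. if i < tm_tapes M then (tp i)(pos i := fst (as ! i)) else tp i)))"

definition bit_symbol :: "bool \<Rightarrow> nat" where
  "bit_symbol b = (if b then 2 else 1)"

definition tape_of :: "bool list \<Rightarrow> int \<Rightarrow> nat" where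
  "tape_of w z = (if 0 \<le> z \<and> z < int (length w) then bit_symbol (w ! nat z) else 0)"

definition tm_init :: "bool list list \<Rightarrow> tm_config" where
  "tm_init ws = (0, (\<lambda>_. 0), (\<lambda>i. if i < length ws then tape_of (ws ! i) else (\<lambda>_. 0)))"

text \<open>The output is the string on the last tape between cell 0 and the first blank. As halting
  configurations are fixed points of \<^const>\<open>tm_step\<close>, being in the halting state after \<open>t\<close> steps
  means having halted within \<open>t\<close> steps.\<close>

definition tm_outputs :: "tm \<Rightarrow> bool list list \<Rightarrow> nat \<Rightarrow> bool list \<Rightarrow> bool" where
  "tm_outputs M ws t y \<longleftrightarrow>
     (case (tm_step M ^^ t) (tm_init ws) of (q, pos, tp) \<Rightarrow>
        q = 1 \<and>
        (\<forall>j < length y. tp (tm_tapes M - 1) (int j) = bit_symbol (y ! j)) \<and>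
        tp (tm_tapes M - 1) (int (length y)) = 0)"

text \<open>Functions of \<open>k\<close> strings, the \<open>i\<close>-th argument being written on the \<open>i\<close>-th tape.\<close>

definition poly_time :: "nat \<Rightarrow> (bool list list \<Rightarrow> bool list) \<Rightarrow> bool" where
  "poly_time k f \<longleftrightarrow> (\<exists>M. \<exists>p :: nat poly. tm_wf M \<and> k \<le> tm_tapes M \<and>
     (\<forall>ws. length ws = k \<longrightarrow> tm_outputs M ws (poly p (sum_list (map length ws))) (f ws)))"


section \<open>NP and NP-hardness\<close>

definition in_NP :: "bool list set \<Rightarrow> bool" where
  "in_NP A \<longleftrightarrow> (\<exists>R :: bool list \<Rightarrow> bool list \<Rightarrow> bool. \<exists>p :: nat poly.
     poly_time 2 (\<lambda>ws. [R (ws ! 0) (ws ! 1)]) \<and>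
     (\<forall>x. x \<in> A \<longleftrightarrow> (\<exists>w. length w \<le> poly p (length x) \<and> R x w)))"

text \<open>A decision problem is given by its set of instances, its yes-instances and an encoding of
  instances as strings. Reductions have to produce encodings of genuine instances, so that
  hardness never stems from recognising valid instances. Hence, if \<open>I \<subseteq> J\<close> and the problem is
  hard for the instances in \<open>I\<close>, then it is hard for those in \<open>J\<close>.\<close>

definition NP_hard :: "'a set \<Rightarrow> ('a \<Rightarrow> bool) \<Rightarrow> ('a \<Rightarrow> bool list) \<Rightarrow> bool" where
  "NP_hard I yes enc \<longleftrightarrow> (\<forall>A. in_NP A \<longrightarrow>
     (\<exists>f. poly_time 1 (\<lambda>ws. f (ws ! 0)) \<and>
          (\<forall>x. \<exists>a \<in> I. f x = enc a \<and> (x \<in> A \<longleftrightarrow> yes a))))"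

text \<open>Strong NP-hardness in the sense of Garey and Johnson: for some polynomial \<open>p\<close>, NP-hardness
  persists when the largest number \<open>mx a\<close> occurring in the instance \<open>a\<close> is bounded by \<open>p\<close> of the
  encoding length.\<close>

definition strongly_NP_hard ::
    "'a set \<Rightarrow> ('a \<Rightarrow> bool) \<Rightarrow> ('a \<Rightarrow> bool list) \<Rightarrow> ('a \<Rightarrow> nat) \<Rightarrow> bool" where
  "strongly_NP_hard I yes enc mx \<longleftrightarrow>
     (\<exists>p :: nat poly. NP_hard {a \<in> I. mx a \<le> poly p (length (enc a))} yes enc)"


section \<open>Distributionally robust two-stage problems\<close>

text \<open>As vectors carry their dimension, a single function provides a norm on \<open>\<real>\<^sup>m\<close> for every \<open>m\<close>.\<close>

definition norm_on :: "nat \<Rightarrow> (real vec \<Rightarrow> real) \<Rightarrow> bool" where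
  "norm_on m nrm \<longleftrightarrow>
     (\<forall>u \<in> carrier_vec m. 0 \<le> nrm u \<and> (nrm u = 0 \<longleftrightarrow> u = 0\<^sub>v m)) \<and>
     (\<forall>u \<in> carrier_vec m. \<forall>a. nrm (a \<cdot>\<^sub>v u) = \<bar>a\<bar> * nrm u) \<and>
     (\<forall>u \<in> carrier_vec m. \<forall>v \<in> carrier_vec m. nrm (u + v) \<le> nrm u + nrm v)"

definition hypercube :: "nat \<Rightarrow> real vec set" where
  "hypercube m = {\<xi> \<in> carrier_vec m. \<forall>j < m. \<xi> $ j \<in> {0, 1}}"

record two_stage =
  X :: "real vec set"
  cost :: "real vec \<Rightarrow> real"
  Y :: "real vec set"
  q0 :: "real vec"
  Q :: "real mat"
  W0 :: "real mat"
  Wj :: "nat \<Rightarrow> real mat"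
  T :: "real vec \<Rightarrow> real mat"
  h :: "real vec \<Rightarrow> real vec"
  supp :: "real vec set"
  samples :: "real vec list"
  radius :: real

definition q_of :: "two_stage \<Rightarrow> real vec \<Rightarrow> real vec" where
  "q_of P \<xi> = q0 P + Q P *\<^sub>v \<xi>"

definition W_of :: "two_stage \<Rightarrow> real vec \<Rightarrow> real mat" where
  "W_of P \<xi> = mat (dim_row (W0 P)) (dim_col (W0 P))
     (\<lambda>(r, s). W0 P $$ (r, s) + (\<Sum>j < dim_vec \<xi>. \<xi> $ j * Wj P j $$ (r, s)))"

text \<open>The infimum is taken in the extended reals: it is \<open>\<infinity>\<close> for an infeasible and \<open>-\<infinity>\<close> for an
  unbounded second stage.\<close>

definition second_stage :: "two_stage \<Rightarrow> real vec \<Rightarrow> real vec \<Rightarrow> ereal" where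
  "second_stage P x \<xi> =
     (INF y \<in> {y \<in> Y P. W_of P \<xi> *\<^sub>v y \<ge> T P x *\<^sub>v \<xi> + h P x}. ereal (q_of P \<xi> \<bullet> y))"

text \<open>The addition of \<^typ>\<open>ereal\<close> satisfies \<open>\<infinity> + (-\<infinity>) = \<infinity>\<close>, the usual convention for minimisation,
  and its multiplication satisfies \<open>0 * \<infinity> = 0\<close>.\<close>

definition expected_loss :: "two_stage \<Rightarrow> real vec pmf \<Rightarrow> real vec \<Rightarrow> ereal" where
  "expected_loss P \<mu> x = (\<Sum>\<xi> \<in> supp P. ereal (pmf \<mu> \<xi>) * second_stage P x \<xi>)"

definition distributions :: "real vec set \<Rightarrow> real vec pmf set" where
  "distributions S = {\<mu>. set_pmf \<mu> \<subseteq> S}"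

definition couplings :: "'a pmf \<Rightarrow> 'a pmf \<Rightarrow> ('a \<times> 'a) pmf set" where
  "couplings \<mu> \<nu> = {\<pi>. map_pmf fst \<pi> = \<mu> \<and> map_pmf snd \<pi> = \<nu>}"

definition wasserstein ::
    "(real vec \<Rightarrow> real) \<Rightarrow> real vec set \<Rightarrow> real vec pmf \<Rightarrow> real vec pmf \<Rightarrow> real" where
  "wasserstein nrm S \<mu> \<nu> =
     (INF \<pi> \<in> couplings \<mu> \<nu>. \<Sum>\<xi> \<in> S. \<Sum>\<xi>' \<in> S. nrm (\<xi> - \<xi>') * pmf \<pi> (\<xi>, \<xi>'))"

definition empirical :: "'a list \<Rightarrow> 'a pmf" where
  "empirical xs = map_pmf ((!) xs) (pmf_of_set {..<length xs})"

definition ambiguity_set :: "(real vec \<Rightarrow> real) \<Rightarrow> two_stage \<Rightarrow> real vec pmf set" where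
  "ambiguity_set nrm P = {\<mu> \<in> distributions (supp P).
     wasserstein nrm (supp P) \<mu> (empirical (samples P)) \<le> radius P}"

definition optimal_value :: "(real vec \<Rightarrow> real) \<Rightarrow> two_stage \<Rightarrow> ereal" where
  "optimal_value nrm P =
     (INF x \<in> X P. ereal (cost P x) + (SUP \<mu> \<in> ambiguity_set nrm P. expected_loss P \<mu> x))"

definition objective_uncertainty :: "two_stage \<Rightarrow> bool" where
  "objective_uncertainty P \<longleftrightarrow>
     (\<forall>\<xi> \<in> supp P. W_of P \<xi> = W0 P) \<and>
     (\<forall>x \<in> X P. T P x = 0\<^sub>m (dim_row (T P x)) (dim_col (T P x)))"

definition rhs_uncertainty :: "two_stage \<Rightarrow> bool" where
  "rhs_uncertainty P \<longleftrightarrow>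
     (\<forall>\<xi> \<in> supp P. W_of P \<xi> = W0 P) \<and>
     Q P = 0\<^sub>m (dim_row (Q P)) (dim_col (Q P)) \<and>
     (\<exists>T0. \<forall>x \<in> X P. T P x = T0)"


section \<open>Finitely encoded instances\<close>

text \<open>Rational data of a problem without first-stage decisions over the zero-one hypercube whose
  second stage is a linear program, together with the threshold of the decision version.\<close>

record instance_data =
  dim_M :: nat
  dim_N2 :: nat
  dim_L :: nat
  data_q0 :: "rat vec"
  data_Q :: "rat mat"
  data_W0 :: "rat mat"
  data_W :: "rat mat list"
  data_T :: "rat mat"
  data_h :: "rat vec"
  data_samples :: "rat vec list"
  data_radius :: rat
  threshold :: rat

definition instances :: "instance_data set" where
  "instances = {D.
     1 \<le> dim_M D \<and> 1 \<le> dim_N2 D \<and> 1 \<le> dim_L D \<and>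
     data_q0 D \<in> carrier_vec (dim_N2 D) \<and>
     data_Q D \<in> carrier_mat (dim_N2 D) (dim_M D) \<and>
     data_W0 D \<in> carrier_mat (dim_L D) (dim_N2 D) \<and>
     length (data_W D) = dim_M D \<and>
     (\<forall>B \<in> set (data_W D). B \<in> carrier_mat (dim_L D) (dim_N2 D)) \<and>
     data_T D \<in> carrier_mat (dim_L D) (dim_M D) \<and>
     data_h D \<in> carrier_vec (dim_L D) \<and>
     data_samples D \<noteq> [] \<and>
     (\<forall>\<xi> \<in> set (data_samples D). \<xi> \<in> carrier_vec (dim_M D) \<and> (\<forall>j < dim_M D. \<xi> $ j \<in> {0, 1})) \<and>
     0 \<le> data_radius D}"

text \<open>The first stage has the single decision \<open>()\<close> in \<open>\<real>\<^sup>0\<close> and no cost.\<close>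

definition problem_of :: "instance_data \<Rightarrow> two_stage" where
  "problem_of D = \<lparr>
     X = carrier_vec 0,
     cost = (\<lambda>_. 0),
     Y = {y \<in> carrier_vec (dim_N2 D). 0\<^sub>v (dim_N2 D) \<le> y},
     q0 = map_vec real_of_rat (data_q0 D),
     Q = map_mat real_of_rat (data_Q D),
     W0 = map_mat real_of_rat (data_W0 D),
     Wj = (\<lambda>j. map_mat real_of_rat (data_W D ! j)),
     T = (\<lambda>_. map_mat real_of_rat (data_T D)),
     h = (\<lambda>_. map_vec real_of_rat (data_h D)),
     supp = hypercube (dim_M D),
     samples = map (map_vec real_of_rat) (data_samples D),
     radius = real_of_rat (data_radius D)\<rparr>"

definition yes_instance :: "(real vec \<Rightarrow> real) \<Rightarrow> instance_data \<Rightarrow> bool" where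
  "yes_instance nrm D \<longleftrightarrow>
     optimal_value nrm (problem_of D) \<ge> ereal (real_of_rat (threshold D))"

text \<open>All rational numbers in an instance, matrices being listed row by row.\<close>

definition data_numbers :: "instance_data \<Rightarrow> rat list" where
  "data_numbers D =
     list_of_vec (data_q0 D) @
     concat (mat_to_list (data_Q D)) @
     concat (mat_to_list (data_W0 D)) @
     concat (map (\<lambda>B. concat (mat_to_list B)) (data_W D)) @
     concat (mat_to_list (data_T D)) @
     list_of_vec (data_h D) @
     concat (map list_of_vec (data_samples D)) @
     [data_radius D, threshold D]"

fun bits :: "nat \<Rightarrow> bool list" where
  "bits n = (if n = 0 then [] else odd n # bits (n div 2))"

declare bits.simps [simp del]

text \<open>Binary digits, least significant first, each preceded by \<^const>\<open>True\<close>; a final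
  \<^const>\<open>False\<close> makes the code self-delimiting.\<close>

definition enc_nat :: "nat \<Rightarrow> bool list" where
  "enc_nat n = concat (map (\<lambda>b. [True, b]) (bits n)) @ [False]"

definition enc_rat :: "rat \<Rightarrow> bool list" where
  "enc_rat r = (case quotient_of r of (a, b) \<Rightarrow> (a < 0) # enc_nat (nat \<bar>a\<bar>) @ enc_nat (nat b))"

definition enc_instance :: "instance_data \<Rightarrow> bool list" where
  "enc_instance D =
     enc_nat (dim_M D) @ enc_nat (dim_N2 D) @ enc_nat (dim_L D) @ enc_nat (length (data_samples D)) @
     concat (map enc_rat (data_numbers D))"

lemma bits_inject: "bits m = bits n \<Longrightarrow> m = n"
proof (induction m arbitrary: n rule: bits.induct)
  case (1 m)
  show ?case
  proof (cases "m = 0 \<or> n = 0")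
    case True
    then show ?thesis
      using "1.prems" by (auto simp: bits.simps[of m] bits.simps[of n] split: if_splits)
  next
    case False
    then have "odd m = odd n" "bits (m div 2) = bits (n div 2)"
      using "1.prems" by (simp_all add: bits.simps[of m] bits.simps[of n])
    moreover from this False "1.IH" have "m div 2 = n div 2"
      by blast
    ultimately show ?thesis
      by (metis dvd_mult_div_cancel odd_two_times_div_two_succ)
  qed
qed

lemma enc_nat_prefix:
  assumes "enc_nat m @ u = enc_nat n @ v"
  shows "m = n \<and> u = v"
proof -
  have "concat (map (\<lambda>b. [True, b]) as) @ False # u = concat (map (\<lambda>b. [True, b]) bs) @ False # v
      \<Longrightarrow> as = bs \<and> u = v" for as bs
    by (induction as arbitrary: bs; case_tac bs) auto
  from this[of "bits m" "bits n"] assms show ?thesis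
    by (auto simp: enc_nat_def dest: bits_inject)
qed

lemma enc_rat_prefix:
  assumes "enc_rat r @ u = enc_rat s @ v"
  shows "r = s \<and> u = v"
proof -
  obtain a b where r: "quotient_of r = (a, b)" by fastforce
  obtain c d where s: "quotient_of s = (c, d)" by fastforce
  have pos: "b > 0" "d > 0"
    using quotient_of_denom_pos[OF r] quotient_of_denom_pos[OF s] by auto
  have "(a < 0) = (c < 0)" and
    e: "enc_nat (nat \<bar>a\<bar>) @ enc_nat (nat b) @ u = enc_nat (nat \<bar>c\<bar>) @ enc_nat (nat d) @ v"
    using assms by (auto simp: enc_rat_def r s)
  moreover from enc_nat_prefix[OF e]
  have "nat \<bar>a\<bar> = nat \<bar>c\<bar>" and e': "enc_nat (nat b) @ u = enc_nat (nat d) @ v" by auto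
  moreover from enc_nat_prefix[OF e'] have "nat b = nat d" "u = v" by auto
  ultimately have "a = c" "b = d" "u = v" using pos by auto
  then show ?thesis
    using quotient_of_div[OF r] quotient_of_div[OF s] by simp
qed

lemma enc_rats_inject:
  "length xs = length ys \<Longrightarrow> concat (map enc_rat xs) = concat (map enc_rat ys) \<Longrightarrow> xs = ys"
  by (induction xs ys rule: list_induct2) (auto dest: enc_rat_prefix)

lemma concat_append_inject:
  "(\<And>a. a \<in> set as \<Longrightarrow> length (f a) = k) \<Longrightarrow> (\<And>b. b \<in> set bs \<Longrightarrow> length (f b) = k) \<Longrightarrow>
   (\<And>a b. a \<in> set as \<Longrightarrow> b \<in> set bs \<Longrightarrow> f a = f b \<Longrightarrow> a = b) \<Longrightarrow> length as = length bs \<Longrightarrow>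
   concat (map f as) @ u = concat (map f bs) @ v \<Longrightarrow> as = bs \<and> u = v"
proof (induction as arbitrary: bs)
  case (Cons a as)
  then obtain b bs' where bs: "bs = b # bs'" by (cases bs) auto
  have "length (f a) = length (f b)" using Cons.prems(1)[of a] Cons.prems(2)[of b] bs by simp
  then have "f a = f b" and r: "concat (map f as) @ u = concat (map f bs') @ v"
    using Cons.prems(5) bs by auto
  then have "a = b" using Cons.prems(3) bs by simp
  moreover have "as = bs' \<and> u = v"
    by (rule Cons.IH[OF _ _ _ _ r]) (use Cons.prems(1-4) bs in auto)
  ultimately show ?case using bs by simp
qed simp

lemma list_of_vec_append_inject:
  assumes "a \<in> carrier_vec n" "b \<in> carrier_vec n" "list_of_vec a @ u = list_of_vec b @ v"
  shows "a = b \<and> u = v"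
proof -
  have "list_of_vec a = list_of_vec b" "u = v" using assms by auto
  then show ?thesis by (metis vec_list)
qed

lemma length_concat_mat_to_list:
  "A \<in> carrier_mat r c \<Longrightarrow> length (concat (mat_to_list A)) = r * c"
  by (auto simp: mat_to_list_def length_concat o_def sum_list_triv)

lemma mat_to_list_inject:
  assumes "A \<in> carrier_mat r c" "B \<in> carrier_mat r c"
    and "concat (mat_to_list A) = concat (mat_to_list B)"
  shows "A = B"
proof -
  have "map (\<lambda>i. map (\<lambda>j. A $$ (i, j)) [0..<c]) [0..<r] = map (\<lambda>i. map (\<lambda>j. B $$ (i, j)) [0..<c]) [0..<r]"
    using assms by (intro concat_injective) (auto simp: mat_to_list_def set_zip)
  then have "A $$ (i, j) = B $$ (i, j)" if "i < r" "j < c" for i j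
    using that by (auto simp: map_eq_conv)
  then show ?thesis using assms by (intro eq_matI) auto
qed

lemma mat_to_list_append_inject:
  assumes "A \<in> carrier_mat r c" "B \<in> carrier_mat r c"
    and "concat (mat_to_list A) @ u = concat (mat_to_list B) @ v"
  shows "A = B \<and> u = v"
  using assms length_concat_mat_to_list[OF assms(1)] length_concat_mat_to_list[OF assms(2)]
    mat_to_list_inject[OF assms(1,2)] by auto

lemma length_concat_const:
  "(\<And>a. a \<in> set as \<Longrightarrow> length (f a) = k) \<Longrightarrow> length (concat (map f as)) = length as * k"
  by (induction as) auto

lemma length_data_numbers:
  assumes "D \<in> instances"
  shows "length (data_numbers D) =
    dim_N2 D + dim_N2 D * dim_M D + dim_L D * dim_N2 D + dim_M D * (dim_L D * dim_N2 D) +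
    dim_L D * dim_M D + dim_L D + length (data_samples D) * dim_M D + 2"
proof -
  have "length (concat (map (\<lambda>B. concat (mat_to_list B)) (data_W D))) =
      length (data_W D) * (dim_L D * dim_N2 D)"
    using assms by (intro length_concat_const length_concat_mat_to_list) (auto simp: instances_def)
  moreover have "length (concat (map list_of_vec (data_samples D))) = length (data_samples D) * dim_M D"
    using assms by (intro length_concat_const) (auto simp: instances_def)
  ultimately show ?thesis
    using assms
      length_concat_mat_to_list[of "data_Q D" "dim_N2 D" "dim_M D"]
      length_concat_mat_to_list[of "data_W0 D" "dim_L D" "dim_N2 D"]
      length_concat_mat_to_list[of "data_T D" "dim_L D" "dim_M D"]
    by (auto simp add: data_numbers_def instances_def)
qed

lemma enc_instance_inject:
  assumes D: "D \<in> instances" and E: "E \<in> instances" and eq: "enc_instance D = enc_instance E"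
  shows "D = E"
proof -
  have dims: "dim_M D = dim_M E" "dim_N2 D = dim_N2 E" "dim_L D = dim_L E"
      "length (data_samples D) = length (data_samples E)"
    and "concat (map enc_rat (data_numbers D)) = concat (map enc_rat (data_numbers E))"
    using eq unfolding enc_instance_def by (auto dest!: enc_nat_prefix)
  then have nums: "data_numbers D = data_numbers E"
    using length_data_numbers[OF D] length_data_numbers[OF E] by (intro enc_rats_inject) simp_all
  note inst = D[unfolded instances_def mem_Collect_eq] E[unfolded instances_def mem_Collect_eq, folded dims]
  note n = nums[unfolded data_numbers_def]
  from list_of_vec_append_inject[OF _ _ n] inst have "data_q0 D = data_q0 E" and
    n: "concat (mat_to_list (data_Q D)) @ concat (mat_to_list (data_W0 D)) @
      concat (map (\<lambda>B. concat (mat_to_list B)) (data_W D)) @ concat (mat_to_list (data_T D)) @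
      list_of_vec (data_h D) @ concat (map list_of_vec (data_samples D)) @ [data_radius D, threshold D] =
      concat (mat_to_list (data_Q E)) @ concat (mat_to_list (data_W0 E)) @
      concat (map (\<lambda>B. concat (mat_to_list B)) (data_W E)) @ concat (mat_to_list (data_T E)) @
      list_of_vec (data_h E) @ concat (map list_of_vec (data_samples E)) @ [data_radius E, threshold E]"
    by blast+
  moreover from mat_to_list_append_inject[OF _ _ n] inst have "data_Q D = data_Q E" and
    n: "concat (mat_to_list (data_W0 D)) @
      concat (map (\<lambda>B. concat (mat_to_list B)) (data_W D)) @ concat (mat_to_list (data_T D)) @
      list_of_vec (data_h D) @ concat (map list_of_vec (data_samples D)) @ [data_radius D, threshold D] =
      concat (mat_to_list (data_W0 E)) @
      concat (map (\<lambda>B. concat (mat_to_list B)) (data_W E)) @ concat (mat_to_list (data_T E)) @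
      list_of_vec (data_h E) @ concat (map list_of_vec (data_samples E)) @ [data_radius E, threshold E]"
    by blast+
  moreover from mat_to_list_append_inject[OF _ _ n] inst have "data_W0 D = data_W0 E" and
    n: "concat (map (\<lambda>B. concat (mat_to_list B)) (data_W D)) @ concat (mat_to_list (data_T D)) @
      list_of_vec (data_h D) @ concat (map list_of_vec (data_samples D)) @ [data_radius D, threshold D] =
      concat (map (\<lambda>B. concat (mat_to_list B)) (data_W E)) @ concat (mat_to_list (data_T E)) @
      list_of_vec (data_h E) @ concat (map list_of_vec (data_samples E)) @ [data_radius E, threshold E]"
    by blast+
  moreover have "data_W D = data_W E \<and>
      concat (mat_to_list (data_T D)) @
      list_of_vec (data_h D) @ concat (map list_of_vec (data_samples D)) @ [data_radius D, threshold D] =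
      concat (mat_to_list (data_T E)) @
      list_of_vec (data_h E) @ concat (map list_of_vec (data_samples E)) @ [data_radius E, threshold E]"
    by (rule concat_append_inject[OF _ _ _ _ n, where k = "dim_L D * dim_N2 D"])
       (use inst in \<open>auto intro!: length_concat_mat_to_list intro: mat_to_list_inject\<close>)
  then have "data_W D = data_W E" and
    n: "concat (mat_to_list (data_T D)) @
      list_of_vec (data_h D) @ concat (map list_of_vec (data_samples D)) @ [data_radius D, threshold D] =
      concat (mat_to_list (data_T E)) @
      list_of_vec (data_h E) @ concat (map list_of_vec (data_samples E)) @ [data_radius E, threshold E]"
    by blast+
  moreover from mat_to_list_append_inject[OF _ _ n] inst have "data_T D = data_T E" and
    n: "list_of_vec (data_h D) @ concat (map list_of_vec (data_samples D)) @ [data_radius D, threshold D] =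
      list_of_vec (data_h E) @ concat (map list_of_vec (data_samples E)) @ [data_radius E, threshold E]"
    by blast+
  moreover from list_of_vec_append_inject[OF _ _ n] inst have "data_h D = data_h E" and
    n: "concat (map list_of_vec (data_samples D)) @ [data_radius D, threshold D] =
      concat (map list_of_vec (data_samples E)) @ [data_radius E, threshold E]"
    by blast+
  moreover have "data_samples D = data_samples E \<and>
      [data_radius D, threshold D] = [data_radius E, threshold E]"
    by (rule concat_append_inject[OF _ _ _ _ n, where k = "dim_M D"])
       (use inst dims in \<open>auto dest: arg_cong[where f = vec_of_list] simp: vec_list\<close>)
  ultimately show ?thesis using dims by simp
qed

definition rat_magnitude :: "rat \<Rightarrow> nat" where
  "rat_magnitude r = (case quotient_of r of (a, b) \<Rightarrow> max (nat \<bar>a\<bar>) (nat b))"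

text \<open>The dimensions and the number of samples need not be included, as they are bounded by the
  length of the encoding.\<close>

definition max_number :: "instance_data \<Rightarrow> nat" where
  "max_number D = Max (rat_magnitude ` set (data_numbers D))"

end

theory Submission
  imports Defs
begin

text \<open>
  The runs of a verifier are tilings in which every cell carries the symbols of all tapes at one
  position together with the state and the scanned symbols, so that legality concerns only windows
  \<open>p\<close>, \<open>p + 1\<close>, \<open>p + 2\<close>, \<open>p + W + 1\<close>. This reduces every problem in NP to the satisfiability of
  clauses given by finitely many schemes with one parameter \<open>p\<close> below a polynomial bound.

  The radius exceeds the diameter of the hypercube, so the optimal value is the largest loss at a
  vertex. (i) Under the constraint \<open>0 \<ge> 0\<close> the loss is \<open>0\<close> if \<open>q(\<xi>) \<ge> 0\<close> and \<open>-\<infinity>\<close> otherwise, and clauses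
  are linear inequalities in \<open>\<xi>\<close>. (ii) The minimum of \<open>\<Sum>\<^sub>c y\<^sub>c\<close> such that \<open>y\<^sub>c\<close> is at least the value of
  every literal of \<open>c\<close> counts the satisfied clauses. For \<open>N\<^sub>2 = 2\<close>, slack variables turn the inequalities
  into equations, which are aggregated into a single one \<open>a \<xi> = b\<close> as digits in a large base; this
  is the pair of inequalities \<open>a \<xi> - b \<ge> 0\<close> and \<open>b - a \<xi> \<ge> 0\<close>.

  The entries of the instances are arithmetic expressions in the loop counters of nested loops, and
  counters are head positions of a Turing machine.
\<close>

section \<open>Counter programs\<close>

text \<open>Hardness is defined through verifiers on Turing machines, so the reduction itself must
  be a machine; the counter programs serve to write one down. Counters are unary: in polynomial time
  a counter never exceeds a polynomial in the input length. This is harmless for the strong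
  statements, whose entries are small, but the coefficients of the single aggregated equation are
  exponential. They are never computed: the base is a power of two that depends on the clause
  schemes only, so the code of a coefficient is a concatenation of codes of digits, each taken from
  a fixed table. Satisfiability keeps the shape in which the tableau yields it: within one clause
  all literals have the same sign, so a clause is a bound on the number of its true variables. This
  serves the inequalities and the equations with slack alike. The radius is a polynomial in the
  dimension that bounds the distance of any two vertices. Here the growth assumption on the norm
  enters, and it keeps the radius small enough for strong hardness.\<close>

datatype action = Inc nat | Dec nat | Out bool
datatype test = NZ nat | In1 | InNB
datatype com = Skip | Act action | Then com com (infixr ";;" 60) | While test com | Cond test com com

text \<open>Register 0 is the head on the input, so \<open>In1\<close> and \<open>InNB\<close> need
  no argument; they test for a bit 1 and for a cell inside the input.\<close>

fun holds :: "bool list \<Rightarrow> (nat \<Rightarrow> nat) \<Rightarrow> test \<Rightarrow> bool" where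
  "holds x \<rho> (NZ r) \<longleftrightarrow> \<rho> r \<noteq> 0"
| "holds x \<rho> In1 \<longleftrightarrow> \<rho> 0 < length x \<and> x ! \<rho> 0"
| "holds x \<rho> InNB \<longleftrightarrow> \<rho> 0 < length x"

text \<open>The times are exact. They count every application of \<open>cstep\<close>, including the
  one that discards the \<open>Skip\<close> left over by the first half of a sequence or by a loop
  body; this is the source of \<open>Suc t2\<close>.\<close>

inductive exec :: "bool list \<Rightarrow> com \<Rightarrow> (nat \<Rightarrow> nat) \<times> bool list \<Rightarrow> nat \<Rightarrow> (nat \<Rightarrow> nat) \<times> bool list \<Rightarrow> bool"
  for x where
  Skip: "exec x Skip s 0 s"
| Inc: "exec x (Act (Inc r)) (\<rho>, w) 1 (\<rho>(r := Suc (\<rho> r)), w)"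
| Dec: "\<rho> r \<noteq> 0 \<Longrightarrow> exec x (Act (Dec r)) (\<rho>, w) 1 (\<rho>(r := \<rho> r - 1), w)"
| Out: "exec x (Act (Out b)) (\<rho>, w) 1 (\<rho>, w @ [b])"
| Then: "exec x c1 s t1 s' \<Longrightarrow> exec x c2 s' t2 s'' \<Longrightarrow> exec x (c1 ;; c2) s (t1 + Suc t2) s''"
| While_False: "\<not> holds x (fst s) b \<Longrightarrow> exec x (While b c) s 1 s"
| While_True: "holds x (fst s) b \<Longrightarrow> exec x c s t1 s' \<Longrightarrow> exec x (While b c) s' t2 s'' \<Longrightarrow>
    exec x (While b c) s (Suc t1 + Suc t2) s''"
| Cond_True: "holds x (fst s) b \<Longrightarrow> exec x c1 s t s' \<Longrightarrow> exec x (Cond b c1 c2) s (Suc t) s'"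
| Cond_False: "\<not> holds x (fst s) b \<Longrightarrow> exec x c2 s t s' \<Longrightarrow> exec x (Cond b c1 c2) s (Suc t) s'"

section \<open>Small-step semantics with finitely many residual programs\<close>

fun cstep :: "(test \<Rightarrow> bool) \<Rightarrow> com \<Rightarrow> com \<times> action option" where
  "cstep H Skip = (Skip, None)"
| "cstep H (Act a) = (Skip, Some a)"
| "cstep H (c1 ;; c2) = (if c1 = Skip then (c2, None) else (fst (cstep H c1) ;; c2, snd (cstep H c1)))"
| "cstep H (While b c) = (if H b then c ;; While b c else Skip, None)"
| "cstep H (Cond b c1 c2) = (if H b then c1 else c2, None)"

text \<open>A superset of the residual programs that \<open>cstep\<close> can reach. A loop puts
  itself behind each residual of its body, so unrolling stays in the same set; its finitely many
  elements become the states of the machine.\<close>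

fun conts :: "com \<Rightarrow> com set" where
  "conts Skip = {Skip}"
| "conts (Act a) = {Act a, Skip}"
| "conts (c1 ;; c2) = (\<lambda>c. c ;; c2) ` conts c1 \<union> conts c2"
| "conts (While b c) = {While b c, Skip} \<union> (\<lambda>c'. c' ;; While b c) ` conts c"
| "conts (Cond b c1 c2) = {Cond b c1 c2} \<union> conts c1 \<union> conts c2"

lemma finite_conts: "finite (conts c)"
  by (induction c) auto

lemma self_in_conts: "c \<in> conts c"
  by (induction c) auto

lemma Skip_in_conts: "Skip \<in> conts c"
  by (induction c) auto

lemma conts_closed: "c' \<in> conts c \<Longrightarrow> fst (cstep H c') \<in> conts c"
  by (induction c arbitrary: c') (auto simp: self_in_conts Skip_in_conts split: if_splits)

text \<open>\<open>NZ 0\<close> is excluded: tape 0 carries the input, so its cell 0 cannot carry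
  the mark by which the machine recognises the value 0.\<close>

fun test_ok :: "nat \<Rightarrow> test \<Rightarrow> bool" where
  "test_ok k (NZ r) \<longleftrightarrow> 0 < r \<and> r \<le> k"
| "test_ok k b \<longleftrightarrow> True"

fun action_ok :: "nat \<Rightarrow> action \<Rightarrow> bool" where
  "action_ok k (Inc r) \<longleftrightarrow> r \<le> k"
| "action_ok k (Dec r) \<longleftrightarrow> r \<le> k"
| "action_ok k (Out b) \<longleftrightarrow> True"

fun com_ok :: "nat \<Rightarrow> com \<Rightarrow> bool" where
  "com_ok k Skip \<longleftrightarrow> True"
| "com_ok k (Act a) \<longleftrightarrow> action_ok k a"
| "com_ok k (c1 ;; c2) \<longleftrightarrow> com_ok k c1 \<and> com_ok k c2"
| "com_ok k (While b c) \<longleftrightarrow> test_ok k b \<and> com_ok k c"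
| "com_ok k (Cond b c1 c2) \<longleftrightarrow> test_ok k b \<and> com_ok k c1 \<and> com_ok k c2"

lemma com_ok_mono: "com_ok k c \<Longrightarrow> k \<le> k' \<Longrightarrow> com_ok k' c"
proof (induction c)
  case (Act a)
  then show ?case by (cases a) auto
next
  case (While b c)
  then show ?case by (cases b) auto
next
  case (Cond b c1 c2)
  then show ?case by (cases b) auto
qed auto

lemma com_ok_conts: "c' \<in> conts c \<Longrightarrow> com_ok k c \<Longrightarrow> com_ok k c'"
  by (induction c arbitrary: c') auto

text \<open>The outcome of tests is a parameter of \<open>cstep\<close> because the function is used
  both with tests on integer registers and with tests on scanned symbols; this lemma exchanges the
  two.\<close>

lemma cstep_cong:
  "com_ok k c \<Longrightarrow> (\<And>b. test_ok k b \<Longrightarrow> H b = H' b) \<Longrightarrow> cstep H c = cstep H' c"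
  by (induction c) auto

lemma cstep_action_ok: "com_ok k c \<Longrightarrow> snd (cstep H c) = Some a \<Longrightarrow> action_ok k a"
  by (induction c) (auto split: if_splits)

text \<open>Registers become head positions, so the small-step semantics works with integers, for which
  decrementing commutes with moving a head.\<close>

fun iholds :: "bool list \<Rightarrow> (nat \<Rightarrow> int) \<Rightarrow> test \<Rightarrow> bool" where
  "iholds x p (NZ r) \<longleftrightarrow> p r \<noteq> 0"
| "iholds x p In1 \<longleftrightarrow> tape_of x (p 0) = 2"
| "iholds x p InNB \<longleftrightarrow> tape_of x (p 0) \<noteq> 0"

fun perform :: "action option \<Rightarrow> (nat \<Rightarrow> int) \<times> bool list \<Rightarrow> (nat \<Rightarrow> int) \<times> bool list" where
  "perform None s = s"
| "perform (Some (Inc r)) (p, w) = (p(r := p r + 1), w)"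
| "perform (Some (Dec r)) (p, w) = (p(r := p r - 1), w)"
| "perform (Some (Out b)) (p, w) = (p, w @ [b])"

definition sstep :: "bool list \<Rightarrow> com \<times> (nat \<Rightarrow> int) \<times> bool list \<Rightarrow> com \<times> (nat \<Rightarrow> int) \<times> bool list" where
  "sstep x = (\<lambda>(c, s). let (c', a) = cstep (iholds x (fst s)) c in (c', perform a s))"

lemma iholds_int: "iholds x (\<lambda>r. int (\<rho> r)) b = holds x \<rho> b"
  by (cases b) (auto simp: tape_of_def bit_symbol_def)

lemma sstep_Then: "c \<noteq> Skip \<Longrightarrow> sstep x (c ;; c2, s) = (case sstep x (c, s) of (c', s') \<Rightarrow> (c' ;; c2, s'))"
  by (simp add: sstep_def split: prod.splits)

text \<open>No step leaves \<open>Skip\<close>, because \<open>Skip\<close> corresponds to the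
  halting state and \<open>represents_step\<close> speaks of the other residuals only.\<close>

inductive reach :: "bool list \<Rightarrow> com \<times> (nat \<Rightarrow> int) \<times> bool list \<Rightarrow> nat \<Rightarrow>
    com \<times> (nat \<Rightarrow> int) \<times> bool list \<Rightarrow> bool" for x where
  stop: "reach x s 0 s"
| step: "fst s \<noteq> Skip \<Longrightarrow> reach x (sstep x s) n s' \<Longrightarrow> reach x s (Suc n) s'"

lemma reach_trans: "reach x s m s' \<Longrightarrow> reach x s' n s'' \<Longrightarrow> reach x s (m + n) s''"
  by (induction rule: reach.induct) (auto intro: reach.intros)

lemma reach_Then: "reach x s n s' \<Longrightarrow> reach x (fst s ;; c2, snd s) n (fst s' ;; c2, snd s')"
proof (induction rule: reach.induct)
  case (step s n s')
  then have "reach x (sstep x (fst s ;; c2, snd s)) n (fst s' ;; c2, snd s')"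
    by (simp add: sstep_Then prod.case_eq_if)
  then show ?case by (intro reach.step) auto
qed (auto intro: reach.stop)

abbreviation (input) istate :: "(nat \<Rightarrow> nat) \<times> bool list \<Rightarrow> (nat \<Rightarrow> int) \<times> bool list" where
  "istate s \<equiv> (\<lambda>r. int (fst s r), snd s)"

lemma exec_reach: "exec x c s t s' \<Longrightarrow> reach x (c, istate s) t (Skip, istate s')"
proof (induction rule: exec.induct)
  case (Skip s)
  then show ?case by (auto intro: reach.stop)
next
  case (Inc r \<rho> w)
  have "(\<lambda>i. int (\<rho> i))(r := int (\<rho> r) + 1) = (\<lambda>i. int ((\<rho>(r := Suc (\<rho> r))) i))" by auto
  then show ?case
    by (simp del: fun_upd_apply) (intro reach.step; simp add: sstep_def reach.stop del: fun_upd_apply)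
next
  case (Dec \<rho> r w)
  then have "(\<lambda>i. int (\<rho> i))(r := int (\<rho> r) - 1) = (\<lambda>i. int ((\<rho>(r := \<rho> r - 1)) i))" by auto
  then show ?case
    by (simp del: fun_upd_apply) (intro reach.step; simp add: sstep_def reach.stop del: fun_upd_apply)
next
  case (Out b \<rho> w)
  then show ?case by simp (intro reach.step; simp add: sstep_def reach.stop)
next
  case (Then c1 s t1 s' c2 t2 s'')
  from reach_Then[OF Then.IH(1), of c2]
  have "reach x (c1 ;; c2, istate s) t1 (Skip ;; c2, istate s')" by simp
  moreover have "reach x (Skip ;; c2, istate s') (Suc t2) (Skip, istate s'')"
    by (intro reach.step) (use Then.IH(2) in \<open>auto simp: sstep_def\<close>)
  ultimately show ?case by (rule reach_trans)
next
  case (While_False s b c)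
  then show ?case by simp (intro reach.step; simp add: sstep_def reach.stop iholds_int)
next
  case (While_True s b c t1 s' t2 s'')
  let ?w = "While b c"
  have "reach x (sstep x (?w, istate s)) t1 (Skip ;; ?w, istate s')"
    using reach_Then[OF While_True.IH(1), of ?w] While_True.hyps by (simp add: sstep_def iholds_int)
  then have "reach x (?w, istate s) (Suc t1) (Skip ;; ?w, istate s')"
    by (intro reach.step) auto
  moreover have "reach x (Skip ;; ?w, istate s') (Suc t2) (Skip, istate s'')"
    by (intro reach.step) (use While_True.IH(2) in \<open>auto simp: sstep_def\<close>)
  ultimately show ?case by (rule reach_trans)
next
  case (Cond_True s b c1 t s' c2)
  then show ?case by (intro reach.step) (auto simp: sstep_def iholds_int)
next
  case (Cond_False s b c2 t s' c1)
  then show ?case by (intro reach.step) (auto simp: sstep_def iholds_int)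
qed

section \<open>Simulation of counter programs by Turing machines\<close>

fun scanned :: "nat list \<Rightarrow> test \<Rightarrow> bool" where
  "scanned s (NZ r) \<longleftrightarrow> s ! r \<noteq> 1"
| "scanned s In1 \<longleftrightarrow> s ! 0 = 2"
| "scanned s InNB \<longleftrightarrow> s ! 0 \<noteq> 0"

fun tape_action :: "nat \<Rightarrow> nat list \<Rightarrow> action option \<Rightarrow> nat \<Rightarrow> nat \<times> head_move" where
  "tape_action k s None i = (s ! i, Stay)"
| "tape_action k s (Some (Inc r)) i = (s ! i, if i = r then Move_right else Stay)"
| "tape_action k s (Some (Dec r)) i = (s ! i, if i = r then Move_left else Stay)"
| "tape_action k s (Some (Out b)) i = (if i = Suc k then (bit_symbol b, Move_right) else (s ! i, Stay))"

text \<open>Tape 0 holds the input; the position of the head on tape \<open>r\<close> is the value of register \<open>r\<close>,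
  the cell 0 of the tapes \<open>1, \<dots>, k\<close> being marked so that the value 0 can be recognised; tape \<open>k + 1\<close>
  holds the output.\<close>

locale com_tm =
  fixes c :: com and k :: nat and g :: "com \<Rightarrow> nat"
  assumes ok: "com_ok k c" and g: "bij_betw g (conts c) {..<card (conts c)}"
begin

text \<open>The machine model fixes 0 and 1 as initial and halting state, so residual programs are
  numbered from 2, and \<open>Skip\<close>, where a program has ended, is the halting state
  itself.\<close>

definition num :: "com \<Rightarrow> nat" where
  "num c' = (if c' = Skip then 1 else g c' + 2)"

definition cont :: "nat \<Rightarrow> com" where
  "cont q = the_inv_into (conts c) g (q - 2)"

text \<open>State 0 is left after one step, which writes the marks of the register tapes while all
  heads still stand on cell 0. The output tape gets no mark, as its cell 0 receives the first output
  bit.\<close>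

definition machine :: tm where
  "machine = \<lparr>tm_tapes = k + 2, tm_states = card (conts c) + 2, tm_symbols = 3,
    tm_delta = (\<lambda>q s.
      if q = 0 then (num c, map (\<lambda>i. (if 1 \<le> i \<and> i \<le> k then 1 else s ! i, Stay)) [0..<k + 2])
      else if q = 1 then (1, map (\<lambda>i. (s ! i, Stay)) [0..<k + 2])
      else (num (fst (cstep (scanned s) (cont q))),
        map (tape_action k s (snd (cstep (scanned s) (cont q)))) [0..<k + 2]))\<rparr>"

lemma num_less: "c' \<in> conts c \<Longrightarrow> num c' < card (conts c) + 2"
  using bij_betwE[OF g] by (auto simp: num_def)

lemma num_pos: "num c' \<noteq> 0"
  by (simp add: num_def)

lemma num_eq_1: "num c' = 1 \<longleftrightarrow> c' = Skip"
  by (simp add: num_def)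

lemma cont_num: "c' \<in> conts c \<Longrightarrow> c' \<noteq> Skip \<Longrightarrow> cont (num c') = c'"
  using g by (simp add: num_def cont_def the_inv_into_f_f bij_betw_def)

lemma cont_in: "2 \<le> q \<Longrightarrow> q < card (conts c) + 2 \<Longrightarrow> cont q \<in> conts c"
  unfolding cont_def using g by (auto simp: bij_betw_def intro!: the_inv_into_into)

lemma nth_less_bound: "set s \<subseteq> {..<b} \<Longrightarrow> i < length s \<Longrightarrow> s ! i < (b :: nat)"
  by (auto simp: subset_iff)

lemma fst_tape_action: "length s = k + 2 \<Longrightarrow> set s \<subseteq> {..<3} \<Longrightarrow> i < k + 2 \<Longrightarrow> fst (tape_action k s a i) < 3"
proof -
  assume "length s = k + 2" "set s \<subseteq> {..<3}" "i < k + 2"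
  then have "s ! i < 3" by (simp add: nth_less_bound)
  then show ?thesis by (cases "(k, s, a, i)" rule: tape_action.cases) (auto simp: bit_symbol_def)
qed

lemma machine_wf: "tm_wf machine"
  unfolding tm_wf_def
proof (intro conjI allI impI)
  fix q s assume q: "q < tm_states machine" and s: "length s = tm_tapes machine \<and> set s \<subseteq> {..<tm_symbols machine}"
  have s3: "s ! i < 3" if "i < k + 2" for i
    using s that nth_less_bound[of s 3 i] by (simp add: machine_def)
  have "num (fst (cstep (scanned s) (cont q))) < card (conts c) + 2" if "2 \<le> q"
    using q that by (intro num_less conts_closed cont_in) (auto simp: machine_def)
  then show "case tm_delta machine q s of (q', as) \<Rightarrow>
      q' < tm_states machine \<and> length as = tm_tapes machine \<and> (\<forall>a\<in>set as. fst a < tm_symbols machine)"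
    using s num_less[OF self_in_conts] fst_tape_action[of s] s3
    by (auto simp: machine_def)
qed (auto simp: machine_def)

definition represents :: "bool list \<Rightarrow> com \<times> (nat \<Rightarrow> int) \<times> bool list \<Rightarrow> tm_config \<Rightarrow> bool" where
  "represents x = (\<lambda>(c', p, w) (q, pos, tp). q = num c' \<and> (\<forall>i\<le>k. pos i = p i) \<and>
     pos (Suc k) = int (length w) \<and> tp 0 = tape_of x \<and>
     (\<forall>i. 1 \<le> i \<and> i \<le> k \<longrightarrow> tp i = (\<lambda>z. if z = 0 then 1 else 0)) \<and> tp (Suc k) = tape_of w)"

lemma tape_of_append: "(tape_of w)(int (length w) := bit_symbol b) = tape_of (w @ [b])"
  by (rule ext) (auto simp: tape_of_def nth_append less_Suc_eq_le)

text \<open>An action moves at most one head, and outside the output tape the scanned symbol is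
  written back, so the marks survive. On a register tape the mark is scanned exactly at position 0,
  hence both kinds of tests agree.\<close>

lemma represents_step:
  assumes R: "represents x (c', p, w) (q, pos, tp)" and c': "c' \<in> conts c" "c' \<noteq> Skip"
  shows "represents x (sstep x (c', p, w)) (tm_step machine (q, pos, tp))"
proof -
  define s where "s = map (\<lambda>i. tp i (pos i)) [0..<k + 2]"
  have q: "q = num c'" "q \<noteq> 0" "q \<noteq> 1" using R num_pos num_eq_1 c' by (auto simp: represents_def)
  have eq: "cstep (scanned s) c' = cstep (iholds x p) c'"
  proof (rule cstep_cong[OF com_ok_conts[OF c'(1) ok]])
    fix b assume "test_ok k b"
    then show "scanned s b = iholds x p b"
      using R by (cases b) (auto simp: s_def represents_def simp del: upt_Suc)
  qed
  obtain c'' a where ca: "cstep (iholds x p) c' = (c'', a)" by fastforce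
  have aok: "action_ok k a'" if "a = Some a'" for a'
    using cstep_action_ok[OF com_ok_conts[OF c'(1) ok], of "iholds x p" a'] ca that by simp
  have step: "tm_step machine (q, pos, tp) = (num c'',
      (\<lambda>i. if i < k + 2 then pos i + shift (snd (tape_action k s a i)) else pos i),
      (\<lambda>i. if i < k + 2 then (tp i)(pos i := fst (tape_action k s a i)) else tp i))"
  proof -
    have "cont q = c'" using q(1) cont_num c' by simp
    then have "tm_delta machine q s = (num c'', map (tape_action k s a) [0..<k + 2])"
      using q(2,3) by (simp add: machine_def eq ca del: upt_Suc)
    moreover have "tm_tapes machine = k + 2" by (simp add: machine_def)
    moreover have "map (\<lambda>i. tp i (pos i)) [0..<Suc (Suc k)] = s" by (simp add: s_def del: upt_Suc)
    ultimately show ?thesis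
      using q(3) by (simp add: tm_step_def fun_eq_iff del: upt_Suc)
  qed
  have nth: "s ! i = tp i (pos i)" if "i < k + 2" for i using that by (simp add: s_def del: upt_Suc)
  have "represents x (c'', perform a (p, w)) (tm_step machine (q, pos, tp))"
  proof (cases a)
    case None
    then show ?thesis using R unfolding step by (auto simp: represents_def nth simp del: upt_Suc)
  next
    case (Some a')
    with aok have ok': "action_ok k a'" by simp
    have out: "tp (Suc k) = tape_of w" "pos (Suc k) = int (length w)" using R by (auto simp: represents_def)
    show ?thesis
    proof (cases a')
      case (Out b)
      then show ?thesis using R unfolding step Some
        by (auto simp: represents_def nth tape_of_append[symmetric] simp del: upt_Suc)
    next
      case (Inc r)
      then show ?thesis using R ok' unfolding step Some
        by (auto simp: represents_def nth simp del: upt_Suc)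
    next
      case (Dec r)
      then show ?thesis using R ok' unfolding step Some
        by (auto simp: represents_def nth simp del: upt_Suc)
    qed
  qed
  then show ?thesis by (simp add: sstep_def ca)
qed

lemma represents_reach:
  "reach x s n s' \<Longrightarrow> fst s \<in> conts c \<Longrightarrow> represents x s C \<Longrightarrow> represents x s' ((tm_step machine ^^ n) C)"
proof (induction arbitrary: C rule: reach.induct)
  case (step s n s')
  obtain c' p w where s: "s = (c', p, w)" by (cases s)
  obtain q pos tp where C: "C = (q, pos, tp)" by (cases C)
  have "represents x (sstep x s) (tm_step machine C)"
    using represents_step step.prems step.hyps s C by auto
  moreover have "fst (sstep x s) \<in> conts c"
    using conts_closed step.prems(1) s by (auto simp: sstep_def split: prod.splits) (metis fst_conv)
  ultimately show ?case using step.IH by (simp add: funpow_swap1)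
qed simp

lemma represents_init: "represents x (c, (\<lambda>_. 0), []) (tm_step machine (tm_init [x]))"
  by (auto simp: represents_def tm_step_def machine_def tm_init_def tape_of_def fun_eq_iff simp del: upt_Suc)

lemma machine_outputs:
  assumes "exec x c (\<lambda>_. 0, []) t (\<rho>, w)"
  shows "tm_outputs machine [x] (Suc t) w"
proof -
  obtain q pos tp where c: "(tm_step machine ^^ Suc t) (tm_init [x]) = (q, pos, tp)"
    by (metis prod_cases3)
  have run: "represents x (Skip, \<lambda>r. int (\<rho> r), w) ((tm_step machine ^^ t) C)"
    if "represents x (c, (\<lambda>_. 0), []) C" for C
    using represents_reach[OF exec_reach[OF assms]] self_in_conts that by simp
  have "represents x (Skip, \<lambda>r. int (\<rho> r), w) (q, pos, tp)"
    using run[OF represents_init[of x]] c by (simp add: funpow_swap1)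
  then show ?thesis unfolding tm_outputs_def c
    by (auto simp: represents_def num_def machine_def tape_of_def)
qed

end

lemma tm_halted: "fst C = 1 \<Longrightarrow> (tm_step M ^^ n) C = C"
  by (induction n) (auto simp: tm_step_def split: prod.splits)

lemma tm_outputs_mono: "tm_outputs M ws t y \<Longrightarrow> t \<le> t' \<Longrightarrow> tm_outputs M ws t' y"
proof -
  assume o: "tm_outputs M ws t y" and "t \<le> t'"
  then obtain d where "t' = d + t" using le_Suc_ex by (metis add.commute)
  moreover have "fst ((tm_step M ^^ t) (tm_init ws)) = 1"
    using o by (auto simp: tm_outputs_def split: prod.splits)
  ultimately show ?thesis using o by (simp add: tm_outputs_def funpow_add tm_halted)
qed

theorem poly_time_com:
  fixes p :: "nat poly"
  assumes ok: "com_ok k c"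
    and run: "\<And>x. \<exists>t \<rho>. t \<le> poly p (length x) \<and> exec x c (\<lambda>_. 0, []) t (\<rho>, f x)"
  shows "poly_time 1 (\<lambda>ws. f (ws ! 0))"
proof -
  obtain g where g: "bij_betw g (conts c) {..<card (conts c)}"
    using ex_bij_betw_finite_nat[OF finite_conts] by (auto simp: atLeast0LessThan)
  interpret com_tm c k g using ok g by unfold_locales
  \<comment> \<open>The additional step is the one that writes the marks.\<close>
  have "tm_outputs machine ws (poly (p + 1) (sum_list (map length ws))) (f (ws ! 0))" if "length ws = 1" for ws
  proof -
    obtain x where ws: "ws = [x]" using \<open>length ws = 1\<close> by (auto simp: length_Suc_conv)
    obtain t \<rho> where "t \<le> poly p (length x)" and e: "exec x c (\<lambda>_. 0, []) t (\<rho>, f x)"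
      using run by blast
    then show ?thesis using tm_outputs_mono[OF machine_outputs[OF e]] ws by simp
  qed
  then show ?thesis unfolding poly_time_def using machine_wf
    by (intro exI[of _ machine] exI[of _ "p + 1"]) (auto simp: machine_def)
qed

section \<open>Upper bounds for running times\<close>

definition runs :: "bool list \<Rightarrow> com \<Rightarrow> (nat \<Rightarrow> nat) \<times> bool list \<Rightarrow> nat \<Rightarrow> (nat \<Rightarrow> nat) \<times> bool list \<Rightarrow> bool" where
  "runs x c s b s' \<longleftrightarrow> (\<exists>t \<le> b. exec x c s t s')"

lemma runs_cong: "runs x c s b s1 \<Longrightarrow> s1 = s' \<Longrightarrow> b \<le> b' \<Longrightarrow> runs x c s b' s'"
  unfolding runs_def using le_trans by blast

lemma runs_Skip: "runs x Skip s b s"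
  unfolding runs_def using exec.Skip by blast

lemma runs_Inc: "runs x (Act (Inc r)) (\<rho>, w) 1 (\<rho>(r := Suc (\<rho> r)), w)"
  unfolding runs_def using exec.Inc by blast

lemma runs_Dec: "\<rho> r \<noteq> 0 \<Longrightarrow> runs x (Act (Dec r)) (\<rho>, w) 1 (\<rho>(r := \<rho> r - 1), w)"
  unfolding runs_def using exec.Dec by blast

lemma runs_Out: "runs x (Act (Out b)) (\<rho>, w) 1 (\<rho>, w @ [b])"
  unfolding runs_def using exec.Out by blast

lemma runs_Then: "runs x c1 s b1 s' \<Longrightarrow> runs x c2 s' b2 s'' \<Longrightarrow> runs x (c1 ;; c2) s (b1 + b2 + 1) s''"
proof -
  assume "runs x c1 s b1 s'" "runs x c2 s' b2 s''"
  then obtain t1 t2 where "t1 \<le> b1" "exec x c1 s t1 s'" "t2 \<le> b2" "exec x c2 s' t2 s''"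
    by (auto simp: runs_def)
  then show ?thesis unfolding runs_def by (intro exI[of _ "t1 + Suc t2"] conjI exec.Then) auto
qed

lemma runs_While_False: "\<not> holds x (fst s) b \<Longrightarrow> runs x (While b c) s 1 s"
  unfolding runs_def using exec.While_False by blast

lemma runs_While_True:
  "holds x (fst s) b \<Longrightarrow> runs x c s b1 s' \<Longrightarrow> runs x (While b c) s' b2 s'' \<Longrightarrow>
   runs x (While b c) s (b1 + b2 + 2) s''"
proof -
  assume h: "holds x (fst s) b" and "runs x c s b1 s'" "runs x (While b c) s' b2 s''"
  then obtain t1 t2 where "t1 \<le> b1" "exec x c s t1 s'" "t2 \<le> b2" "exec x (While b c) s' t2 s''"
    by (auto simp: runs_def)
  then show ?thesis unfolding runs_def using h
    by (intro exI[of _ "Suc t1 + Suc t2"] conjI exec.While_True) auto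
qed

lemma runs_Cond_True: "holds x (fst s) b \<Longrightarrow> runs x c1 s t s' \<Longrightarrow> runs x (Cond b c1 c2) s (Suc t) s'"
  unfolding runs_def using exec.Cond_True by (metis Suc_le_mono)

lemma runs_Cond_False: "\<not> holds x (fst s) b \<Longrightarrow> runs x c2 s t s' \<Longrightarrow> runs x (Cond b c1 c2) s (Suc t) s'"
  unfolding runs_def using exec.Cond_False by (metis Suc_le_mono)

text \<open>The invariant is given as the sequence \<open>st\<close> of the states before each
  iteration. The proof runs backwards: \<open>k\<close> counts the iterations that remain.\<close>

lemma runs_While:
  assumes "\<And>i. i < n \<Longrightarrow> holds x (fst (st i)) b" "\<And>i. i < n \<Longrightarrow> runs x c (st i) (t i) (st (Suc i))"
    and "\<not> holds x (fst (st n)) b"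
  shows "runs x (While b c) (st 0) ((\<Sum>i<n. t i + 2) + 1) (st n)"
proof -
  have "runs x (While b c) (st (n - k)) ((\<Sum>i=n-k..<n. t i + 2) + 1) (st n)" if "k \<le> n" for k
    using that
  proof (induction k)
    case 0
    then show ?case using runs_While_False[OF assms(3)] by simp
  next
    case (Suc k)
    then have "runs x (While b c) (st (n - k)) ((\<Sum>i=n-k..<n. t i + 2) + 1) (st n)" by simp
    then have "runs x (While b c) (st (Suc (n - Suc k))) ((\<Sum>i=n-k..<n. t i + 2) + 1) (st n)"
      using Suc.prems by (simp add: Suc_diff_Suc)
    then have "runs x (While b c) (st (n - Suc k)) (t (n - Suc k) + ((\<Sum>i=n-k..<n. t i + 2) + 1) + 2) (st n)"
      using Suc.prems by (intro runs_While_True[OF assms(1,2)]) auto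
    then show ?case
      by (rule runs_cong) (use Suc.prems in \<open>auto simp: sum.atLeast_Suc_lessThan[of "n - Suc k"] Suc_diff_Suc\<close>)
  qed
  from this[of n] show ?thesis by (simp add: atLeast0LessThan)
qed

lemma runs_While_const:
  assumes "\<And>i. i < n \<Longrightarrow> holds x (fst (st i)) b" "\<And>i. i < n \<Longrightarrow> runs x c (st i) t (st (Suc i))"
    and "\<not> holds x (fst (st n)) b"
  shows "runs x (While b c) (st 0) (n * (t + 2) + 1) (st n)"
  using runs_While[of n x st b c "\<lambda>_. t"] assms by simp

definition clear :: "nat \<Rightarrow> com" where
  "clear r = While (NZ r) (Act (Dec r))"

definition move :: "nat \<Rightarrow> nat \<Rightarrow> com" where
  "move r d = While (NZ r) (Act (Dec r) ;; Act (Inc d))"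

definition move2 :: "nat \<Rightarrow> nat \<Rightarrow> nat \<Rightarrow> com" where
  "move2 r d e = While (NZ r) (Act (Dec r) ;; Act (Inc d) ;; Act (Inc e))"

lemma runs_clear: "runs x (clear r) (\<rho>, w) (3 * \<rho> r + 1) (\<rho>(r := 0), w)"
proof -
  define st where "st i = (\<rho>(r := \<rho> r - i), w)" for i
  have "runs x (clear r) (st 0) (\<rho> r * (1 + 2) + 1) (st (\<rho> r))"
    unfolding clear_def st_def
    by (intro runs_While_const[where st = "\<lambda>i. (\<rho>(r := \<rho> r - i), w)"])
      (auto intro!: runs_cong[OF runs_Dec])
  from runs_cong[OF this, of "(\<rho>(r := 0), w)" "3 * \<rho> r + 1"] show ?thesis by (simp add: st_def)
qed

lemma runs_move:
  assumes "r \<noteq> d"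
  shows "runs x (move r d) (\<rho>, w) (5 * \<rho> r + 1) (\<rho>(r := 0, d := \<rho> d + \<rho> r), w)"
proof -
  define st where "st i = (\<rho>(r := \<rho> r - i, d := \<rho> d + i), w)" for i
  have "runs x (move r d) (st 0) (\<rho> r * (3 + 2) + 1) (st (\<rho> r))"
    unfolding move_def st_def using assms
    by (intro runs_While_const[where st = "\<lambda>i. (\<rho>(r := \<rho> r - i, d := \<rho> d + i), w)"])
      (auto intro!: runs_cong[OF runs_Then[OF runs_Dec runs_Inc]])
  then show ?thesis using assms by (simp add: st_def algebra_simps)
qed

lemma runs_move2:
  assumes "r \<noteq> d" "r \<noteq> e" "d \<noteq> e"
  shows "runs x (move2 r d e) (\<rho>, w) (7 * \<rho> r + 1) (\<rho>(r := 0, d := \<rho> d + \<rho> r, e := \<rho> e + \<rho> r), w)"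
proof -
  define st where "st i = (\<rho>(r := \<rho> r - i, d := \<rho> d + i, e := \<rho> e + i), w)" for i
  have "runs x (move2 r d e) (st 0) (\<rho> r * (5 + 2) + 1) (st (\<rho> r))"
    unfolding move2_def st_def using assms
    by (intro runs_While_const[where st = "\<lambda>i. (\<rho>(r := \<rho> r - i, d := \<rho> d + i, e := \<rho> e + i), w)"])
      (auto intro!: runs_cong[OF runs_Then[OF runs_Dec runs_Then[OF runs_Inc runs_Inc]]])
  then show ?thesis using assms by (simp add: st_def algebra_simps)
qed

section \<open>Arithmetic expressions\<close>

text \<open>Every operation keeps values polynomially bounded in the input length and the variables,
  as unary registers require. \<open>Bit\<close> gives access to the input, and the truncated
  \<open>Sub\<close> yields comparisons.\<close>

datatype aexp = Lit nat | Var nat | Len | Bit aexp | Add aexp aexp | Mul aexp aexp | Sub aexp aexp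

fun aval :: "aexp \<Rightarrow> bool list \<Rightarrow> (nat \<Rightarrow> nat) \<Rightarrow> nat" where
  "aval (Lit n) x env = n"
| "aval (Var v) x env = env v"
| "aval Len x env = length x"
| "aval (Bit a) x env = (if aval a x env < length x \<and> x ! aval a x env then 1 else 0)"
| "aval (Add a b) x env = aval a x env + aval b x env"
| "aval (Mul a b) x env = aval a x env * aval b x env"
| "aval (Sub a b) x env = aval a x env - aval b x env"

fun avars :: "aexp \<Rightarrow> nat set" where
  "avars (Lit n) = {}"
| "avars (Var v) = {v}"
| "avars Len = {}"
| "avars (Bit a) = avars a"
| "avars (Add a b) = avars a \<union> avars b"
| "avars (Mul a b) = avars a \<union> avars b"
| "avars (Sub a b) = avars a \<union> avars b"

lemma finite_avars: "finite (avars a)"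
  by (induction a) auto

lemma aval_cong: "(\<And>v. v \<in> avars a \<Longrightarrow> env v = env' v) \<Longrightarrow> aval a x env = aval a x env'"
  by (induction a) auto

text \<open>The code for an expression adds its value to register \<open>d\<close>, assuming that the registers from
  \<open>d\<close> onwards are zero; variable \<open>v\<close> is kept in register \<open>v + 1\<close>.\<close>

fun comp_aexp :: "aexp \<Rightarrow> nat \<Rightarrow> com" where
  "comp_aexp (Lit n) d = ((\<lambda>c. Act (Inc d) ;; c) ^^ n) Skip"
| "comp_aexp (Var v) d = move2 (Suc v) d (d + 1) ;; move (d + 1) (Suc v)"
| "comp_aexp Len d = While InNB (Act (Inc 0) ;; Act (Inc d) ;; Act (Inc (d + 1))) ;; While (NZ (d + 1)) (Act (Dec (d + 1)) ;; Act (Dec 0))"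
| "comp_aexp (Bit a) d = comp_aexp a d ;; move2 d 0 (d + 1) ;; Cond In1 (Act (Inc d)) Skip ;;
     While (NZ (d + 1)) (Act (Dec (d + 1)) ;; Act (Dec 0))"
| "comp_aexp (Add a b) d = comp_aexp a d ;; comp_aexp b (d + 1) ;; move (d + 1) d"
| "comp_aexp (Sub a b) d = comp_aexp a d ;; comp_aexp b (d + 1) ;;
     While (NZ (d + 1)) (Act (Dec (d + 1)) ;; Cond (NZ d) (Act (Dec d)) Skip)"
| "comp_aexp (Mul a b) d = comp_aexp a (d + 1) ;; comp_aexp b (d + 2) ;;
     While (NZ (d + 1)) (Act (Dec (d + 1)) ;; move2 (d + 2) d (d + 3) ;; move (d + 3) (d + 2)) ;;
     clear (d + 2)"

fun atime :: "aexp \<Rightarrow> bool list \<Rightarrow> (nat \<Rightarrow> nat) \<Rightarrow> nat" where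
  "atime (Lit n) x env = 2 * n"
| "atime (Var v) x env = 12 * env v + 3"
| "atime Len x env = 12 * length x + 3"
| "atime (Bit a) x env = atime a x env + 12 * aval a x env + 10"
| "atime (Add a b) x env = atime a x env + atime b x env + 5 * aval b x env + 10"
| "atime (Sub a b) x env = atime a x env + atime b x env + 6 * aval b x env + 10"
| "atime (Mul a b) x env = atime a x env + atime b x env +
     aval a x env * (12 * aval b x env + 7) + 3 * aval b x env + 10"

text \<open>The input head cannot be tested for position 0, so code that moves it keeps a copy of
  its position in an auxiliary register, which drives the loop back.\<close>

lemma runs_rewind:
  assumes "\<rho> 0 = \<rho> d" "d \<noteq> 0"
  shows "runs x (While (NZ d) (Act (Dec d) ;; Act (Dec 0))) (\<rho>, w) (5 * \<rho> d + 1) (\<rho>(0 := 0, d := 0), w)"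
proof -
  define st where "st i = (\<rho>(0 := \<rho> d - i, d := \<rho> d - i), w)" for i
  have "runs x (While (NZ d) (Act (Dec d) ;; Act (Dec 0))) (st 0) (\<rho> d * (3 + 2) + 1) (st (\<rho> d))"
    unfolding st_def using assms
    by (intro runs_While_const[where st = "\<lambda>i. (\<rho>(0 := \<rho> d - i, d := \<rho> d - i), w)"])
      (auto intro!: runs_cong[OF runs_Then[OF runs_Dec runs_Dec]])
  moreover have "st 0 = (\<rho>, w)" using assms by (auto simp: st_def)
  ultimately show ?thesis using assms by (simp add: st_def algebra_simps)
qed

text \<open>All registers except \<open>d\<close> end with their old values, in particular the input
  head at 0 and the registers above \<open>d\<close> at zero. This lets subexpressions be evaluated
  one after the other in neighbouring registers.\<close>

lemma runs_aexp:
  assumes "\<rho> 0 = 0" "\<And>r. d \<le> r \<Longrightarrow> \<rho> r = 0" "0 < d" "\<And>v. v \<in> avars a \<Longrightarrow> Suc v < d \<and> \<rho> (Suc v) = env v"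
  shows "runs x (comp_aexp a d) (\<rho>, w) (atime a x env) (\<rho>(d := aval a x env), w)"
  using assms
proof (induction a arbitrary: \<rho> d)
  case (Lit n)
  have "runs x (((\<lambda>c. Act (Inc d) ;; c) ^^ n) Skip) (\<rho>, w) (2 * n) (\<rho>(d := \<rho> d + n), w)" for \<rho>
  proof (induction n arbitrary: \<rho>)
    case 0
    then show ?case using runs_Skip by simp
  next
    case (Suc n)
    show ?case by (auto intro!: runs_cong[OF runs_Then[OF runs_Inc Suc]])
  qed
  moreover have "\<rho>(d := \<rho> d + n) = \<rho>(d := n)" using Lit.prems(2)[of d] by simp
  ultimately show ?case by (metis comp_aexp.simps(1) atime.simps(1) aval.simps(1))
next
  case (Var v)
  then have v: "Suc v < d" "\<rho> (Suc v) = env v" by auto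
  show ?case unfolding comp_aexp.simps
    by (rule runs_cong[OF runs_Then[OF runs_move2 runs_move]]) (use Var.prems v in auto)
next
  case Len
  define st where "st i = (\<rho>(0 := i, d := i, d + 1 := i), w)" for i
  have "runs x (While InNB (Act (Inc 0) ;; Act (Inc d) ;; Act (Inc (d + 1)))) (st 0) (length x * (5 + 2) + 1) (st (length x))"
    unfolding st_def using Len
    by (intro runs_While_const[where st = "\<lambda>i. (\<rho>(0 := i, d := i, d + 1 := i), w)"])
      (auto intro!: runs_cong[OF runs_Then[OF runs_Inc runs_Then[OF runs_Inc runs_Inc]]])
  moreover have "st 0 = (\<rho>, w)" using Len by (auto simp: st_def)
  ultimately have 1: "runs x (While InNB (Act (Inc 0) ;; Act (Inc d) ;; Act (Inc (d + 1)))) (\<rho>, w)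
      (length x * 7 + 1) (\<rho>(0 := length x, d := length x, d + 1 := length x), w)"
    by (simp add: st_def)
  show ?case unfolding comp_aexp.simps
    by (rule runs_cong[OF runs_Then[OF 1 runs_rewind]]) (use Len.prems in auto)
next
  case (Bit a)
  let ?v = "aval a x env"
  define \<rho>1 where "\<rho>1 = \<rho>(d := 0, 0 := ?v, d + 1 := ?v)"
  have 0: "runs x (comp_aexp a d) (\<rho>, w) (atime a x env) (\<rho>(d := ?v), w)"
    by (rule Bit.IH) (use Bit.prems in auto)
  have 1: "runs x (move2 d 0 (d + 1)) (\<rho>(d := ?v), w) (7 * ?v + 1) (\<rho>1, w)"
    by (rule runs_cong[OF runs_move2]) (use Bit.prems in \<open>auto simp: \<rho>1_def\<close>)
  have 2: "runs x (Cond In1 (Act (Inc d)) Skip) (\<rho>1, w) 2 (\<rho>1(d := aval (Bit a) x env), w)"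
  proof (cases "?v < length x \<and> x ! ?v")
    case True
    then show ?thesis using Bit.prems
      by (auto intro!: runs_cong[OF runs_Cond_True[OF _ runs_Inc]] simp: \<rho>1_def)
  next
    case False
    then show ?thesis using Bit.prems
      by (auto intro!: runs_cong[OF runs_Cond_False[OF _ runs_Skip]] simp: \<rho>1_def)
  qed
  have 3: "runs x (Cond In1 (Act (Inc d)) Skip ;; While (NZ (d + 1)) (Act (Dec (d + 1)) ;; Act (Dec 0)))
      (\<rho>1, w) (5 * ?v + 4) (\<rho>(d := aval (Bit a) x env), w)"
    by (rule runs_cong[OF runs_Then[OF 2 runs_rewind]]) (use Bit.prems in \<open>auto simp: \<rho>1_def\<close>)
  show ?case unfolding comp_aexp.simps
    by (rule runs_cong[OF runs_Then[OF 0 runs_Then[OF 1 3]]]) auto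
next
  case (Add a b)
  have vs: "Suc v < d" "v < d" "\<rho> (Suc v) = env v" if "v \<in> avars a \<union> avars b" for v
    using Add.prems(4)[of v] that by auto
  have 1: "runs x (comp_aexp a d) (\<rho>, w) (atime a x env) (\<rho>(d := aval a x env), w)"
    by (rule Add.IH(1)) (use Add.prems in auto)
  have 2: "runs x (comp_aexp b (d + 1)) (\<rho>(d := aval a x env), w) (atime b x env)
      (\<rho>(d := aval a x env, d + 1 := aval b x env), w)"
    by (rule Add.IH(2)) (use Add.prems(1-3) vs in \<open>auto simp: less_SucI\<close>)
  show ?case unfolding comp_aexp.simps
    by (rule runs_cong[OF runs_Then[OF 1 runs_Then[OF 2 runs_move]]]) (use Add.prems in auto)
next
  case (Sub a b)
  have vs: "Suc v < d" "v < d" "\<rho> (Suc v) = env v" if "v \<in> avars a \<union> avars b" for v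
    using Sub.prems(4)[of v] that by auto
  let ?a = "aval a x env" and ?b = "aval b x env"
  have 1: "runs x (comp_aexp a d) (\<rho>, w) (atime a x env) (\<rho>(d := ?a), w)"
    by (rule Sub.IH(1)) (use Sub.prems in auto)
  have 2: "runs x (comp_aexp b (d + 1)) (\<rho>(d := ?a), w) (atime b x env)
      (\<rho>(d := ?a, d + 1 := ?b), w)"
    by (rule Sub.IH(2)) (use Sub.prems(1-3) vs in \<open>auto simp: less_SucI\<close>)
  \<comment> \<open>\<open>?a - i\<close> stays 0 once it is reached, so \<open>?b\<close> rounds
    produce the truncated difference.\<close>
  let ?st = "\<lambda>i. (\<rho>(d := ?a - i, d + 1 := ?b - i), w)"
  have cond: "runs x (Cond (NZ d) (Act (Dec d)) Skip) (\<rho>, w) 2 (\<rho>(d := \<rho> d - 1), w)" for \<rho>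
  proof (cases "\<rho> d = 0")
    case True
    then have "\<rho>(d := \<rho> d - 1) = \<rho>" by auto
    then show ?thesis using True by (auto intro!: runs_cong[OF runs_Cond_False[OF _ runs_Skip]])
  next
    case False
    then show ?thesis by (auto intro!: runs_cong[OF runs_Cond_True[OF _ runs_Dec]])
  qed
  have 3: "runs x (While (NZ (d + 1)) (Act (Dec (d + 1)) ;; Cond (NZ d) (Act (Dec d)) Skip)) (?st 0) (?b * (4 + 2) + 1) (?st ?b)"
    by (rule runs_While_const) (auto intro!: runs_cong[OF runs_Then[OF runs_Dec cond]])
  show ?case unfolding comp_aexp.simps
    by (rule runs_cong[OF runs_Then[OF 1 runs_Then[OF 2 3[unfolded diff_zero]]]]) (use Sub.prems in auto)
next
  case (Mul a b)
  have vs: "Suc v < d" "v < d" "\<rho> (Suc v) = env v" if "v \<in> avars a \<union> avars b" for v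
    using Mul.prems(4)[of v] that by auto
  let ?a = "aval a x env" and ?b = "aval b x env"
  have 1: "runs x (comp_aexp a (d + 1)) (\<rho>, w) (atime a x env) (\<rho>(d + 1 := ?a), w)"
    by (rule Mul.IH(1)) (use Mul.prems(1-3) vs in \<open>auto simp: less_SucI\<close>)
  have 2: "runs x (comp_aexp b (d + 2)) (\<rho>(d + 1 := ?a), w) (atime b x env)
      (\<rho>(d + 1 := ?a, d + 2 := ?b), w)"
    by (rule Mul.IH(2)) (use Mul.prems(1-3) vs in \<open>auto simp: less_SucI\<close>)
  \<comment> \<open>Each round adds \<open>?b\<close> to the product in \<open>d\<close> and
    restores \<open>d + 2\<close> by way of \<open>d + 3\<close>.\<close>
  let ?st = "\<lambda>i. (\<rho>(d := i * ?b, d + 1 := ?a - i, d + 2 := ?b), w)"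
  have 3: "runs x (While (NZ (d + 1)) (Act (Dec (d + 1)) ;; move2 (d + 2) d (d + 3) ;; move (d + 3) (d + 2)))
      (?st 0) (?a * ((12 * ?b + 5) + 2) + 1) (?st ?a)"
    by (rule runs_While_const)
      (use Mul.prems in \<open>auto intro!: runs_cong[OF runs_Then[OF runs_Dec runs_Then[OF runs_move2 runs_move]]]\<close>)
  have st0: "?st 0 = (\<rho>(d + 1 := ?a, d + 2 := ?b), w)" using Mul.prems(2)[of d] by auto
  show ?case unfolding comp_aexp.simps
    by (rule runs_cong[OF runs_Then[OF 1 runs_Then[OF 2 runs_Then[OF 3[unfolded st0] runs_clear]]]])
      (use Mul.prems in \<open>auto simp: algebra_simps\<close>)
qed

section \<open>String generators\<close>

datatype gen = Emit "bool list" | Cat gen gen | For nat aexp gen | Branch aexp gen gen | Num aexp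

fun gsem :: "gen \<Rightarrow> bool list \<Rightarrow> (nat \<Rightarrow> nat) \<Rightarrow> bool list" where
  "gsem (Emit bs) x env = bs"
| "gsem (Cat g1 g2) x env = gsem g1 x env @ gsem g2 x env"
| "gsem (For v a g) x env = concat (map (\<lambda>i. gsem g x (env(v := i))) [0..<aval a x env])"
| "gsem (Branch a g1 g2) x env = (if aval a x env \<noteq> 0 then gsem g1 x env else gsem g2 x env)"
| "gsem (Num a) x env = enc_nat (aval a x env)"

fun gvars :: "gen \<Rightarrow> nat set" where
  "gvars (Emit bs) = {}"
| "gvars (Cat g1 g2) = gvars g1 \<union> gvars g2"
| "gvars (For v a g) = insert v (avars a \<union> gvars g)"
| "gvars (Branch a g1 g2) = avars a \<union> gvars g1 \<union> gvars g2"
| "gvars (Num a) = avars a"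

fun loopvars :: "gen \<Rightarrow> nat set" where
  "loopvars (Cat g1 g2) = loopvars g1 \<union> loopvars g2"
| "loopvars (For v a g) = insert v (loopvars g)"
| "loopvars (Branch a g1 g2) = loopvars g1 \<union> loopvars g2"
| "loopvars _ = {}"

text \<open>A loop over \<open>v\<close> counts register \<open>v + 1\<close> up from 0 and clears
  it at the end, so its body must not loop over \<open>v\<close> again. For the same reason
  \<open>runs_gen\<close> asks for loop variables that are 0 at the start.\<close>

fun gen_wf :: "gen \<Rightarrow> bool" where
  "gen_wf (Cat g1 g2) \<longleftrightarrow> gen_wf g1 \<and> gen_wf g2"
| "gen_wf (For v a g) \<longleftrightarrow> v \<notin> loopvars g \<and> gen_wf g"
| "gen_wf (Branch a g1 g2) \<longleftrightarrow> gen_wf g1 \<and> gen_wf g2"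
| "gen_wf _ \<longleftrightarrow> True"

lemma finite_gvars: "finite (gvars g)"
  by (induction g) (auto simp: finite_avars)

definition halve :: "nat \<Rightarrow> com" where
  "halve d = While (NZ d) (Act (Dec d) ;; Cond (NZ d) (Act (Dec d) ;; Act (Inc (d + 1))) (Act (Inc (d + 2))))"

definition comp_bits :: "nat \<Rightarrow> com" where
  "comp_bits d = While (NZ d) (Act (Out True) ;; halve d ;;
     Cond (NZ (d + 2)) (Act (Dec (d + 2)) ;; Act (Out True)) (Act (Out False)) ;; move (d + 1) d)"

text \<open>In a loop, register \<open>d\<close> holds the number of rounds that remain, so the body
  works from \<open>d + 1\<close> on.\<close>

fun comp_gen :: "gen \<Rightarrow> nat \<Rightarrow> com" where
  "comp_gen (Emit bs) d = foldr (\<lambda>b c. Act (Out b) ;; c) bs Skip"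
| "comp_gen (Cat g1 g2) d = comp_gen g1 d ;; comp_gen g2 d"
| "comp_gen (For v a g) d = comp_aexp a d ;;
     While (NZ d) (Act (Dec d) ;; comp_gen g (Suc d) ;; Act (Inc (Suc v))) ;; clear (Suc v)"
| "comp_gen (Branch a g1 g2) d = comp_aexp a d ;; Cond (NZ d) (clear d ;; comp_gen g1 d) (comp_gen g2 d)"
| "comp_gen (Num a) d = comp_aexp a d ;; comp_bits d ;; Act (Out False)"

fun gtime :: "gen \<Rightarrow> bool list \<Rightarrow> (nat \<Rightarrow> nat) \<Rightarrow> nat" where
  "gtime (Emit bs) x env = 2 * length bs"
| "gtime (Cat g1 g2) x env = gtime g1 x env + gtime g2 x env + 1"
| "gtime (For v a g) x env = atime a x env +
     (\<Sum>i<aval a x env. gtime g x (env(v := i)) + 6) + 3 * aval a x env + 4"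
| "gtime (Branch a g1 g2) x env = atime a x env + 3 * aval a x env + gtime g1 x env + gtime g2 x env + 6"
| "gtime (Num a) x env = atime a x env + aval a x env * (20 * aval a x env + 40) + 10"

lemma runs_halve:
  "runs x (halve d) (\<rho>, w) (9 * \<rho> d + 1)
     (\<rho>(d := 0, d + 1 := \<rho> (d + 1) + \<rho> d div 2, d + 2 := \<rho> (d + 2) + \<rho> d mod 2), w)"
proof (induction "\<rho> d" arbitrary: \<rho> rule: less_induct)
  case less
  consider "\<rho> d = 0" | "\<rho> d = 1" | n where "\<rho> d = Suc (Suc n)"
    by (metis One_nat_def not0_implies_Suc)
  then show ?case
  proof cases
    case 1
    then have "(\<rho>(d := 0, d + 1 := \<rho> (d + 1) + \<rho> d div 2, d + 2 := \<rho> (d + 2) + \<rho> d mod 2)) = \<rho>" by auto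
    then show ?thesis using runs_While_False[of x "(\<rho>, w)" "NZ d"] 1 unfolding halve_def by simp
  next
    case 2
    have 0: "runs x (Act (Dec d) ;; Cond (NZ d) (Act (Dec d) ;; Act (Inc (d + 1))) (Act (Inc (d + 2)))) (\<rho>, w) 4
        (\<rho>(d := 0, d + 2 := Suc (\<rho> (d + 2))), w)"
      using 2 by (intro runs_cong[OF runs_Then[OF runs_Dec runs_Cond_False[OF _ runs_Inc]]]) auto
    show ?thesis unfolding halve_def
      by (rule runs_cong[OF runs_While_True[OF _ 0 runs_While_False]]) (use 2 in auto)
  next
    case (3 n)
    have 1: "runs x (Act (Dec d) ;; Cond (NZ d) (Act (Dec d) ;; Act (Inc (d + 1))) (Act (Inc (d + 2)))) (\<rho>, w) 6
        (\<rho>(d := n, d + 1 := Suc (\<rho> (d + 1))), w)"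
      using 3 by (intro runs_cong[OF runs_Then[OF runs_Dec runs_Cond_True[OF _ runs_Then[OF runs_Dec runs_Inc]]]]) auto
    have "(\<rho>(d := n, d + 1 := Suc (\<rho> (d + 1)))) d < \<rho> d" using 3 by simp
    from less[of "\<rho>(d := n, d + 1 := Suc (\<rho> (d + 1)))", OF this] show ?thesis using 3 unfolding halve_def
      by (intro runs_cong[OF runs_While_True[OF _ 1]]) auto
  qed
qed

lemma runs_comp_bits:
  "\<rho> (d + 1) = 0 \<Longrightarrow> \<rho> (d + 2) = 0 \<Longrightarrow>
   runs x (comp_bits d) (\<rho>, w) (\<rho> d * (20 * \<rho> d + 40) + 1)
     (\<rho>(d := 0), w @ concat (map (\<lambda>b. [True, b]) (bits (\<rho> d))))"
proof (induction "\<rho> d" arbitrary: \<rho> w rule: less_induct)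
  case less
  let ?n = "\<rho> d"
  show ?case
  proof (cases "?n = 0")
    case True
    then have "\<rho>(d := 0) = \<rho>" by auto
    then show ?thesis using runs_While_False[of x "(\<rho>, w)" "NZ d"] True
      unfolding comp_bits_def by (simp add: bits.simps)
  next
    case False
    define \<rho>1 where "\<rho>1 = \<rho>(d := 0, d + 1 := ?n div 2, d + 2 := ?n mod 2)"
    define \<rho>2 where "\<rho>2 = \<rho>(d := ?n div 2)"
    have 1: "runs x (halve d) (\<rho>, w @ [True]) (9 * ?n + 1) (\<rho>1, w @ [True])"
      by (rule runs_cong[OF runs_halve]) (use less.prems in \<open>auto simp: \<rho>1_def\<close>)
    have 2: "runs x (Cond (NZ (d + 2)) (Act (Dec (d + 2)) ;; Act (Out True)) (Act (Out False))) (\<rho>1, w @ [True]) 4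
        (\<rho>1(d + 2 := 0), w @ [True] @ [odd ?n])"
    proof (cases "odd ?n")
      case True
      then show ?thesis
        by (intro runs_cong[OF runs_Cond_True[OF _ runs_Then[OF runs_Dec runs_Out]]]) (auto simp: \<rho>1_def odd_iff_mod_2_eq_one)
    next
      case False
      then show ?thesis
        by (intro runs_cong[OF runs_Cond_False[OF _ runs_Out]]) (auto simp: \<rho>1_def)
    qed
    have 3: "runs x (move (d + 1) d) (\<rho>1(d + 2 := 0), w @ [True] @ [odd ?n]) (5 * ?n + 1)
        (\<rho>2, w @ [True, odd ?n])"
      by (rule runs_cong[OF runs_move]) (use less.prems in \<open>auto simp: \<rho>1_def \<rho>2_def\<close>)
    have 4: "runs x (comp_bits d) (\<rho>2, w @ [True, odd ?n]) (\<rho>2 d * (20 * \<rho>2 d + 40) + 1)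
        (\<rho>2(d := 0), (w @ [True, odd ?n]) @ concat (map (\<lambda>b. [True, b]) (bits (\<rho>2 d))))"
      using False less.prems by (intro less.hyps) (auto simp: \<rho>2_def)
    \<comment> \<open>The call on the half uses at most half of the quadratic budget; the other half
      pays for the halving and the output of this round.\<close>
    have "?n div 2 * (20 * (?n div 2) + 40) \<le> ?n * (10 * ?n + 20)"
    proof -
      have "?n div 2 * (20 * (?n div 2) + 40) = (2 * (?n div 2)) * (10 * (?n div 2) + 20)" by (simp add: algebra_simps)
      also have "\<dots> \<le> ?n * (10 * ?n + 20)" by (intro mult_mono) auto
      finally show ?thesis .
    qed
    moreover have "?n * (10 * ?n + 20) + (14 * ?n + 13) \<le> ?n * (20 * ?n + 40) + 1"
    proof -
      obtain m where m: "?n = Suc m" using False not0_implies_Suc by blast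
      show ?thesis unfolding m by (simp add: algebra_simps)
    qed
    ultimately show ?thesis using False unfolding comp_bits_def
      by (intro runs_cong[OF runs_While_True[OF _ runs_Then[OF runs_Out runs_Then[OF 1 runs_Then[OF 2 3]]] 4[unfolded comp_bits_def]]])
         (auto simp: \<rho>2_def bits.simps[of ?n])
  qed
qed

text \<open>A generator restores all registers and only appends to the output, which is what makes
  sequences and loops compose.\<close>

lemma runs_gen:
  assumes "gen_wf g" "\<rho> 0 = 0" "\<And>r. d \<le> r \<Longrightarrow> \<rho> r = 0" "0 < d"
    and "\<And>v. v \<in> gvars g \<Longrightarrow> Suc v < d \<and> \<rho> (Suc v) = env v" "\<And>v. v \<in> loopvars g \<Longrightarrow> env v = 0"
  shows "runs x (comp_gen g d) (\<rho>, w) (gtime g x env) (\<rho>, w @ gsem g x env)"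
  using assms
proof (induction g arbitrary: \<rho> d w env)
  case (Emit bs)
  have "runs x (foldr (\<lambda>b c. Act (Out b) ;; c) bs Skip) (\<rho>, w) (2 * length bs) (\<rho>, w @ bs)" for w
  proof (induction bs arbitrary: w)
    case (Cons b bs)
    show ?case by (auto intro!: runs_cong[OF runs_Then[OF runs_Out Cons]])
  qed (simp add: runs_Skip)
  then show ?case by simp
next
  case (Cat g1 g2)
  have 1: "runs x (comp_gen g1 d) (\<rho>, w) (gtime g1 x env) (\<rho>, w @ gsem g1 x env)"
    by (rule Cat.IH(1)) (use Cat.prems in auto)
  have 2: "runs x (comp_gen g2 d) (\<rho>, w @ gsem g1 x env) (gtime g2 x env) (\<rho>, (w @ gsem g1 x env) @ gsem g2 x env)"
    by (rule Cat.IH(2)) (use Cat.prems in auto)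
  show ?case unfolding comp_gen.simps by (rule runs_cong[OF runs_Then[OF 1 2]]) auto
next
  case (For v a g)
  let ?n = "aval a x env"
  let ?\<rho> = "\<lambda>i. \<rho>(d := ?n - i, Suc v := i)"
  let ?st = "\<lambda>i. (?\<rho> i, w @ concat (map (\<lambda>i. gsem g x (env(v := i))) [0..<i]))"
  have v: "Suc v < d" "v < d" "env v = 0" "\<rho> (Suc v) = 0" using For.prems(5)[of v] For.prems(6)[of v] by auto
  have vs: "Suc u < d" "u < d" "\<rho> (Suc u) = env u" if "u \<in> avars a \<union> gvars g" for u
    using For.prems(5)[of u] that by auto
  have loops: "env u = 0" "u \<noteq> v" if "u \<in> loopvars g" for u
    using For.prems that by auto
  have 1: "runs x (comp_aexp a d) (\<rho>, w) (atime a x env) (\<rho>(d := ?n), w)"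
    by (rule runs_aexp) (use For.prems in auto)
  have body: "runs x (Act (Dec d) ;; comp_gen g (Suc d) ;; Act (Inc (Suc v))) (?st i) (gtime g x (env(v := i)) + 4) (?st (Suc i))"
    if i: "i < ?n" for i
  proof -
    let ?\<rho>' = "\<rho>(d := ?n - Suc i, Suc v := i)"
    have "runs x (comp_gen g (Suc d)) (?\<rho>', w') (gtime g x (env(v := i))) (?\<rho>', w' @ gsem g x (env(v := i)))" for w'
      by (rule For.IH) (use For.prems(1-4) v vs loops in \<open>auto simp: less_SucI\<close>)
    then show ?thesis using i v
      by (intro runs_cong[OF runs_Then[OF runs_Dec[of "?\<rho> i" d] runs_Then[OF runs_cong[OF _ refl order_refl] runs_Inc]]])
         (auto simp: fun_upd_twist)
  qed
  have 2: "runs x (While (NZ d) (Act (Dec d) ;; comp_gen g (Suc d) ;; Act (Inc (Suc v)))) (?st 0)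
      ((\<Sum>i<?n. gtime g x (env(v := i)) + 4 + 2) + 1) (?st ?n)"
    by (rule runs_While[where st = ?st, OF _ body]) (use v in auto)
  have st0: "?st 0 = (\<rho>(d := ?n), w)" using v by auto
  show ?case unfolding comp_gen.simps
    by (rule runs_cong[OF runs_Then[OF 1 runs_Then[OF 2[unfolded st0] runs_clear]]])
       (use v For.prems in \<open>auto simp: ac_simps\<close>)
next
  case (Branch a g1 g2)
  have 1: "runs x (comp_aexp a d) (\<rho>, w) (atime a x env) (\<rho>(d := aval a x env), w)"
    by (rule runs_aexp) (use Branch.prems in auto)
  have d: "\<rho>(d := 0) = \<rho>" using Branch.prems(3)[of d] by auto
  show ?case
  proof (cases "aval a x env = 0")
    case True
    have "runs x (comp_gen g2 d) (\<rho>, w) (gtime g2 x env) (\<rho>, w @ gsem g2 x env)"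
      by (rule Branch.IH(2)) (use Branch.prems in auto)
    then have 2: "runs x (comp_gen g2 d) (\<rho>(d := aval a x env), w) (gtime g2 x env) (\<rho>, w @ gsem g2 x env)"
      using True d by simp
    show ?thesis unfolding comp_gen.simps
      by (rule runs_cong[OF runs_Then[OF 1 runs_Cond_False[OF _ 2]]]) (use True in auto)
  next
    case False
    have 2: "runs x (comp_gen g1 d) (\<rho>, w) (gtime g1 x env) (\<rho>, w @ gsem g1 x env)"
      by (rule Branch.IH(1)) (use Branch.prems in auto)
    have 3: "runs x (clear d) (\<rho>(d := aval a x env), w) (3 * aval a x env + 1) (\<rho>, w)"
      by (rule runs_cong[OF runs_clear]) (use d in auto)
    show ?thesis unfolding comp_gen.simps
      by (rule runs_cong[OF runs_Then[OF 1 runs_Cond_True[OF _ runs_Then[OF 3 2]]]]) (use False in auto)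
  qed
next
  case (Num a)
  have 1: "runs x (comp_aexp a d) (\<rho>, w) (atime a x env) (\<rho>(d := aval a x env), w)"
    by (rule runs_aexp) (use Num.prems in auto)
  show ?case unfolding comp_gen.simps
    by (rule runs_cong[OF runs_Then[OF 1 runs_Then[OF runs_comp_bits runs_Out]]])
       (use Num.prems in \<open>auto simp: enc_nat_def algebra_simps\<close>)
qed

section \<open>Compiled code uses finitely many registers\<close>

lemma com_ok_aexp:
  "0 < d \<Longrightarrow> \<exists>k. com_ok k (comp_aexp a d)"
proof (induction a arbitrary: d)
  case (Lit n)
  have "com_ok d (((\<lambda>c. Act (Inc d) ;; c) ^^ n) Skip)" by (induction n) auto
  then show ?case by auto
next
  case (Var v)
  show ?case by (intro exI[of _ "v + d + 2"]) (auto simp: move_def move2_def Var)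
next
  case Len
  show ?case by (intro exI[of _ "d + 2"]) (auto simp: Len)
next
  case (Bit a)
  from Bit.IH[OF Bit.prems] obtain k where "com_ok k (comp_aexp a d)" by auto
  then show ?case
    by (intro exI[of _ "k + d + 3"]) (auto simp: move_def move2_def Bit intro: com_ok_mono)
next
  case (Add a b)
  from Add.IH(1)[OF Add.prems] Add.IH(2)[of "d + 1"] obtain k k'
    where "com_ok k (comp_aexp a d)" "com_ok k' (comp_aexp b (d + 1))" by auto
  then show ?case
    by (intro exI[of _ "k + k' + d + 3"]) (auto simp: move_def move2_def Add.prems intro: com_ok_mono)
next
  case (Mul a b)
  from Mul.IH(1)[of "d + 1"] Mul.IH(2)[of "d + 2"] obtain k k'
    where "com_ok k (comp_aexp a (d + 1))" "com_ok k' (comp_aexp b (d + 2))" by auto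
  then show ?case
    by (intro exI[of _ "k + k' + d + 3"]) (auto simp: move_def move2_def clear_def Mul.prems intro: com_ok_mono)
next
  case (Sub a b)
  from Sub.IH(1)[OF Sub.prems] Sub.IH(2)[of "d + 1"] obtain k k'
    where "com_ok k (comp_aexp a d)" "com_ok k' (comp_aexp b (d + 1))" by auto
  then show ?case
    by (intro exI[of _ "k + k' + d + 3"]) (auto simp: move_def move2_def Sub.prems intro: com_ok_mono)
qed

lemma com_ok_gen:
  "0 < d \<Longrightarrow> \<exists>k. com_ok k (comp_gen g d)"
proof (induction g arbitrary: d)
  case (Emit bs)
  have "com_ok d (foldr (\<lambda>b c. Act (Out b) ;; c) bs Skip)" by (induction bs) auto
  then show ?case by auto
next
  case (Cat g1 g2)
  then obtain k k' where "com_ok k (comp_gen g1 d)" "com_ok k' (comp_gen g2 d)" by blast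
  then show ?case by (intro exI[of _ "k + k'"]) (auto intro: com_ok_mono)
next
  case (For v a g)
  from For.IH[of "Suc d"] com_ok_aexp[OF For.prems, of a] obtain k k'
    where "com_ok k (comp_gen g (Suc d))" "com_ok k' (comp_aexp a d)" by auto
  then show ?case
    by (intro exI[of _ "k + k' + v + d + 3"]) (auto simp: clear_def For.prems intro: com_ok_mono)
next
  case (Branch a g1 g2)
  from Branch.IH(1)[OF Branch.prems] Branch.IH(2)[OF Branch.prems] com_ok_aexp[OF Branch.prems, of a]
  obtain k k' k'' where "com_ok k (comp_gen g1 d)" "com_ok k' (comp_gen g2 d)" "com_ok k'' (comp_aexp a d)" by auto
  then show ?case
    by (intro exI[of _ "k + k' + k'' + d"]) (auto simp: clear_def Branch.prems intro: com_ok_mono)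
next
  case (Num a)
  from com_ok_aexp[OF Num.prems, of a] obtain k where "com_ok k (comp_aexp a d)" by auto
  then show ?case
    by (intro exI[of _ "k + d + 3"]) (auto simp: comp_bits_def halve_def move_def Num.prems intro: com_ok_mono)
qed

section \<open>Polynomial running time of generators\<close>

definition poly_bounded :: "(bool list \<Rightarrow> (nat \<Rightarrow> nat) \<Rightarrow> nat) \<Rightarrow> bool" where
  "poly_bounded f \<longleftrightarrow> (\<exists>p :: nat poly. \<forall>x env m. (\<forall>v. env v \<le> m) \<longrightarrow> f x env \<le> poly p (length x + m))"

lemma poly_mono_nat: "a \<le> b \<Longrightarrow> poly (p :: nat poly) a \<le> poly p b"
  by (induction p) (auto intro!: add_mono mult_mono)

lemma poly_bounded_const: "poly_bounded (\<lambda>x env. c)"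
  unfolding poly_bounded_def by (rule exI[of _ "[:c:]"]) auto

lemma poly_bounded_length: "poly_bounded (\<lambda>x env. length x)"
  unfolding poly_bounded_def by (rule exI[of _ "[:0, 1:]"]) auto

lemma poly_bounded_env: "poly_bounded (\<lambda>x env. env v)"
  unfolding poly_bounded_def by (rule exI[of _ "[:0, 1:]"]) (auto intro: le_SucI trans_le_add2)

lemma poly_bounded_add: "poly_bounded f \<Longrightarrow> poly_bounded g \<Longrightarrow> poly_bounded (\<lambda>x env. f x env + g x env)"
proof -
  assume "poly_bounded f" "poly_bounded g"
  then obtain p q :: "nat poly" where
    "\<And>x env m. (\<forall>v. env v \<le> m) \<Longrightarrow> f x env \<le> poly p (length x + m)"
    "\<And>x env m. (\<forall>v. env v \<le> m) \<Longrightarrow> g x env \<le> poly q (length x + m)"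
    by (auto simp: poly_bounded_def)
  then show ?thesis unfolding poly_bounded_def
    by (intro exI[of _ "p + q"] allI impI) (simp add: add_mono)
qed

lemma poly_bounded_Suc: "poly_bounded f \<Longrightarrow> poly_bounded (\<lambda>x env. Suc (f x env))"
  using poly_bounded_add[OF _ poly_bounded_const[of 1]] by simp

lemma poly_bounded_mult: "poly_bounded f \<Longrightarrow> poly_bounded g \<Longrightarrow> poly_bounded (\<lambda>x env. f x env * g x env)"
proof -
  assume "poly_bounded f" "poly_bounded g"
  then obtain p q :: "nat poly" where
    "\<And>x env m. (\<forall>v. env v \<le> m) \<Longrightarrow> f x env \<le> poly p (length x + m)"
    "\<And>x env m. (\<forall>v. env v \<le> m) \<Longrightarrow> g x env \<le> poly q (length x + m)"
    by (auto simp: poly_bounded_def)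
  then show ?thesis unfolding poly_bounded_def
    by (intro exI[of _ "p * q"] allI impI) (simp add: mult_mono)
qed

lemma poly_bounded_le: "poly_bounded f \<Longrightarrow> (\<And>x env. g x env \<le> f x env) \<Longrightarrow> poly_bounded g"
  unfolding poly_bounded_def using le_trans by meson

text \<open>The loop variable takes values up to the number of rounds, which may exceed the bound
  \<open>m\<close> on the environment. Hence the polynomial for the body is composed with the one
  for the number of rounds; nesting iterates this composition a fixed number of times.\<close>

lemma poly_bounded_sum:
  assumes "poly_bounded f" "poly_bounded g"
  shows "poly_bounded (\<lambda>x env. \<Sum>i<f x env. g x (env(v := i)))"
proof -
  from assms obtain p q :: "nat poly" where
    f: "\<And>x env m. (\<forall>v. env v \<le> m) \<Longrightarrow> f x env \<le> poly p (length x + m)" and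
    g: "\<And>x env m. (\<forall>v. env v \<le> m) \<Longrightarrow> g x env \<le> poly q (length x + m)"
    by (auto simp: poly_bounded_def)
  show ?thesis unfolding poly_bounded_def
  proof (intro exI[of _ "p * pcompose q ([:0, 1:] + p)"] allI impI)
    fix x :: "bool list" and env :: "nat \<Rightarrow> nat" and m assume env: "\<forall>v. env v \<le> m"
    let ?k = "length x + m"
    have "g x (env(v := i)) \<le> poly q (?k + poly p ?k)" if "i < f x env" for i
      using g[of "env(v := i)" "m + poly p ?k" x] f[OF env, of x] env that
      by (auto simp: add.assoc trans_le_add1)
    then have "(\<Sum>i<f x env. g x (env(v := i))) \<le> (\<Sum>i<f x env. poly q (?k + poly p ?k))"
      by (intro sum_mono) auto
    also have "\<dots> \<le> poly p ?k * poly q (?k + poly p ?k)"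
      using f[OF env, of x] by simp
    finally show "(\<Sum>i<f x env. g x (env(v := i))) \<le> poly (p * pcompose q ([:0, 1:] + p)) ?k"
      by (simp add: poly_pcompose)
  qed
qed

lemmas poly_bounded_intros =
  poly_bounded_const poly_bounded_length poly_bounded_env poly_bounded_add poly_bounded_Suc poly_bounded_mult poly_bounded_sum

lemma poly_bounded_aval: "poly_bounded (aval a)"
proof (induction a)
  case (Bit a)
  show ?case by (rule poly_bounded_le[OF poly_bounded_const[of 1]]) simp
next
  case (Sub a b)
  show ?case by (rule poly_bounded_le[OF Sub(1)]) simp
qed (use poly_bounded_intros in \<open>auto simp: fun_eq_iff aval.simps[abs_def]\<close>)

lemma poly_bounded_atime: "poly_bounded (atime a)"
  by (induction a) (auto simp: atime.simps[abs_def] intro!: poly_bounded_intros poly_bounded_aval)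

lemma poly_bounded_gtime: "poly_bounded (gtime g)"
  by (induction g) (auto simp: gtime.simps[abs_def] intro!: poly_bounded_intros poly_bounded_aval poly_bounded_atime)

theorem poly_time_gen:
  assumes "gen_wf g"
  shows "poly_time 1 (\<lambda>ws. gsem g (ws ! 0) (\<lambda>_. 0))"
proof -
  \<comment> \<open>Variable \<open>v\<close> lives in register \<open>v + 1\<close>, so the work
    registers start at the largest variable plus 2.\<close>
  define d where "d = Suc (Suc (Max (insert 0 (gvars g))))"
  have d: "Suc v < d" if "v \<in> gvars g" for v
    using that finite_gvars[of g] by (auto simp: d_def less_Suc_eq_le)
  obtain k where k: "com_ok k (comp_gen g d)" using com_ok_gen[of d g] by (auto simp: d_def)
  obtain p :: "nat poly" where p: "\<And>x env m. (\<forall>v. env v \<le> m) \<Longrightarrow> gtime g x env \<le> poly p (length x + m)"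
    using poly_bounded_gtime[of g] by (auto simp: poly_bounded_def)
  show ?thesis
  proof (rule poly_time_com[OF k])
    fix x
    have "runs x (comp_gen g d) (\<lambda>_. 0, []) (gtime g x (\<lambda>_. 0)) (\<lambda>_. 0, [] @ gsem g x (\<lambda>_. 0))"
      by (rule runs_gen) (use assms d in \<open>auto simp: d_def\<close>)
    moreover have "gtime g x (\<lambda>_. 0) \<le> poly p (length x)" using p[of "\<lambda>_. 0" 0 x] by simp
    ultimately show "\<exists>t \<rho>. t \<le> poly p (length x) \<and> exec x (comp_gen g d) (\<lambda>_. 0, []) t (\<rho>, gsem g x (\<lambda>_. 0))"
      using le_trans by (fastforce simp: runs_def)
  qed
qed

section \<open>Worst-case expectations over all distributions\<close>

lemma hypercube_eq: "hypercube m = (\<lambda>\<beta>. vec m (\<lambda>j. of_bool (\<beta> j))) ` UNIV"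
proof (rule Set.set_eqI, rule iffI)
  fix \<xi> assume "\<xi> \<in> hypercube m"
  then have "\<xi> = vec m (\<lambda>j. of_bool (\<xi> $ j = 1))"
    by (intro eq_vecI) (auto simp: hypercube_def)
  from image_eqI[where f = "\<lambda>\<beta>. vec m (\<lambda>j. of_bool (\<beta> j))" and x = "\<lambda>j. \<xi> $ j = 1", OF this UNIV_I]
  show "\<xi> \<in> (\<lambda>\<beta>. vec m (\<lambda>j. of_bool (\<beta> j))) ` UNIV" .
qed (auto simp: hypercube_def)

lemma finite_hypercube: "finite (hypercube m)"
proof (rule finite_subset)
  show "hypercube m \<subseteq> (\<lambda>s. vec m (\<lambda>j. of_bool (j \<in> s))) ` Pow {..<m}"
  proof
    fix \<xi> assume "\<xi> \<in> hypercube m"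
    then have "\<xi> = vec m (\<lambda>j. of_bool (j \<in> {j. j < m \<and> \<xi> $ j = 1}))"
      by (intro eq_vecI) (auto simp: hypercube_def)
    then show "\<xi> \<in> (\<lambda>s. vec m (\<lambda>j. of_bool (j \<in> s))) ` Pow {..<m}" by blast
  qed
qed auto

lemma carrier_vec_0: "carrier_vec 0 = {0\<^sub>v 0}"
  by (auto intro: eq_vecI)

text \<open>The independent coupling moves each unit of mass at a cost of at most \<open>R\<close>.
  The infimum is one over reals and requires the costs to be bounded below, which holds as norms are
  nonnegative.\<close>

lemma wasserstein_le:
  assumes nrm: "norm_on m nrm" and S: "finite S" "S \<subseteq> carrier_vec m"
    and le: "\<And>\<xi> \<xi>'. \<xi> \<in> S \<Longrightarrow> \<xi>' \<in> S \<Longrightarrow> nrm (\<xi> - \<xi>') \<le> R" and R: "0 \<le> R"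
  shows "wasserstein nrm S \<mu> \<nu> \<le> R"
proof -
  let ?c = "\<lambda>\<pi>. \<Sum>\<xi>\<in>S. \<Sum>\<xi>'\<in>S. nrm (\<xi> - \<xi>') * pmf \<pi> (\<xi>, \<xi>')"
  have nonneg: "0 \<le> nrm (\<xi> - \<xi>')" if "\<xi> \<in> S" "\<xi>' \<in> S" for \<xi> \<xi>'
  proof -
    have "\<xi> - \<xi>' \<in> carrier_vec m" using that S by (intro minus_carrier_vec) auto
    then show ?thesis using nrm by (simp add: norm_on_def)
  qed
  have "pair_pmf \<mu> \<nu> \<in> couplings \<mu> \<nu>"
    by (auto simp: couplings_def map_fst_pair_pmf map_snd_pair_pmf)
  moreover have "bdd_below (?c ` couplings \<mu> \<nu>)"
    by (intro bdd_belowI2[of _ 0] sum_nonneg mult_nonneg_nonneg nonneg) auto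
  ultimately have "wasserstein nrm S \<mu> \<nu> \<le> ?c (pair_pmf \<mu> \<nu>)"
    unfolding wasserstein_def by (rule cINF_lower[rotated])
  also have "\<dots> \<le> (\<Sum>\<xi>\<in>S. \<Sum>\<xi>'\<in>S. R * pmf (pair_pmf \<mu> \<nu>) (\<xi>, \<xi>'))"
    by (intro sum_mono mult_right_mono le) auto
  also have "\<dots> = R * (\<Sum>z\<in>S \<times> S. pmf (pair_pmf \<mu> \<nu>) z)"
    by (simp add: sum_distrib_left sum.cartesian_product)
  also have "(\<Sum>z\<in>S \<times> S. pmf (pair_pmf \<mu> \<nu>) z) = measure_pmf.prob (pair_pmf \<mu> \<nu>) (S \<times> S)"
    using S by (subst measure_measure_pmf_finite) auto
  also have "R * \<dots> \<le> R * 1"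
    using R by (intro mult_left_mono) auto
  finally show ?thesis by simp
qed

text \<open>Monotonicity is used in the extended reals, so the bound also covers vertices with the
  loss -\<infinity>.\<close>

lemma expected_loss_le:
  assumes "finite (supp P)" "\<And>\<xi>. \<xi> \<in> supp P \<Longrightarrow> second_stage P x \<xi> \<le> ereal u"
    and "\<mu> \<in> distributions (supp P)"
  shows "expected_loss P \<mu> x \<le> ereal u"
proof -
  have "expected_loss P \<mu> x \<le> (\<Sum>\<xi>\<in>supp P. ereal (pmf \<mu> \<xi>) * ereal u)"
    unfolding expected_loss_def using assms by (intro sum_mono ereal_mult_left_mono) auto
  also have "\<dots> = ereal ((\<Sum>\<xi>\<in>supp P. pmf \<mu> \<xi>) * u)"
    by (simp add: sum_distrib_right)
  also have "(\<Sum>\<xi>\<in>supp P. pmf \<mu> \<xi>) = 1"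
    using assms by (intro sum_pmf_eq_1) (auto simp: distributions_def)
  finally show ?thesis by simp
qed

text \<open>At all other vertices the probability 0 cancels even an infinite loss, by the convention
  for multiplication by 0.\<close>

lemma expected_loss_return:
  assumes "finite (supp P)" "\<xi> \<in> supp P"
  shows "expected_loss P (return_pmf \<xi>) x = second_stage P x \<xi>"
proof -
  have "expected_loss P (return_pmf \<xi>) x = (\<Sum>\<xi>'\<in>supp P. if \<xi>' = \<xi> then second_stage P x \<xi>' else 0)"
    unfolding expected_loss_def by (intro sum.cong) (auto simp: indicator_def)
  then show ?thesis using assms by simp
qed

lemma optimal_value_problem_of:
  "optimal_value nrm (problem_of D) =
     (SUP \<mu>\<in>ambiguity_set nrm (problem_of D). expected_loss (problem_of D) \<mu> (0\<^sub>v 0))"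
  by (simp add: optimal_value_def carrier_vec_0 problem_of_def)

text \<open>The point mass at any vertex is within the radius of the empirical distribution,
  whatever the samples are, so the supremum is at least the loss at that vertex.\<close>

lemma yes_instanceI:
  assumes nrm: "norm_on (dim_M D) nrm"
    and le: "\<And>\<xi> \<xi>'. \<xi> \<in> hypercube (dim_M D) \<Longrightarrow> \<xi>' \<in> hypercube (dim_M D) \<Longrightarrow>
      nrm (\<xi> - \<xi>') \<le> real_of_rat (data_radius D)"
    and pos: "0 \<le> data_radius D"
    and \<xi>: "\<xi> \<in> hypercube (dim_M D)"
    and ge: "ereal (real_of_rat (threshold D)) \<le> second_stage (problem_of D) (0\<^sub>v 0) \<xi>"
  shows "yes_instance nrm D"
proof -
  have "wasserstein nrm (hypercube (dim_M D)) (return_pmf \<xi>) \<nu> \<le> real_of_rat (data_radius D)" for \<nu>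
    by (rule wasserstein_le[OF nrm finite_hypercube _ le]) (use pos in \<open>auto simp: hypercube_def\<close>)
  then have "return_pmf \<xi> \<in> ambiguity_set nrm (problem_of D)"
    using \<xi> by (simp add: ambiguity_set_def distributions_def problem_of_def)
  then have "expected_loss (problem_of D) (return_pmf \<xi>) (0\<^sub>v 0) \<le> optimal_value nrm (problem_of D)"
    unfolding optimal_value_problem_of by (rule SUP_upper)
  then show ?thesis
    using ge \<xi> expected_loss_return[of "problem_of D" \<xi> "0\<^sub>v 0"] finite_hypercube
    by (auto simp: yes_instance_def problem_of_def)
qed

text \<open>A mean never exceeds a common bound on the losses; this direction holds for every
  function \<open>nrm\<close> and every radius.\<close>

lemma not_yes_instanceI:
  assumes "\<And>\<xi>. \<xi> \<in> hypercube (dim_M D) \<Longrightarrow> second_stage (problem_of D) (0\<^sub>v 0) \<xi> \<le> ereal u"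
    and "u < real_of_rat (threshold D)"
  shows "\<not> yes_instance nrm D"
proof -
  have "optimal_value nrm (problem_of D) \<le> ereal u"
    unfolding optimal_value_problem_of
    by (intro SUP_least expected_loss_le)
      (use assms finite_hypercube in \<open>auto simp: ambiguity_set_def problem_of_def\<close>)
  then show ?thesis using assms(2) unfolding yes_instance_def
    by (meson ereal_less_eq(3) not_le order_trans)
qed

section \<open>Instances given by functions\<close>

text \<open>The matrices by which the uncertainty enters W are zero, so \<open>W_of\<close> is
  constant, as both cases demand. One sample suffices, since the radius chosen later admits all
  distributions.\<close>

definition inst :: "nat \<Rightarrow> nat \<Rightarrow> nat \<Rightarrow> (nat \<Rightarrow> rat) \<Rightarrow> (nat \<Rightarrow> nat \<Rightarrow> rat) \<Rightarrow> (nat \<Rightarrow> nat \<Rightarrow> rat) \<Rightarrow>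
    (nat \<Rightarrow> nat \<Rightarrow> rat) \<Rightarrow> (nat \<Rightarrow> rat) \<Rightarrow> rat \<Rightarrow> rat \<Rightarrow> instance_data" where
  "inst m n l qf Qf wt tf hf rad thr = \<lparr>dim_M = m, dim_N2 = n, dim_L = l,
     data_q0 = vec n qf, data_Q = mat n m (\<lambda>(i, j). Qf i j), data_W0 = mat l n (\<lambda>(r, i). wt r i),
     data_W = replicate m (0\<^sub>m l n), data_T = mat l m (\<lambda>(r, j). tf r j), data_h = vec l hf,
     data_samples = [0\<^sub>v m], data_radius = rad, threshold = thr\<rparr>"

lemma inst_in_instances:
  "1 \<le> m \<Longrightarrow> 1 \<le> n \<Longrightarrow> 1 \<le> l \<Longrightarrow> 0 \<le> rad \<Longrightarrow> inst m n l qf Qf wt tf hf rad thr \<in> instances"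
  by (auto simp: inst_def instances_def)

lemma inst_sel [simp]:
  "dim_M (inst m n l qf Qf wt tf hf rad thr) = m" "dim_N2 (inst m n l qf Qf wt tf hf rad thr) = n"
  "data_radius (inst m n l qf Qf wt tf hf rad thr) = rad" "threshold (inst m n l qf Qf wt tf hf rad thr) = thr"
  by (simp_all add: inst_def)

lemma concat_mat_to_list:
  "concat (mat_to_list (mat r c (\<lambda>(i, j). f i j))) = concat (map (\<lambda>i. map (f i) [0..<c]) [0..<r])"
  by (rule arg_cong[of _ _ concat]) (auto simp: mat_to_list_def intro!: map_cong)

lemma list_of_vec_vec: "list_of_vec (vec n f) = map f [0..<n]"
  by (intro nth_equalityI) (auto simp: list_of_vec_index)

lemma zero_mat_fun: "0\<^sub>m r c = mat r c (\<lambda>(i, j). 0)"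
  by (auto intro!: eq_matI)

lemma data_numbers_inst:
  "data_numbers (inst m n l qf Qf wt tf hf rad thr) =
     map qf [0..<n] @ concat (map (\<lambda>i. map (Qf i) [0..<m]) [0..<n]) @
     concat (map (\<lambda>r. map (wt r) [0..<n]) [0..<l]) @
     concat (map (\<lambda>_. concat (map (\<lambda>_. map (\<lambda>_. 0) [0..<n]) [0..<l])) [0..<m]) @
     concat (map (\<lambda>r. map (tf r) [0..<m]) [0..<l]) @
     map hf [0..<l] @ map (\<lambda>_. 0) [0..<m] @ [rad, thr]"
proof -
  have "map (\<lambda>B. concat (mat_to_list B)) (replicate m (0\<^sub>m l n :: rat mat)) =
      map (\<lambda>_. concat (map (\<lambda>_. map (\<lambda>_. 0) [0..<n]) [0..<l])) [0..<m]"
    by (simp add: zero_mat_fun concat_mat_to_list map_replicate_const)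
  moreover have "0\<^sub>v m = vec m (\<lambda>_. 0 :: rat)" by auto
  ultimately show ?thesis
    by (simp add: data_numbers_def inst_def concat_mat_to_list list_of_vec_vec)
qed

lemma concat_map_concat: "concat (map f (concat (map g xs))) = concat (map (\<lambda>x. concat (map f (g x))) xs)"
  by (induction xs) auto

lemma enc_instance_inst:
  "enc_instance (inst m n l qf Qf wt tf hf rad thr) =
     enc_nat m @ enc_nat n @ enc_nat l @ enc_nat 1 @
     concat (map (\<lambda>i. enc_rat (qf i)) [0..<n]) @
     concat (map (\<lambda>i. concat (map (\<lambda>j. enc_rat (Qf i j)) [0..<m])) [0..<n]) @
     concat (map (\<lambda>r. concat (map (\<lambda>i. enc_rat (wt r i)) [0..<n])) [0..<l]) @
     concat (map (\<lambda>_. concat (map (\<lambda>_. concat (map (\<lambda>_. enc_rat 0) [0..<n])) [0..<l])) [0..<m]) @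
     concat (map (\<lambda>r. concat (map (\<lambda>j. enc_rat (tf r j)) [0..<m])) [0..<l]) @
     concat (map (\<lambda>r. enc_rat (hf r)) [0..<l]) @
     concat (map (\<lambda>_. enc_rat 0) [0..<m]) @ enc_rat rad @ enc_rat thr"
proof -
  have "dim_L (inst m n l qf Qf wt tf hf rad thr) = l" "length (data_samples (inst m n l qf Qf wt tf hf rad thr)) = 1"
    by (simp_all add: inst_def)
  then show ?thesis
    unfolding enc_instance_def data_numbers_inst
    by (simp add: concat_map_concat o_def del: upt_Suc)
qed

lemma W_of_inst:
  "\<xi> \<in> carrier_vec m \<Longrightarrow> W_of (problem_of (inst m n l qf Qf wt tf hf rad thr)) \<xi> =
     mat l n (\<lambda>(r, i). real_of_rat (wt r i))"
  by (intro eq_matI) (auto simp: W_of_def problem_of_def inst_def)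

lemma objective_uncertainty_inst:
  "objective_uncertainty (problem_of (inst m n l qf Qf wt (\<lambda>_ _. 0) hf rad thr))"
  by (auto simp: objective_uncertainty_def W_of_inst problem_of_def inst_def hypercube_def W_of_def intro!: eq_matI)

lemma rhs_uncertainty_inst:
  "rhs_uncertainty (problem_of (inst m n l qf (\<lambda>_ _. 0) wt tf hf rad thr))"
  by (auto simp: rhs_uncertainty_def W_of_inst problem_of_def inst_def hypercube_def W_of_def intro!: eq_matI)

section \<open>The second stage at a vertex of the hypercube\<close>

definition feasible :: "nat \<Rightarrow> nat \<Rightarrow> nat \<Rightarrow> (nat \<Rightarrow> nat \<Rightarrow> rat) \<Rightarrow> (nat \<Rightarrow> nat \<Rightarrow> rat) \<Rightarrow> (nat \<Rightarrow> rat) \<Rightarrow>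
    (nat \<Rightarrow> bool) \<Rightarrow> (nat \<Rightarrow> real) \<Rightarrow> bool" where
  "feasible m n l wt tf hf \<beta> y \<longleftrightarrow> (\<forall>i<n. 0 \<le> y i) \<and>
     (\<forall>r<l. (\<Sum>j<m. real_of_rat (tf r j) * of_bool (\<beta> j)) + real_of_rat (hf r) \<le>
       (\<Sum>i<n. real_of_rat (wt r i) * y i))"

definition objective :: "nat \<Rightarrow> nat \<Rightarrow> (nat \<Rightarrow> rat) \<Rightarrow> (nat \<Rightarrow> nat \<Rightarrow> rat) \<Rightarrow>
    (nat \<Rightarrow> bool) \<Rightarrow> (nat \<Rightarrow> real) \<Rightarrow> real" where
  "objective m n qf Qf \<beta> y =
     (\<Sum>i<n. (real_of_rat (qf i) + (\<Sum>j<m. real_of_rat (Qf i j) * of_bool (\<beta> j))) * y i)"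

lemma second_stage_inst:
  "second_stage (problem_of (inst m n l qf Qf wt tf hf rad thr)) x (vec m (\<lambda>j. of_bool (\<beta> j))) =
     (INF y\<in>{y. feasible m n l wt tf hf \<beta> y}. ereal (objective m n qf Qf \<beta> y))"
proof -
  define D where D: "D = inst m n l qf Qf wt tf hf rad thr"
  let ?F = "feasible m n l wt tf hf"
  let ?O = "objective m n qf Qf"
  let ?\<xi> = "vec m (\<lambda>j. of_bool (\<beta> j)) :: real vec"
  let ?P = "problem_of D"
  have obj: "q_of ?P ?\<xi> \<bullet> vec n y = ?O \<beta> y" for y
    by (auto simp: D q_of_def problem_of_def inst_def scalar_prod_def objective_def atLeast0LessThan
        intro!: sum.cong)
  have feas: "vec n y \<in> {y \<in> Y ?P. W_of ?P ?\<xi> *\<^sub>v y \<ge> T ?P x *\<^sub>v ?\<xi> + h ?P x} \<longleftrightarrow> ?F \<beta> y" for y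
    unfolding D
    by (subst W_of_inst) (auto simp: problem_of_def inst_def feasible_def less_eq_vec_def scalar_prod_def atLeast0LessThan)
  have "{y \<in> Y ?P. W_of ?P ?\<xi> *\<^sub>v y \<ge> T ?P x *\<^sub>v ?\<xi> + h ?P x} = (\<lambda>y. vec n y) ` {y. ?F \<beta> y}" (is "?S = _")
  proof (rule Set.set_eqI, rule iffI)
    fix v assume v: "v \<in> ?S"
    then have "v \<in> carrier_vec n" by (simp add: D problem_of_def inst_def)
    then have eq: "v = vec n (\<lambda>i. v $ i)" by auto
    with v have "?F \<beta> (\<lambda>i. v $ i)" using feas[of "\<lambda>i. v $ i"] by auto
    then show "v \<in> (\<lambda>y. vec n y) ` {y. ?F \<beta> y}" using eq by blast
  qed (use feas in blast)
  then show ?thesis unfolding second_stage_def D[symmetric] by (simp add: obj image_image)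
qed

text \<open>The minimum over y \<ge> 0 splits into coordinates. With nonnegative costs it is 0; a
  negative cost allows arbitrarily low values, of which -1 is enough to miss the threshold
  0.\<close>

lemma yes_inst_objective:
  assumes nrm: "norm_on m nrm"
    and le: "\<And>\<xi> \<xi>'. \<xi> \<in> hypercube m \<Longrightarrow> \<xi>' \<in> hypercube m \<Longrightarrow> nrm (\<xi> - \<xi>') \<le> real_of_rat rad"
    and rad: "0 \<le> rad"
  shows "yes_instance nrm (inst m n 1 (\<lambda>i. of_int (qf i)) (\<lambda>i j. of_int (Qf i j)) (\<lambda>_ _. 0) (\<lambda>_ _. 0) (\<lambda>_. 0) rad 0) \<longleftrightarrow>
    (\<exists>\<beta>. \<forall>i<n. 0 \<le> qf i + (\<Sum>j<m. Qf i j * of_bool (\<beta> j)))" (is "yes_instance nrm ?D \<longleftrightarrow> _")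
proof -
  let ?c = "\<lambda>\<beta> i. qf i + (\<Sum>j<m. Qf i j * of_bool (\<beta> j))"
  let ?F = "feasible m n 1 (\<lambda>_ _. 0) (\<lambda>_ _. 0) (\<lambda>_. 0)"
  let ?O = "objective m n (\<lambda>i. of_int (qf i)) (\<lambda>i j. of_int (Qf i j))"
  have obj: "?O \<beta> y = (\<Sum>i<n. real_of_int (?c \<beta> i) * y i)" for \<beta> y
    by (simp add: objective_def)
  have feas: "?F \<beta> y \<longleftrightarrow> (\<forall>i<n. 0 \<le> y i)" for \<beta> y by (simp add: feasible_def)
  note ss = second_stage_inst[of m n 1 "\<lambda>i. of_int (qf i)" "\<lambda>i j. of_int (Qf i j)" "\<lambda>_ _. 0" "\<lambda>_ _. 0" "\<lambda>_. 0" rad 0 "0\<^sub>v 0"]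
  show ?thesis
  proof
    assume "\<exists>\<beta>. \<forall>i<n. 0 \<le> ?c \<beta> i"
    then obtain \<beta> where \<beta>: "\<And>i. i < n \<Longrightarrow> 0 \<le> ?c \<beta> i" by blast
    have "ereal 0 \<le> ereal (?O \<beta> y)" if "?F \<beta> y" for y
    proof -
      have "0 \<le> (\<Sum>i<n. real_of_int (?c \<beta> i) * y i)"
        using that feas \<beta> by (intro sum_nonneg mult_nonneg_nonneg of_int_nonneg) auto
      then show ?thesis by (simp add: obj)
    qed
    then have "ereal 0 \<le> second_stage (problem_of ?D) (0\<^sub>v 0) (vec m (\<lambda>j. of_bool (\<beta> j)))"
      unfolding ss by (intro INF_greatest) auto
    then show "yes_instance nrm ?D"
      using nrm le rad by (intro yes_instanceI) (auto simp: hypercube_eq)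
  next
    assume yes: "yes_instance nrm ?D"
    show "\<exists>\<beta>. \<forall>i<n. 0 \<le> ?c \<beta> i"
    proof (rule ccontr)
      assume no: "\<not> ?thesis"
      have "second_stage (problem_of ?D) (0\<^sub>v 0) \<xi> \<le> ereal (- 1)" if \<xi>: "\<xi> \<in> hypercube (dim_M ?D)" for \<xi>
      proof -
        obtain \<beta> where \<beta>: "\<xi> = vec m (\<lambda>j. of_bool (\<beta> j))" using \<xi> by (auto simp: hypercube_eq)
        obtain i where i: "i < n" "?c \<beta> i < 0" using no by (meson not_le)
        \<comment> \<open>This weight on the negative cost makes the objective exactly -1.\<close>
        define y where "y k = (if k = i then - 1 / real_of_int (?c \<beta> i) else 0)" for k
        have "?F \<beta> y" unfolding feas using i by (auto simp: y_def divide_nonneg_neg simp del: of_int_add of_int_sum)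
        then have "second_stage (problem_of ?D) (0\<^sub>v 0) \<xi> \<le> ereal (?O \<beta> y)"
          unfolding \<beta> ss by (intro INF_lower) auto
        also have "?O \<beta> y = (\<Sum>k<n. if k = i then - 1 else 0)"
          unfolding obj using i by (intro sum.cong) (auto simp: y_def simp del: of_int_add of_int_sum)
        also have "\<dots> = - 1" using i by simp
        finally show ?thesis .
      qed
      then have "\<not> yes_instance nrm ?D" by (intro not_yes_instanceI[of _ "- 1"]) auto
      with yes show False by blast
    qed
  qed
qed

text \<open>Row \<open>r\<close> of the second stage bounds the variable of clause \<open>cl r\<close> from below by the value of a
  literal. On the vertices of the hypercube the minimum then counts the satisfied clauses.\<close>

lemma yes_inst_rhs:
  assumes nrm: "norm_on m nrm"
    and le: "\<And>\<xi> \<xi>'. \<xi> \<in> hypercube m \<Longrightarrow> \<xi>' \<in> hypercube m \<Longrightarrow> nrm (\<xi> - \<xi>') \<le> real_of_rat rad"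
    and rad: "0 \<le> rad"
    and cl: "\<And>r. r < l \<Longrightarrow> cl r < n"
    and lit: "\<And>r \<beta>. r < l \<Longrightarrow> (\<Sum>j<m. tf r j * of_bool (\<beta> j)) + hf r = of_bool (lit r \<beta>)"
  shows "yes_instance nrm (inst m n l (\<lambda>_. 1) (\<lambda>_ _. 0) (\<lambda>r i. of_bool (i = cl r)) (\<lambda>r j. of_int (tf r j))
      (\<lambda>r. of_int (hf r)) rad (of_nat n)) \<longleftrightarrow>
    (\<exists>\<beta>. \<forall>i<n. \<exists>r<l. cl r = i \<and> lit r \<beta>)" (is "yes_instance nrm ?D \<longleftrightarrow> _")
proof -
  let ?F = "feasible m n l (\<lambda>r i. of_bool (i = cl r)) (\<lambda>r j. of_int (tf r j)) (\<lambda>r. of_int (hf r))"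
  let ?O = "objective m n (\<lambda>_. 1) (\<lambda>_ _. 0)"
  have obj: "?O \<beta> y = (\<Sum>i<n. y i)" for \<beta> y
    by (simp add: objective_def)
  have val: "(\<Sum>j<m. real_of_rat (of_int (tf r j)) * of_bool (\<beta> j)) + real_of_rat (of_int (hf r)) = of_bool (lit r \<beta>)" if "r < l" for r \<beta>
    using arg_cong[OF lit[OF that, of \<beta>], of real_of_int] by simp
  have row: "(\<Sum>i<n. real_of_rat (of_bool (i = cl r)) * y i) = y (cl r)" if "r < l" for r y
  proof -
    have "(\<Sum>i<n. real_of_rat (of_bool (i = cl r)) * y i) = (\<Sum>i<n. if i = cl r then y i else 0)"
      by (intro sum.cong) auto
    then show ?thesis using cl[OF that] by simp
  qed
  have feas: "?F \<beta> y \<longleftrightarrow> (\<forall>i<n. 0 \<le> y i) \<and> (\<forall>r<l. of_bool (lit r \<beta>) \<le> y (cl r))" for \<beta> y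
    unfolding feasible_def by (intro conj_cong refl all_cong1 imp_cong) (simp only: val row)
  note ss = second_stage_inst[of m n l "\<lambda>_. 1" "\<lambda>_ _. 0" "\<lambda>r i. of_bool (i = cl r)"
      "\<lambda>r j. of_int (tf r j)" "\<lambda>r. of_int (hf r)" rad "of_nat n" "0\<^sub>v 0"]
  show ?thesis
  proof
    assume "\<exists>\<beta>. \<forall>i<n. \<exists>r<l. cl r = i \<and> lit r \<beta>"
    then obtain \<beta> where \<beta>: "\<And>i. i < n \<Longrightarrow> \<exists>r<l. cl r = i \<and> lit r \<beta>" by blast
    have "ereal (real n) \<le> ereal (?O \<beta> y)" if "?F \<beta> y" for y
    proof -
      have "1 \<le> y i" if "i < n" for i
        using \<beta>[OF that] \<open>?F \<beta> y\<close> unfolding feas by force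
      then have "(\<Sum>i<n. 1) \<le> (\<Sum>i<n. y i)" by (intro sum_mono) auto
      then show ?thesis by (simp add: obj)
    qed
    then have "ereal (real n) \<le> second_stage (problem_of ?D) (0\<^sub>v 0) (vec m (\<lambda>j. of_bool (\<beta> j)))"
      unfolding ss by (intro INF_greatest) auto
    then show "yes_instance nrm ?D"
      using nrm le rad by (intro yes_instanceI) (auto simp: hypercube_eq)
  next
    assume yes: "yes_instance nrm ?D"
    show "\<exists>\<beta>. \<forall>i<n. \<exists>r<l. cl r = i \<and> lit r \<beta>"
    proof (rule ccontr)
      assume no: "\<not> ?thesis"
      have "second_stage (problem_of ?D) (0\<^sub>v 0) \<xi> \<le> ereal (real n - 1)" if \<xi>: "\<xi> \<in> hypercube (dim_M ?D)" for \<xi>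
      proof -
        obtain \<beta> where \<beta>: "\<xi> = vec m (\<lambda>j. of_bool (\<beta> j))" using \<xi> by (auto simp: hypercube_eq)
        obtain i where i: "i < n" "\<And>r. r < l \<Longrightarrow> cl r = i \<Longrightarrow> \<not> lit r \<beta>" using no by blast
        \<comment> \<open>All rows of the violated clause \<open>i\<close> have the value 0, so its
          variable may be 0 while the others are 1.\<close>
        define y :: "nat \<Rightarrow> real" where "y k = 1 - of_bool (k = i)" for k
        have "?F \<beta> y" unfolding feas using i by (auto simp: y_def)
        then have "second_stage (problem_of ?D) (0\<^sub>v 0) \<xi> \<le> ereal (?O \<beta> y)"
          unfolding \<beta> ss by (intro INF_lower) auto
        also have "?O \<beta> y = real n - 1"
          unfolding obj using i by (simp add: y_def sum_subtractf of_bool_def)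
        finally show ?thesis .
      qed
      then have "\<not> yes_instance nrm ?D" by (intro not_yes_instanceI[of _ "real n - 1"]) auto
      with yes show False by blast
    qed
  qed
qed

section \<open>Computations as tilings\<close>

text \<open>The arguments of \<open>Cell\<close>: whether the cell lies in the first row, the state,
  the symbols scanned by all heads, the symbols of all tapes at this position, and which heads stand
  here. The flag tells \<open>fits\<close>, which does not know the row, where the guessed witness
  has to be a contiguous word.\<close>

datatype tile = Border | Cell bool nat "nat list" "nat list" "bool list"

fun head_at :: "tile \<Rightarrow> nat \<Rightarrow> bool" where
  "head_at Border j \<longleftrightarrow> False"
| "head_at (Cell i q s sy hs) j \<longleftrightarrow> hs ! j"

abbreviation (input) heads :: "tm_config \<Rightarrow> nat \<Rightarrow> int" where
  "heads C \<equiv> fst (snd C)"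

abbreviation (input) tapes :: "tm_config \<Rightarrow> nat \<Rightarrow> int \<Rightarrow> nat" where
  "tapes C \<equiv> snd (snd C)"

locale tableau =
  fixes M :: tm and k :: nat
  assumes tm_wf: "tm_wf M" and k: "k = tm_tapes M" "2 \<le> k"
begin

text \<open>\<open>tm_step\<close> keeps halted configurations fixed whatever
  \<open>tm_delta\<close> says in state 1; here halting becomes a transition that writes back the
  scanned symbols without a move.\<close>

definition act :: "nat \<Rightarrow> nat list \<Rightarrow> nat \<times> (nat \<times> head_move) list" where
  "act q s = (if q = 1 then (1, map (\<lambda>a. (a, Stay)) s) else tm_delta M q s)"

definition scan :: "tm_config \<Rightarrow> nat list" where
  "scan C = map (\<lambda>j. tapes C j (heads C j)) [0..<k]"

lemma length_scan [simp]: "length (scan C) = k"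
  by (simp add: scan_def)

lemma scan_nth [simp]: "j < k \<Longrightarrow> scan C ! j = tapes C j (heads C j)"
  by (simp add: scan_def)

lemma tm_step_simps:
  "fst (tm_step M C) = fst (act (fst C) (scan C))"
  "j < k \<Longrightarrow> heads (tm_step M C) j = heads C j + shift (snd (snd (act (fst C) (scan C)) ! j))"
  "j < k \<Longrightarrow> tapes (tm_step M C) j z =
     (if z = heads C j then fst (snd (act (fst C) (scan C)) ! j) else tapes C j z)"
  by (auto simp: tm_step_def act_def k(1)[symmetric] scan_def split: prod.splits)

definition good :: "tm_config \<Rightarrow> bool" where
  "good C \<longleftrightarrow> fst C < tm_states M \<and> (\<forall>j<k. \<forall>z. tapes C j z < tm_symbols M)"

lemma good_act:
  assumes "good C"
  shows "fst (act (fst C) (scan C)) < tm_states M"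
    "j < k \<Longrightarrow> fst (snd (act (fst C) (scan C)) ! j) < tm_symbols M"
proof -
  have s: "length (scan C) = tm_tapes M \<and> set (scan C) \<subseteq> {..<tm_symbols M}"
    using assms by (auto simp: scan_def good_def k(1)[symmetric])
  have "case tm_delta M (fst C) (scan C) of (q', as) \<Rightarrow>
      q' < tm_states M \<and> length as = tm_tapes M \<and> (\<forall>a\<in>set as. fst a < tm_symbols M)"
  proof -
    have "\<forall>q<tm_states M. \<forall>s. length s = tm_tapes M \<and> set s \<subseteq> {..<tm_symbols M} \<longrightarrow>
        (case tm_delta M q s of (q', as) \<Rightarrow>
           q' < tm_states M \<and> length as = tm_tapes M \<and> (\<forall>a\<in>set as. fst a < tm_symbols M))"
      using tm_wf unfolding tm_wf_def by (elim conjE)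
    moreover have "fst C < tm_states M" using assms unfolding good_def ..
    ultimately show ?thesis using s by (elim allE impE) assumption+
  qed
  then show "fst (act (fst C) (scan C)) < tm_states M"
    "j < k \<Longrightarrow> fst (snd (act (fst C) (scan C)) ! j) < tm_symbols M"
    using assms tm_wf by (auto simp: act_def good_def tm_wf_def k(1)[symmetric])
qed

lemma good_step: "good C \<Longrightarrow> good (tm_step M C)"
  using good_act[of C] by (auto simp: good_def[of "tm_step M C"] tm_step_simps good_def[of C])

lemma good_init: "good (tm_init ws)"
  using tm_wf by (auto simp: good_def tm_init_def tm_wf_def tape_of_def bit_symbol_def)

definition run :: "bool list \<Rightarrow> bool list \<Rightarrow> nat \<Rightarrow> tm_config" where
  "run x w t = (tm_step M ^^ t) (tm_init [x, w])"

lemma run_0: "run x w 0 = tm_init [x, w]"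
  by (simp add: run_def)

lemma run_Suc: "run x w (Suc t) = tm_step M (run x w t)"
  by (simp add: run_def)

lemma good_run: "good (run x w t)"
  by (induction t) (auto simp: run_0 run_Suc good_init good_step)

text \<open>A head moves by at most one cell per step, so for \<open>tt\<close> steps the cells from
  \<open>-tt\<close> to \<open>tt\<close> contain all heads.\<close>

lemma heads_run: "j < k \<Longrightarrow> \<bar>heads (run x w t) j\<bar> \<le> int t"
proof (induction t)
  case (Suc t)
  let ?mv = "snd (snd (act (fst (run x w t)) (scan (run x w t))) ! j)"
  have "\<bar>shift ?mv\<bar> \<le> 1" by (cases ?mv) auto
  then show ?case using Suc unfolding run_Suc by (simp add: tm_step_simps)
qed (simp add: run_0 tm_init_def)

text \<open>\<open>b\<close> is the cell in question, \<open>a\<close> and \<open>c\<close> are its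
  neighbours and \<open>d\<close> lies below it. The broadcast symbols are equal along a row and
  correct under each head. In the first row a blank on the witness tape 1 is followed by a blank,
  unless the next cell carries its head: this is cell 0, where the witness begins. A border
  reproduces itself downwards.\<close>

definition fits :: "tile \<Rightarrow> tile \<Rightarrow> tile \<Rightarrow> tile \<Rightarrow> bool" where
  "fits a b c d \<longleftrightarrow> (case b of Border \<Rightarrow> d = Border | Cell i q s sy hs \<Rightarrow>
     (\<forall>j<k. hs ! j \<longrightarrow> s ! j = sy ! j) \<and>
     (case c of Border \<Rightarrow> True
      | Cell i' q' s' sy' hs' \<Rightarrow> s' = s \<and> (i \<and> sy ! 1 = 0 \<and> \<not> hs' ! 1 \<longrightarrow> sy' ! 1 = 0)) \<and>
     (case d of Border \<Rightarrow> False
      | Cell i' q' s' sy' hs' \<Rightarrow> \<not> i' \<and> q' = fst (act q s) \<and>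
        (\<forall>j<k. sy' ! j = (if hs ! j then fst (snd (act q s) ! j) else sy ! j)) \<and>
        (\<forall>j<k. hs' ! j \<longleftrightarrow> (case snd (snd (act q s) ! j) of
            Move_left \<Rightarrow> head_at c j | Stay \<Rightarrow> hs ! j | Move_right \<Rightarrow> head_at a j))))"

definition tiles :: "tile set" where
  "tiles = insert Border
     ((\<lambda>(i, q, s, sy, hs). Cell i q s sy hs) `
        (UNIV \<times> {..<tm_states M} \<times> {s. set s \<subseteq> {..<tm_symbols M} \<and> length s = k} \<times>
         {s. set s \<subseteq> {..<tm_symbols M} \<and> length s = k} \<times> {s. set s \<subseteq> UNIV \<and> length s = k}))"

lemma finite_tiles: "finite tiles"
  unfolding tiles_def
  by (intro finite.insertI finite_imageI finite_cartesian_product finite_lists_length_eq finite_lessThan) simp_all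

lemma Border_in_tiles: "Border \<in> tiles"
  by (simp add: tiles_def)

lemma Cell_in_tiles:
  "Cell i q s sy hs \<in> tiles \<longleftrightarrow> q < tm_states M \<and> set s \<subseteq> {..<tm_symbols M} \<and> length s = k \<and>
     set sy \<subseteq> {..<tm_symbols M} \<and> length sy = k \<and> length hs = k"
  by (auto simp: tiles_def image_iff)

abbreviation (input) "syms_at C z \<equiv> map (\<lambda>j. tapes C j z) [0..<k]"
abbreviation (input) "heads_at C z \<equiv> map (\<lambda>j. heads C j = z) [0..<k]"
abbreviation (input) "coord tt j \<equiv> int j - 1 - int tt"

definition cell :: "bool \<Rightarrow> tm_config \<Rightarrow> int \<Rightarrow> tile" where
  "cell i C z = Cell i (fst C) (scan C) (syms_at C z) (heads_at C z)"

lemma cell_in_tiles: "good C \<Longrightarrow> cell i C z \<in> tiles"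
  by (auto simp: cell_def Cell_in_tiles good_def scan_def)

lemma head_at_cell [simp]: "j < k \<Longrightarrow> head_at (cell i C z) j \<longleftrightarrow> heads C j = z"
  by (simp add: cell_def)

lemma fits_cell:
  assumes a: "\<And>j. j < k \<Longrightarrow> head_at a j \<longleftrightarrow> heads C j = z - 1"
    and c: "c = cell i C (z + 1) \<or> (c = Border \<and> (\<forall>j<k. heads C j \<noteq> z + 1))"
    and ini: "i \<Longrightarrow> tapes C 1 z = 0 \<Longrightarrow> heads C 1 \<noteq> z + 1 \<Longrightarrow> tapes C 1 (z + 1) = 0"
  shows "fits a (cell i C z) c (cell False (tm_step M C) z)"
proof -
  have hc: "head_at c j \<longleftrightarrow> heads C j = z + 1" if "j < k" for j
    using c that by auto
  have move: "(heads C j + shift mv = z) = (case mv of Move_left \<Rightarrow> head_at c j | Stay \<Rightarrow> heads C j = z | Move_right \<Rightarrow> head_at a j)"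
    if "j < k" for j mv
    using a[OF that] hc[OF that] by (cases mv) auto
  show ?thesis
    using c ini k(2) unfolding fits_def
    by (auto simp: cell_def tm_step_simps move split: head_move.splits)
qed

text \<open>Row \<open>t\<close> of the tableau occupies the positions from \<open>t * width tt\<close> onwards: a border tile, then
  the cells \<open>-tt, \<dots>, tt\<close> of all tapes at time \<open>t\<close>.\<close>

definition width :: "nat \<Rightarrow> nat" where
  "width tt = 2 * tt + 2"

section \<open>The tableau of a run\<close>

definition grid :: "bool list \<Rightarrow> bool list \<Rightarrow> nat \<Rightarrow> nat \<Rightarrow> tile" where
  "grid x w tt p = (if p mod width tt = 0 then Border
     else cell (p div width tt = 0) (run x w (p div width tt)) (coord tt (p mod width tt)))"

text \<open>Apart from the scanned symbols, which \<open>fits\<close> determines, the first row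
  leaves open only the witness, within the \<open>l\<close> cells from 0 on. Borders are prescribed
  at two positions, because the window at \<open>p\<close> has its \<open>b\<close> at
  \<open>p + 1\<close> and thus cannot carry the border at 0 down to the second row.\<close>

definition initial :: "bool list \<Rightarrow> nat \<Rightarrow> nat \<Rightarrow> nat \<Rightarrow> tile \<Rightarrow> bool" where
  "initial x l tt p a \<longleftrightarrow>
     (p = 0 \<or> p = width tt \<longrightarrow> a = Border) \<and>
     (0 < p \<and> p < width tt \<longrightarrow> (case a of Border \<Rightarrow> False | Cell i q s sy hs \<Rightarrow>
        i \<and> q = 0 \<and> (\<forall>j<k. 2 \<le> j \<longrightarrow> sy ! j = 0) \<and> (\<forall>j<k. hs ! j \<longleftrightarrow> p = tt + 1) \<and>
        sy ! 0 = tape_of x (coord tt p) \<and>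
        sy ! 1 \<le> 2 \<and> (p < tt + 1 \<or> tt + 1 + l \<le> p \<longrightarrow> sy ! 1 = 0)))"

definition accepting :: "tile \<Rightarrow> bool" where
  "accepting a \<longleftrightarrow> (case a of Border \<Rightarrow> False | Cell i q s sy hs \<Rightarrow> sy ! (k - 1) = 2)"

lemma grid_in_tiles: "grid x w tt p \<in> tiles"
  by (simp add: grid_def cell_in_tiles good_run Border_in_tiles)

lemma width_pos: "0 < width tt"
  by (simp add: width_def)

lemma grid_row:
  assumes "0 < j" "j < width tt"
  shows "grid x w tt (t * width tt + j) = cell (t = 0) (run x w t) (coord tt j)"
  using assms by (simp add: grid_def)

lemma grid_border: "grid x w tt (t * width tt) = Border"
  using width_pos by (simp add: grid_def)

lemma grid_initial:
  assumes "length w \<le> l"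
  shows "initial x l tt p (grid x w tt p)"
proof -
  have "grid x w tt 0 = Border" "grid x w tt (width tt) = Border"
    using grid_border[of x w tt 0] grid_border[of x w tt 1] by auto
  moreover have "grid x w tt p = cell True (tm_init [x, w]) (coord tt p)" if "0 < p" "p < width tt"
    using grid_row[of p tt x w 0] that by (simp add: run_0)
  ultimately show ?thesis
    using assms k(2) by (auto simp: initial_def cell_def tm_init_def tape_of_def bit_symbol_def nth_Cons')
qed

lemma fits_grid:
  assumes p: "p < (tt + 1) * width tt"
  shows "fits (grid x w tt p) (grid x w tt (p + 1)) (grid x w tt (p + 2)) (grid x w tt (p + width tt + 1))"
proof -
  define W where "W = width tt"
  define t where "t = (p + 1) div W"
  define j where "j = (p + 1) mod W"
  have W: "W = 2 * tt + 2" by (simp add: W_def width_def)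
  have pj: "p + 1 = t * W + j" unfolding t_def j_def by (rule div_mult_mod_eq[symmetric])
  have jW: "j < W" using W by (simp add: j_def)
  show ?thesis
  proof (cases "j = 0")
    case True
    then have "p + 1 = t * width tt" "p + width tt + 1 = (t + 1) * width tt" using pj W_def by auto
    then have "grid x w tt (p + 1) = Border" "grid x w tt (p + width tt + 1) = Border"
      by (simp_all only: grid_border)
    then show ?thesis by (simp add: fits_def)
  next
    case False
    let ?C = "run x w t"
    let ?z = "coord tt j"
    have "t * W < (tt + 1) * W"
      using p pj False unfolding W_def[symmetric] by linarith
    then have t: "t \<le> tt" unfolding mult_less_cancel2 by simp
    have hb: "\<bar>heads ?C j'\<bar> \<le> int tt" if "j' < k" for j'
      using heads_run[OF that, of x w t] t by linarith
    have b: "grid x w tt (p + 1) = cell (t = 0) ?C ?z"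
      using False jW unfolding pj W_def by (intro grid_row) auto
    have pW: "p + width tt + 1 = (t + 1) * width tt + j" using pj unfolding W_def by (simp add: algebra_simps)
    have d: "grid x w tt (p + width tt + 1) = cell False (run x w (t + 1)) ?z"
      using grid_row[of j tt x w "t + 1"] False jW unfolding W_def pW by simp
    have a: "head_at (grid x w tt p) j' \<longleftrightarrow> heads ?C j' = ?z - 1" if "j' < k" for j'
    proof (cases "j = 1")
      case True
      then have "grid x w tt p = Border" using pj grid_border[of x w tt t] W_def by simp
      then show ?thesis using hb[OF that] True by auto
    next
      case False
      then have "p = t * W + (j - 1)" using pj \<open>j \<noteq> 0\<close> by simp
      then have "grid x w tt p = cell (t = 0) ?C (coord tt (j - 1))"
        using False \<open>j \<noteq> 0\<close> jW grid_row[of "j - 1" tt x w t] unfolding W_def by simp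
      then show ?thesis using that \<open>j \<noteq> 0\<close> by (auto simp: of_nat_diff)
    qed
    have c: "grid x w tt (p + 2) = cell (t = 0) ?C (?z + 1) \<or>
        (grid x w tt (p + 2) = Border \<and> (\<forall>j'<k. heads ?C j' \<noteq> ?z + 1))"
    proof (cases "j + 1 = W")
      case True
      then have "p + 2 = (t + 1) * width tt" using pj W_def by simp
      then have "grid x w tt (p + 2) = Border" by (simp only: grid_border)
      moreover have "heads ?C j' \<noteq> ?z + 1" if "j' < k" for j'
        using hb[OF that] True W by auto
      ultimately show ?thesis by blast
    next
      case False
      then have "p + 2 = t * W + (j + 1)" using pj by simp
      then have "grid x w tt (p + 2) = cell (t = 0) ?C (coord tt (j + 1))"
        using False jW grid_row[of "j + 1" tt x w t] unfolding W_def by simp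
      then show ?thesis by (simp add: algebra_simps)
    qed
    have ini: "tapes ?C 1 (?z + 1) = 0" if "t = 0" "tapes ?C 1 ?z = 0" "heads ?C 1 \<noteq> ?z + 1"
      using that by (auto simp: run_0 tm_init_def tape_of_def bit_symbol_def split: if_splits)
    show ?thesis unfolding b d
      using fits_cell[OF a c ini] by (simp add: run_Suc)
  qed
qed

lemma grid_accepting:
  assumes "tapes (run x w tt) (k - 1) 0 = 2"
  shows "accepting (grid x w tt (tt * width tt + tt + 1))"
proof -
  have "grid x w tt (tt * width tt + tt + 1) = cell (tt = 0) (run x w tt) 0"
    using grid_row[of "tt + 1" tt x w tt] by (simp add: width_def algebra_simps)
  then show ?thesis using assms k(2) by (simp add: accepting_def cell_def)
qed

text \<open>The broadcast of the scanned symbols along a row, together with the cells under the heads,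
  determines them.\<close>

lemma scan_row:
  assumes row: "\<And>j. 0 < j \<Longrightarrow> j < width tt \<Longrightarrow> \<exists>s. length s = k \<and> \<tau> (t * width tt + j) =
      Cell i q s (syms_at C (coord tt j)) (heads_at C (coord tt j))"
    and fit: "\<And>p. p < (tt + 1) * width tt \<Longrightarrow> fits (\<tau> p) (\<tau> (p + 1)) (\<tau> (p + 2)) (\<tau> (p + width tt + 1))"
    and t: "t \<le> tt" and hb: "\<And>j. j < k \<Longrightarrow> \<bar>heads C j\<bar> \<le> int tt" and q: "q = fst C"
    and j: "0 < j" "j < width tt"
  shows "\<tau> (t * width tt + j) = cell i C (coord tt j)"
proof -
  define W where "W = width tt"
  have W: "W = 2 * tt + 2" by (simp add: W_def width_def)
  let ?sy = "\<lambda>j. syms_at C (coord tt j)"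
  let ?hs = "\<lambda>j. heads_at C (coord tt j)"
  obtain s where s: "\<And>j. 0 < j \<Longrightarrow> j < W \<Longrightarrow> length (s j) = k \<and> \<tau> (t * W + j) = Cell i q (s j) (?sy j) (?hs j)"
    using row unfolding W_def by metis
  have win: "fits (\<tau> (t * W + j - 1)) (\<tau> (t * W + j)) (\<tau> (t * W + Suc j)) (\<tau> (t * W + W + j))"
    if "0 < j" "j < W" for j
  proof -
    have "t * W + j < (tt + 1) * W"
    proof -
      have "t * W + j < (t + 1) * W" using that by simp
      also have "\<dots> \<le> (tt + 1) * W" using t by (intro mult_right_mono) auto
      finally show ?thesis .
    qed
    then have "t * W + j - 1 < (tt + 1) * width tt" unfolding W_def by linarith
    from fit[OF this] that show ?thesis by (simp add: W_def algebra_simps)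
  qed
  have eq: "s j = s 1" if "0 < j" "j < W" for j
    using that
  proof (induction j)
    case (Suc j)
    show ?case
    proof (cases "j = 0")
      case False
      then have "s (Suc j) = s j" using win[of j] s[of j] s[of "Suc j"] Suc.prems by (auto simp: fits_def)
      then show ?thesis using Suc False by simp
    qed simp
  qed simp
  have "s 1 = scan C"
  proof (rule nth_equalityI)
    show "length (s 1) = length (scan C)" using s[of 1] W by simp
    fix j' assume "j' < length (s 1)"
    then have j': "j' < k" using s[of 1] W by simp
    define j where "j = nat (heads C j' + 1 + int tt)"
    have j: "int j = heads C j' + 1 + int tt" "0 < j" "j < W" using hb[OF j'] W by (auto simp: j_def)
    have "s j ! j' = ?sy j ! j'"
      using win[OF j(2,3)] s[OF j(2,3)] j(1) j' by (auto simp: fits_def)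
    then show "s 1 ! j' = scan C ! j'" using eq[OF j(2,3)] j(1) j' by simp
  qed
  then show ?thesis using s[of j] eq[of j] j q unfolding W_def by (simp add: cell_def)
qed

text \<open>A tiling whose first row spells \<open>w\<close> on tape 1 is the tableau of the run on
  \<open>w\<close>. Row by row, the windows determine state, symbols and heads from the row above,
  and \<open>scan_row\<close> then determines the broadcast symbols.\<close>

lemma rows_eq_run:
  assumes fit: "\<And>p. p < (tt + 1) * width tt \<Longrightarrow> fits (\<tau> p) (\<tau> (p + 1)) (\<tau> (p + 2)) (\<tau> (p + width tt + 1))"
    and til: "\<And>p. p < (tt + 2) * width tt \<Longrightarrow> \<tau> p \<in> tiles"
    and ini: "\<And>p. p \<le> width tt \<Longrightarrow> initial x l tt p (\<tau> p)"
    and w: "\<And>j. 0 < j \<Longrightarrow> j < width tt \<Longrightarrow>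
      (case \<tau> j of Border \<Rightarrow> False | Cell i q s sy hs \<Rightarrow> sy ! 1 = tape_of w (coord tt j))"
    and t: "t \<le> tt" and j: "0 < j" "j < width tt"
  shows "\<tau> (t * width tt + j) = cell (t = 0) (run x w t) (coord tt j)"
proof -
  define W where "W = width tt"
  have W: "W = 2 * tt + 2" by (simp add: W_def width_def)
  \<comment> \<open>Rows 0 and 1 are covered by \<open>initial\<close>; each further border comes
    from the window whose \<open>b\<close> is the border above it.\<close>
  have border: "\<tau> (t * W) = Border" if "t \<le> tt + 1" for t
    using that
  proof (induction t)
    case 0
    show ?case using ini[of 0] by (simp add: initial_def)
  next
    case (Suc t)
    show ?case
    proof (cases "t = 0")
      case True
      then show ?thesis using ini[of W] by (simp add: initial_def W_def)
    next
      case False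
      then have "0 < t * W" using W by simp
      moreover have "t * W \<le> (tt + 1) * W" using Suc.prems by (intro mult_right_mono) auto
      ultimately obtain p where p: "t * W = Suc p" "p < (tt + 1) * W"
        by (metis Suc_le_lessD gr0_conv_Suc)
      then have "fits (\<tau> p) (\<tau> (t * W)) (\<tau> (t * W + 1)) (\<tau> (t * W + W))"
        using fit[of p] unfolding W_def[symmetric] by simp
      then show ?thesis using Suc by (simp add: fits_def add.commute)
    qed
  qed
  have less: "t * W + j < (tt + 2) * W" if "t \<le> tt + 1" "j < W" for t j
  proof -
    have "t * W + j < (t + 1) * W" using that by simp
    also have "\<dots> \<le> (tt + 2) * W" using that by (intro mult_right_mono) auto
    finally show ?thesis .
  qed
  show ?thesis using t j unfolding W_def[symmetric]
  proof (induction t arbitrary: j)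
    case 0
    have "\<exists>s. length s = k \<and> \<tau> (0 * width tt + j) =
        Cell True 0 s (syms_at (run x w 0) (coord tt j))
          (heads_at (run x w 0) (coord tt j))"
      if j: "0 < j" "j < width tt" for j
    proof -
      have "initial x l tt j (\<tau> j)" "\<tau> j \<in> tiles" using ini[of j] til[of j] less[of 0 j] j unfolding W_def by auto
      then obtain s sy hs where \<tau>: "\<tau> j = Cell True 0 s sy hs" and len: "length s = k" "length sy = k" "length hs = k"
        and r: "\<And>j'. j' < k \<Longrightarrow> 2 \<le> j' \<Longrightarrow> sy ! j' = 0" "\<And>j'. j' < k \<Longrightarrow> hs ! j' \<longleftrightarrow> j = tt + 1"
          "sy ! 0 = tape_of x (coord tt j)"
        using j by (auto simp: initial_def Cell_in_tiles split: tile.splits)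
      have sy1: "sy ! 1 = tape_of w (coord tt j)" using w[OF j] \<tau> by simp
      have "sy = syms_at (run x w 0) (coord tt j)"
      proof (rule nth_equalityI)
        fix j' assume "j' < length sy"
        then have "j' < k" using len by simp
        then show "sy ! j' = syms_at (run x w 0) (coord tt j) ! j'"
          using r sy1 by (cases "j' = 0"; cases "j' = 1") (auto simp: run_0 tm_init_def)
      qed (simp add: len)
      moreover have "hs = heads_at (run x w 0) (coord tt j)"
        by (rule nth_equalityI) (use len r in \<open>auto simp: run_0 tm_init_def\<close>)
      ultimately show ?thesis using \<tau> len by simp
    qed
    from scan_row[where \<tau> = \<tau> and t = 0, OF this fit _ _ _ ] 0 show ?case
      by (simp add: W_def run_0 tm_init_def)
  next
    case (Suc t)
    let ?C = "run x w t" and ?C' = "run x w (Suc t)"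
    have t: "t \<le> tt" using Suc.prems by simp
    have IH: "\<tau> (t * W + j) = cell (t = 0) ?C (coord tt j)" if "0 < j" "j < W" for j
      using Suc.IH[OF t that] .
    have hb: "\<bar>heads ?C j'\<bar> \<le> int tt" "\<bar>heads ?C' j'\<bar> \<le> int tt" if "j' < k" for j'
      using heads_run[OF that, of x w t] heads_run[OF that, of x w "Suc t"] Suc.prems by linarith+
    have "\<exists>s. length s = k \<and> \<tau> (Suc t * width tt + j) =
        Cell False (fst ?C') s (syms_at ?C' (coord tt j))
          (heads_at ?C' (coord tt j))"
      if j: "0 < j" "j < width tt" for j
    proof -
      let ?z = "coord tt j"
      have "t * W + j < (t + 1) * W" using j by (simp add: W_def)
      also have "\<dots> \<le> (tt + 1) * W" using t by (intro mult_right_mono) auto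
      finally have less1: "t * W + j - 1 < (tt + 1) * width tt" unfolding W_def by linarith
      define a0 c0 where a0: "a0 = \<tau> (t * W + (j - 1))" and c0: "c0 = \<tau> (t * W + Suc j)"
      from fit[OF less1] have f: "fits a0 (\<tau> (t * W + j)) c0 (\<tau> (Suc t * W + j))"
        using j by (simp add: W_def algebra_simps a0 c0)
      have a: "head_at a0 j' \<longleftrightarrow> heads ?C j' = ?z - 1" if "j' < k" for j'
      proof (cases "j = 1")
        case True
        then show ?thesis using border[of t] t hb(1)[OF that] by (auto simp: a0)
      next
        case False
        then have "\<tau> (t * W + (j - 1)) = cell (t = 0) ?C (coord tt (j - 1))"
          using j by (intro IH) (auto simp: W_def)
        then show ?thesis using that j by (auto simp: a0 of_nat_diff)
      qed
      have c: "head_at c0 j' \<longleftrightarrow> heads ?C j' = ?z + 1" if "j' < k" for j'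
      proof (cases "Suc j = W")
        case True
        then have "\<tau> (t * W + Suc j) = Border" using border[of "Suc t"] t by (simp add: add.commute)
        moreover have "heads ?C j' \<noteq> ?z + 1" using hb(1)[OF that] True W by auto
        ultimately show ?thesis by (simp add: c0)
      next
        case False
        then have "\<tau> (t * W + Suc j) = cell (t = 0) ?C (coord tt (Suc j))"
          using j by (intro IH) (auto simp: W_def)
        then show ?thesis using that by (auto simp: c0)
      qed
      have move: "(heads ?C j' + shift mv = ?z) = (case mv of Move_left \<Rightarrow> head_at c0 j'
          | Stay \<Rightarrow> heads ?C j' = ?z | Move_right \<Rightarrow> head_at a0 j')"
        if "j' < k" for j' mv
        using a[OF that] c[OF that] by (cases mv) auto
      have b: "\<tau> (t * W + j) = cell (t = 0) ?C ?z" using j by (intro IH) (auto simp: W_def)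
      have "\<tau> (Suc t * W + j) \<in> tiles"
        using til less[of "Suc t" j] Suc.prems j unfolding W_def by auto
      then obtain i q s sy hs where \<tau>: "\<tau> (Suc t * W + j) = Cell i q s sy hs"
        and len: "length s = k" "length sy = k" "length hs = k"
        using f b by (cases "\<tau> (Suc t * W + j)") (auto simp: fits_def cell_def Cell_in_tiles)
      have r: "\<not> i" "q = fst ?C'" "\<And>j'. j' < k \<Longrightarrow> sy ! j' = tapes ?C' j' ?z" "\<And>j'. j' < k \<Longrightarrow> hs ! j' \<longleftrightarrow> heads ?C' j' = ?z"
        using f unfolding b \<tau> by (auto simp: fits_def cell_def run_Suc tm_step_simps move split: head_move.splits)
      have "sy = syms_at ?C' ?z" "hs = heads_at ?C' ?z"
        by (rule nth_equalityI; use len r in simp)+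
      then show ?thesis using \<tau> r len unfolding W_def by simp
    qed
    from scan_row[where \<tau> = \<tau> and t = "Suc t", OF this fit _ hb(2)] Suc.prems show ?case
      by (simp add: W_def)
  qed
qed

text \<open>The last window ends at position \<open>(tt + 2) * width tt\<close>, the border of row
  \<open>tt + 2\<close>; hence \<open>tt + 3\<close> rows of tiles. The accepting position is cell 0
  in row \<open>tt\<close>.\<close>

definition tiling :: "bool list \<Rightarrow> nat \<Rightarrow> nat \<Rightarrow> (nat \<Rightarrow> tile) \<Rightarrow> bool" where
  "tiling x l tt \<tau> \<longleftrightarrow>
     (\<forall>p < (tt + 3) * width tt. \<tau> p \<in> tiles \<and> initial x l tt p (\<tau> p)) \<and>
     accepting (\<tau> (tt * width tt + tt + 1)) \<and>
     (\<forall>p < (tt + 1) * width tt. fits (\<tau> p) (\<tau> (p + 1)) (\<tau> (p + 2)) (\<tau> (p + width tt + 1)))"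

text \<open>A witness gives the tableau of its run. Conversely, the witness is read off tape 1 in
  the first row up to the first blank; the condition of \<open>fits\<close> on the first row makes
  all later cells blank, so the row is that of a proper input.\<close>

theorem tiling_iff:
  assumes l: "l \<le> tt"
    and out: "\<And>w. length w \<le> l \<Longrightarrow> tm_outputs M [x, w] tt [R w]"
  shows "(\<exists>\<tau>. tiling x l tt \<tau>) \<longleftrightarrow> (\<exists>w. length w \<le> l \<and> R w)"
proof -
  have R: "R w \<longleftrightarrow> tapes (run x w tt) (k - 1) 0 = 2" if "length w \<le> l" for w
    using out[OF that] by (auto simp: tm_outputs_def run_def k(1) bit_symbol_def split: prod.splits if_splits)
  show ?thesis
  proof
    assume "\<exists>w. length w \<le> l \<and> R w"
    then obtain w where w: "length w \<le> l" "R w" by blast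
    have "tiling x l tt (grid x w tt)"
      unfolding tiling_def
      using grid_in_tiles grid_initial[OF w(1)] grid_accepting fits_grid R[OF w(1)] w(2) by blast
    then show "\<exists>\<tau>. tiling x l tt \<tau>" by blast
  next
    assume "\<exists>\<tau>. tiling x l tt \<tau>"
    then obtain \<tau> where \<tau>: "tiling x l tt \<tau>" by blast
    have fit: "fits (\<tau> p) (\<tau> (p + 1)) (\<tau> (p + 2)) (\<tau> (p + width tt + 1))" if "p < (tt + 1) * width tt" for p
      using \<tau> that by (auto simp: tiling_def)
    have til: "\<tau> p \<in> tiles" "initial x l tt p (\<tau> p)" if "p < (tt + 3) * width tt" for p
      using \<tau> that by (auto simp: tiling_def)
    define sy where "sy j = (case \<tau> (tt + 1 + j) of Cell i q s sy hs \<Rightarrow> sy ! 1)" for j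
    \<comment> \<open>Cell \<open>l\<close> is blank by \<open>initial\<close>, so the least index
      exists and is at most \<open>l\<close>.\<close>
    define n where "n = (LEAST j. sy j = 0)"
    have w0: "width tt \<le> (tt + 3) * width tt" by simp
    have cellE: "\<exists>s sy hs. \<tau> j = Cell True 0 s sy hs \<and> (\<forall>j'<k. hs ! j' \<longleftrightarrow> j = tt + 1) \<and> sy ! 1 \<le> 2 \<and>
        (j < tt + 1 \<or> tt + 1 + l \<le> j \<longrightarrow> sy ! 1 = 0)" if "0 < j" "j < width tt" for j
      using til(2)[of j] w0 that by (auto simp: initial_def split: tile.splits)
    have "sy l = 0" using cellE[of "tt + 1 + l"] l by (auto simp: sy_def width_def)
    then have n: "sy n = 0" "n \<le> l" and nz: "\<And>j. j < n \<Longrightarrow> sy j \<noteq> 0"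
      unfolding n_def by (auto intro: LeastI Least_le dest: not_less_Least)
    have sy0: "sy j = 0" if "n \<le> j" "j \<le> tt" for j
      using that
    proof (induction j rule: dec_induct)
      case base
      show ?case using n by simp
    next
      case (step j)
      have less: "tt + j < (tt + 1) * width tt" using step.prems by (simp add: width_def)
      obtain s1 sy1 hs1 where 1: "\<tau> (tt + 1 + j) = Cell True 0 s1 sy1 hs1"
        using cellE[of "tt + 1 + j"] step.prems by (auto simp: width_def)
      obtain s2 sy2 hs2 where 2: "\<tau> (tt + 1 + Suc j) = Cell True 0 s2 sy2 hs2" "\<not> hs2 ! 1"
        using cellE[of "tt + 1 + Suc j"] step.prems k(2) by (auto simp: width_def)
      have "sy1 ! 1 = 0" using step 1 by (simp add: sy_def)
      moreover have "sy1 ! 1 = 0 \<longrightarrow> sy2 ! 1 = 0"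
        using fit[OF less] 1 2 by (simp add: fits_def)
      ultimately show ?case using 2(1) by (simp add: sy_def)
    qed
    define w where "w = map (\<lambda>j. sy j = 2) [0..<n]"
    have w: "case \<tau> j of Border \<Rightarrow> False | Cell i q s sy hs \<Rightarrow> sy ! 1 = tape_of w (coord tt j)"
      if j: "0 < j" "j < width tt" for j
    proof -
      obtain s syj hs where c: "\<tau> j = Cell True 0 s syj hs" "syj ! 1 \<le> 2" "j < tt + 1 \<longrightarrow> syj ! 1 = 0"
        using cellE[OF j] by auto
      have "syj ! 1 = tape_of w (coord tt j)"
      proof (cases "j < tt + 1")
        case True
        then show ?thesis using c by (simp add: tape_of_def)
      next
        case False
        define j' where "j' = j - (tt + 1)"
        have j': "j = tt + 1 + j'" "j' \<le> tt" using False j by (auto simp: j'_def width_def)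
        have e: "syj ! 1 = sy j'" using c j' by (simp add: sy_def)
        show ?thesis
        proof (cases "j' < n")
          case True
          then have "sy j' = 1 \<or> sy j' = 2" using nz[of j'] c(2) e by linarith
          then show ?thesis using True e j' by (auto simp: tape_of_def w_def bit_symbol_def)
        next
          case False
          then show ?thesis using sy0[of j'] e j' by (simp add: tape_of_def w_def)
        qed
      qed
      then show ?thesis using c by simp
    qed
    have "\<tau> (tt * width tt + (tt + 1)) = cell (tt = 0) (run x w tt) (coord tt (tt + 1))"
    proof (rule rows_eq_run[OF fit _ _ w])
      show "\<tau> p \<in> tiles" if "p < (tt + 2) * width tt" for p
        by (intro til(1) less_le_trans[OF that] mult_right_mono) auto
      show "initial x l tt p (\<tau> p)" if "p \<le> width tt" for p
        by (intro til(2) le_less_trans[OF that]) (simp add: width_def)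
    qed (auto simp: width_def)
    moreover have "accepting (\<tau> (tt * width tt + tt + 1))" using \<tau> by (simp add: tiling_def)
    ultimately have "tapes (run x w tt) (k - 1) 0 = 2"
      using k(2) by (simp add: accepting_def cell_def add.assoc)
    moreover have "length w \<le> l" using n(2) by (simp add: w_def)
    ultimately show "\<exists>w. length w \<le> l \<and> R w" using R by blast
  qed
qed

end

section \<open>The Cook-Levin theorem\<close>

text \<open>Horner's scheme.\<close>

lemma ex_poly_aexp: "\<exists>e. avars e \<subseteq> avars a \<and> (\<forall>x env. aval e x env = poly p (aval a x env))"
proof (induction p)
  case 0
  show ?case by (intro exI[of _ "Lit 0"]) simp
next
  case (pCons c p)
  then obtain e where "avars e \<subseteq> avars a" "\<And>x env. aval e x env = poly p (aval a x env)" by blast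
  then show ?case by (intro exI[of _ "Add (Lit c) (Mul a e)"]) auto
qed

text \<open>With truncated subtraction, \<open>1 - (1 - n)\<close> is 1 for positive
  \<open>n\<close> and 0 otherwise.\<close>

definition aless :: "aexp \<Rightarrow> aexp \<Rightarrow> aexp" where
  "aless a b = Sub (Lit 1) (Sub (Lit 1) (Sub b a))"

definition aeq :: "aexp \<Rightarrow> aexp \<Rightarrow> aexp" where
  "aeq a b = Sub (Lit 1) (Add (Sub a b) (Sub b a))"

lemma aval_aless [simp]: "aval (aless a b) x env = of_bool (aval a x env < aval b x env)"
  by (auto simp: aless_def)

lemma aval_aeq [simp]: "aval (aeq a b) x env = of_bool (aval a x env = aval b x env)"
  by (auto simp: aeq_def)

lemma avars_aless [simp]: "avars (aless a b) = avars a \<union> avars b"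
  by (auto simp: aless_def)

lemma avars_aeq [simp]: "avars (aeq a b) = avars a \<union> avars b"
  by (auto simp: aeq_def)

lemma aval_closed: "avars a = {} \<Longrightarrow> aval a x env = aval a x env'"
  by (rule aval_cong) simp

text \<open>A scheme \<open>(s, ls, d)\<close> stands for one clause for each \<open>p < P\<close> with \<open>d p \<noteq> 0\<close>: some of the
  variables with indices \<open>ls p\<close> has the value \<open>s\<close>. The number \<open>p\<close> is the value of variable 0.\<close>

type_synonym cnf = "(bool \<times> aexp list \<times> aexp) list"

definition sat :: "cnf \<Rightarrow> aexp \<Rightarrow> bool list \<Rightarrow> (nat \<Rightarrow> bool) \<Rightarrow> bool" where
  "sat F P x \<beta> \<longleftrightarrow> (\<forall>(s, ls, d)\<in>set F. \<forall>p < aval P x (\<lambda>_. 0).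
     aval d x (\<lambda>_. p) \<noteq> 0 \<longrightarrow> (\<exists>l\<in>set ls. \<beta> (aval l x (\<lambda>_. p)) = s))"

text \<open>The same number bounds variable indices and clause lengths: in the strong cases it
  becomes the dimension of the hypercube and controls the entries. Positivity is there because
  instances need positive dimensions.\<close>

definition cnf_bounded :: "cnf \<Rightarrow> aexp \<Rightarrow> aexp \<Rightarrow> bool" where
  "cnf_bounded F P m \<longleftrightarrow> F \<noteq> [] \<and> avars P = {} \<and> avars m = {} \<and>
     (\<forall>(s, ls, d)\<in>set F. avars d \<subseteq> {0} \<and> (\<forall>l\<in>set ls. avars l \<subseteq> {0})) \<and>
     (\<forall>x. 0 < aval P x (\<lambda>_. 0) \<and> 0 < aval m x (\<lambda>_. 0) \<and>
        (\<forall>(s, ls, d)\<in>set F. length ls \<le> aval m x (\<lambda>_. 0) \<and>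
           (\<forall>l\<in>set ls. \<forall>p < aval P x (\<lambda>_. 0). aval l x (\<lambda>_. p) < aval m x (\<lambda>_. 0))))"

text \<open>The variable saying that position \<open>p + e\<close> carries tile \<open>i\<close> of
  the list, where \<open>p\<close> is the parameter of the scheme.\<close>

definition tile_var :: "nat \<Rightarrow> aexp \<Rightarrow> nat \<Rightarrow> aexp" where
  "tile_var K e i = Add (Mul (Add (Var 0) e) (Lit K)) (Lit i)"

text \<open>Three groups: a suitable tile for each demand, at most one tile per position, no illegal
  window. The last components switch off the pairs with \<open>i = j\<close> and the windows that
  fit. Literals are positive in the first group and negative in the others, so each clause has one
  sign.\<close>

definition tiling_cnf :: "'a list \<Rightarrow> (('a \<Rightarrow> bool) \<times> aexp) list \<Rightarrow> ('a \<Rightarrow> 'a \<Rightarrow> 'a \<Rightarrow> 'a \<Rightarrow> bool) \<Rightarrow>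
    aexp \<Rightarrow> aexp \<Rightarrow> cnf" where
  "tiling_cnf gs Ds fits N W = (let K = length gs in
     map (\<lambda>(S, d). (True, map (tile_var K (Lit 0)) (filter (\<lambda>i. S (gs ! i)) [0..<K]), d)) Ds @
     concat (map (\<lambda>i. map (\<lambda>j. (False, [tile_var K (Lit 0) i, tile_var K (Lit 0) j], Lit (of_bool (i \<noteq> j)))) [0..<K]) [0..<K]) @
     concat (map (\<lambda>a. concat (map (\<lambda>b. concat (map (\<lambda>c. map (\<lambda>d.
       (False, [tile_var K (Lit 0) a, tile_var K (Lit 1) b, tile_var K (Lit 2) c, tile_var K (Add W (Lit 1)) d],
        Mul (Lit (of_bool (\<not> fits (gs ! a) (gs ! b) (gs ! c) (gs ! d)))) (aless (Var 0) N)))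
       [0..<K]) [0..<K])) [0..<K])) [0..<K]))"

lemma sat_append: "sat (F @ G) P x \<beta> \<longleftrightarrow> sat F P x \<beta> \<and> sat G P x \<beta>"
  by (simp add: sat_def ball_Un)

lemma sat_concat_map: "sat (concat (map f xs)) P x \<beta> \<longleftrightarrow> (\<forall>a\<in>set xs. sat (f a) P x \<beta>)"
  by (auto simp: sat_def)

lemma sat_tiling_cnf_iff:
  assumes N: "avars N = {}" and W: "avars W = {}"
  shows "sat (tiling_cnf gs Ds fits N W) P x \<beta> \<longleftrightarrow>
    (\<forall>(S, d)\<in>set Ds. \<forall>p < aval P x (\<lambda>_. 0). aval d x (\<lambda>_. p) \<noteq> 0 \<longrightarrow>
       (\<exists>i < length gs. S (gs ! i) \<and> \<beta> (p * length gs + i))) \<and>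
    (\<forall>i < length gs. \<forall>j < length gs. \<forall>p < aval P x (\<lambda>_. 0).
       \<beta> (p * length gs + i) \<and> \<beta> (p * length gs + j) \<longrightarrow> i = j) \<and>
    (\<forall>a < length gs. \<forall>b < length gs. \<forall>c < length gs. \<forall>d < length gs. \<forall>p < aval P x (\<lambda>_. 0). p < aval N x (\<lambda>_. 0) \<and>
       \<beta> (p * length gs + a) \<and> \<beta> ((p + 1) * length gs + b) \<and> \<beta> ((p + 2) * length gs + c) \<and>
       \<beta> ((p + aval W x (\<lambda>_. 0) + 1) * length gs + d) \<longrightarrow> fits (gs ! a) (gs ! b) (gs ! c) (gs ! d))"
proof -
  define n w where n: "n = aval N x (\<lambda>_. 0)" and w: "w = aval W x (\<lambda>_. 0)"
  have N': "aval N x (\<lambda>_. p) = n" and W': "aval W x (\<lambda>_. p) = w" for p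
    unfolding n w using aval_closed N W by metis+
  let ?P = "aval P x (\<lambda>_. 0)" and ?K = "length gs"
  have 1: "sat (map (\<lambda>(S, d). (True, map (tile_var ?K (Lit 0)) (filter (\<lambda>i. S (gs ! i)) [0..<?K]), d)) Ds) P x \<beta> \<longleftrightarrow>
      (\<forall>(S, d)\<in>set Ds. \<forall>p < ?P. aval d x (\<lambda>_. p) \<noteq> 0 \<longrightarrow> (\<exists>i < ?K. S (gs ! i) \<and> \<beta> (p * ?K + i)))"
    by (simp add: sat_def tile_var_def split_beta del: not_gr0)
  have 2: "sat (map (\<lambda>j. (False, [tile_var ?K (Lit 0) i, tile_var ?K (Lit 0) j], Lit (of_bool (i \<noteq> j)))) [0..<?K]) P x \<beta> \<longleftrightarrow>
      (\<forall>j < ?K. \<forall>p < ?P. \<beta> (p * ?K + i) \<and> \<beta> (p * ?K + j) \<longrightarrow> i = j)" for i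
    by (auto simp: sat_def tile_var_def)
  have 3: "sat (map (\<lambda>d.
       (False, [tile_var ?K (Lit 0) a, tile_var ?K (Lit 1) b, tile_var ?K (Lit 2) c, tile_var ?K (Add W (Lit 1)) d],
        Mul (Lit (of_bool (\<not> fits (gs ! a) (gs ! b) (gs ! c) (gs ! d)))) (aless (Var 0) N))) [0..<?K]) P x \<beta> \<longleftrightarrow>
      (\<forall>d < ?K. \<forall>p < ?P. p < n \<and> \<beta> (p * ?K + a) \<and> \<beta> ((p + 1) * ?K + b) \<and> \<beta> ((p + 2) * ?K + c) \<and>
       \<beta> ((p + w + 1) * ?K + d) \<longrightarrow> fits (gs ! a) (gs ! b) (gs ! c) (gs ! d))" for a b c
    by (auto simp: sat_def tile_var_def N' W' add.assoc)
  show ?thesis unfolding tiling_cnf_def Let_def sat_append sat_concat_map 1 2 3 n[symmetric] w[symmetric]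
    by (simp only: set_upt atLeast0LessThan lessThan_iff Ball_def)
qed

text \<open>The demand that always holds and is always active forces a tile at every position, and
  the second group makes it unique. The inequalities keep all windows inside the \<open>P\<close>
  positions.\<close>

lemma sat_tiling_cnf:
  assumes N: "avars N = {}" and W: "avars W = {}"
    and le: "aval N x (\<lambda>_. 0) + aval W x (\<lambda>_. 0) < aval P x (\<lambda>_. 0)" "aval N x (\<lambda>_. 0) + 1 < aval P x (\<lambda>_. 0)"
    and gs: "distinct gs" and Ds: "(\<lambda>_. True, Lit 1) \<in> set Ds"
  shows "(\<exists>\<beta>. sat (tiling_cnf gs Ds fits N W) P x \<beta>) \<longleftrightarrow>
    (\<exists>\<tau>. (\<forall>p < aval P x (\<lambda>_. 0). \<tau> p \<in> set gs \<and> (\<forall>(S, d)\<in>set Ds. aval d x (\<lambda>_. p) \<noteq> 0 \<longrightarrow> S (\<tau> p))) \<and>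
       (\<forall>p < aval N x (\<lambda>_. 0). fits (\<tau> p) (\<tau> (p + 1)) (\<tau> (p + 2)) (\<tau> (p + aval W x (\<lambda>_. 0) + 1))))"
    (is "?L \<longleftrightarrow> ?R")
proof -
  let ?P = "aval P x (\<lambda>_. 0)" and ?N = "aval N x (\<lambda>_. 0)" and ?W = "aval W x (\<lambda>_. 0)" and ?K = "length gs"
  have le': "?N \<le> ?P" using le by simp
  show ?thesis
  proof
    assume ?L
    then obtain \<beta> where \<beta>: "sat (tiling_cnf gs Ds fits N W) P x \<beta>" by blast
    note \<beta>' = \<beta>[unfolded sat_tiling_cnf_iff[OF N W]]
    have S: "\<exists>i < ?K. S (gs ! i) \<and> \<beta> (p * ?K + i)" if "(S, d) \<in> set Ds" "p < ?P" "aval d x (\<lambda>_. p) \<noteq> 0" for S d p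
      using conjunct1[OF \<beta>'] that by blast
    have uniq: "i = j" if "i < ?K" "j < ?K" "p < ?P" "\<beta> (p * ?K + i)" "\<beta> (p * ?K + j)" for i j p
      by (rule conjunct1[OF conjunct2[OF \<beta>'], rule_format, of i j p]) (intro that conjI)+
    have fit: "fits (gs ! a) (gs ! b) (gs ! c) (gs ! d)"
      if "a < ?K" "b < ?K" "c < ?K" "d < ?K" "p < ?N" "\<beta> (p * ?K + a)" "\<beta> ((p + 1) * ?K + b)"
        "\<beta> ((p + 2) * ?K + c)" "\<beta> ((p + ?W + 1) * ?K + d)" for a b c d p
      by (rule conjunct2[OF conjunct2[OF \<beta>'], rule_format, of a b c d p]) (use that le' in auto)
    have "\<exists>i. i < ?K \<and> \<beta> (p * ?K + i)" if "p < ?P" for p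
      using S[OF Ds that] by auto
    then obtain I where I: "\<And>p. p < ?P \<Longrightarrow> I p < ?K \<and> \<beta> (p * ?K + I p)" by metis
    show ?R
    proof (intro exI[of _ "\<lambda>p. gs ! I p"] conjI allI impI)
      fix p assume p: "p < ?P"
      show "gs ! I p \<in> set gs" using I[OF p] by simp
      show "\<forall>(S, d)\<in>set Ds. aval d x (\<lambda>_. p) \<noteq> 0 \<longrightarrow> S (gs ! I p)"
      proof safe
        fix S d assume "(S, d) \<in> set Ds" "0 < aval d x (\<lambda>_. p)"
        then obtain i where i: "i < ?K" "S (gs ! i)" "\<beta> (p * ?K + i)" using S[of S d p] p by auto
        then have "i = I p" using uniq[of i "I p" p] I[OF p] p by blast
        then show "S (gs ! I p)" using i by simp
      qed
    next
      fix p assume p: "p < ?N"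
      then show "fits (gs ! I p) (gs ! I (p + 1)) (gs ! I (p + 2)) (gs ! I (p + ?W + 1))"
        using le I[of p] I[of "p + 1"] I[of "p + 2"] I[of "p + ?W + 1"]
        by (intro fit[of _ _ _ _ p]) simp_all
    qed
  next
    assume ?R
    then obtain \<tau> where \<tau>0:
      "\<forall>p < ?P. \<tau> p \<in> set gs \<and> (\<forall>(S, d)\<in>set Ds. aval d x (\<lambda>_. p) \<noteq> 0 \<longrightarrow> S (\<tau> p))"
      "\<forall>p < ?N. fits (\<tau> p) (\<tau> (p + 1)) (\<tau> (p + 2)) (\<tau> (p + ?W + 1))" by (elim exE conjE)
    have \<tau>: "\<tau> p \<in> set gs" "(S, d) \<in> set Ds \<Longrightarrow> aval d x (\<lambda>_. p) \<noteq> 0 \<Longrightarrow> S (\<tau> p)" if "p < ?P" for p S d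
      using \<tau>0(1) that by auto
    have fit: "fits (\<tau> p) (\<tau> (p + 1)) (\<tau> (p + 2)) (\<tau> (p + ?W + 1))" if "p < ?N" for p
      using \<tau>0(2) that by blast
    define \<beta> where "\<beta> v \<longleftrightarrow> \<tau> (v div ?K) = gs ! (v mod ?K)" for v
    have \<beta>: "\<beta> (p * ?K + i) \<longleftrightarrow> \<tau> p = gs ! i" if "i < ?K" for p i
    proof -
      have "gs \<noteq> []" using that by auto
      then show ?thesis using that by (simp add: \<beta>_def)
    qed
    have "sat (tiling_cnf gs Ds fits N W) P x \<beta>"
      unfolding sat_tiling_cnf_iff[OF N W]
    proof (intro conjI)
      show "\<forall>(S, d)\<in>set Ds. \<forall>p<?P. aval d x (\<lambda>_. p) \<noteq> 0 \<longrightarrow> (\<exists>i<?K. S (gs ! i) \<and> \<beta> (p * ?K + i))"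
      proof safe
        fix S d p assume h: "(S, d) \<in> set Ds" "p < ?P" "0 < aval d x (\<lambda>_. p)"
        obtain i where i: "i < ?K" "\<tau> p = gs ! i" using \<tau>(1)[OF h(2)] by (auto simp: in_set_conv_nth)
        then show "\<exists>i<?K. S (gs ! i) \<and> \<beta> (p * ?K + i)" using \<tau>(2)[OF h(2,1)] h(3) \<beta> by auto
      qed
      show "\<forall>i<?K. \<forall>j<?K. \<forall>p<?P. \<beta> (p * ?K + i) \<and> \<beta> (p * ?K + j) \<longrightarrow> i = j"
        by (intro allI impI, elim conjE, subst (asm) \<beta>, assumption, subst (asm) \<beta>, assumption)
          (simp add: nth_eq_iff_index_eq[OF gs])
      show "\<forall>a<?K. \<forall>b<?K. \<forall>c<?K. \<forall>d<?K. \<forall>p<?P. p < ?N \<and> \<beta> (p * ?K + a) \<and> \<beta> ((p + 1) * ?K + b) \<and> \<beta> ((p + 2) * ?K + c) \<and>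
          \<beta> ((p + ?W + 1) * ?K + d) \<longrightarrow> fits (gs ! a) (gs ! b) (gs ! c) (gs ! d)"
      proof (intro allI impI, elim conjE)
        fix a b c d p
        assume h: "a < ?K" "b < ?K" "c < ?K" "d < ?K" "p < ?N" "\<beta> (p * ?K + a)" "\<beta> ((p + 1) * ?K + b)"
          "\<beta> ((p + 2) * ?K + c)" "\<beta> ((p + ?W + 1) * ?K + d)"
        have "\<tau> p = gs ! a" "\<tau> (p + 1) = gs ! b" "\<tau> (p + 2) = gs ! c" "\<tau> (p + ?W + 1) = gs ! d"
          using h(6-9) unfolding \<beta>[OF h(1)] \<beta>[OF h(2)] \<beta>[OF h(3)] \<beta>[OF h(4)] by simp_all
        then show "fits (gs ! a) (gs ! b) (gs ! c) (gs ! d)" using fit[OF h(5)] by simp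
      qed
    qed
    then show ?L by blast
  qed
qed

section \<open>Clauses for the tableau of a verifier\<close>

context tableau
begin

text \<open>\<open>initial\<close> and acceptance are split into properties of tiles and arithmetic
  conditions on the position. The properties must refer neither to the position nor to the input, so
  the symbol on tape 0 takes one demand for each of its three values. In the conditions
  \<open>Mul\<close> acts as conjunction and \<open>Add\<close> as disjunction; as \<open>z\<close>
  is truncated, the demands for input bits also ask for \<open>tt < p\<close>.\<close>

definition demands :: "aexp \<Rightarrow> aexp \<Rightarrow> ((tile \<Rightarrow> bool) \<times> aexp) list" where
  "demands tt l = (let p = Var 0; w = Add (Mul (Lit 2) tt) (Lit 2); row = Mul (aless (Lit 0) p) (aless p w);
       u = Add tt (Lit 1); z = Sub p u;
       C = (\<lambda>R. case_tile False (\<lambda>i q s sy hs. R i q sy hs)) in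
     [(\<lambda>_. True, Lit 1),
      (\<lambda>a. a = Border, Add (aeq p (Lit 0)) (aeq p w)),
      (C (\<lambda>i q sy hs. i \<and> q = 0 \<and> (\<forall>j<k. 2 \<le> j \<longrightarrow> sy ! j = 0) \<and> sy ! 1 \<le> 2), row),
      (C (\<lambda>i q sy hs. \<forall>j<k. hs ! j), Mul row (aeq p u)),
      (C (\<lambda>i q sy hs. \<forall>j<k. \<not> hs ! j), Mul row (Sub (Lit 1) (aeq p u))),
      (C (\<lambda>i q sy hs. sy ! 0 = 0), Mul row (Add (aless p u) (Sub (Lit 1) (aless z Len)))),
      (C (\<lambda>i q sy hs. sy ! 0 = 1), Mul row (Mul (aless tt p) (Mul (aless z Len) (Sub (Lit 1) (Bit z))))),
      (C (\<lambda>i q sy hs. sy ! 0 = 2), Mul row (Mul (aless tt p) (Bit z))),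
      (C (\<lambda>i q sy hs. sy ! 1 = 0), Mul row (Add (aless p u) (Sub (Lit 1) (aless p (Add u l))))),
      (accepting, aeq p (Add (Mul tt w) u))])"

lemma avars_demands: "(S, d) \<in> set (demands tt l) \<Longrightarrow> avars d \<subseteq> {0} \<union> avars tt \<union> avars l"
  by (auto simp: demands_def Let_def)

lemma demands_iff:
  assumes tt: "aval tt x (\<lambda>_. p) = t" and l: "aval l x (\<lambda>_. p) = n"
  shows "(\<forall>(S, d)\<in>set (demands tt l). aval d x (\<lambda>_. p) \<noteq> 0 \<longrightarrow> S a) \<longleftrightarrow>
    initial x n t p a \<and> (p = t * width t + t + 1 \<longrightarrow> accepting a)"
proof -
  let ?row = "0 < p \<and> p < width t"
  let ?C = "\<lambda>R. case a of Border \<Rightarrow> False | Cell i q s sy hs \<Rightarrow> R i q sy hs"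
  let ?tape = "\<lambda>sy. (p < t + 1 \<or> t + 1 + length x \<le> p \<longrightarrow> sy ! 0 = (0 :: nat)) \<and>
      (t < p \<and> p - (t + 1) < length x \<and> \<not> x ! (p - (t + 1)) \<longrightarrow> sy ! 0 = 1) \<and>
      (t < p \<and> p - (t + 1) < length x \<and> x ! (p - (t + 1)) \<longrightarrow> sy ! 0 = 2)"
  have tape: "?tape sy \<longleftrightarrow> sy ! 0 = tape_of x (coord t p)" for sy
  proof (cases "t < p \<and> p - (t + 1) < length x")
    case True
    then have "nat (int p - 1 - int t) = p - (t + 1)" by linarith
    then show ?thesis using True by (auto simp: tape_of_def bit_symbol_def)
  next
    case False
    then show ?thesis by (auto simp: tape_of_def)
  qed
  let ?w = "Add (Mul (Lit 2) tt) (Lit 2)" and ?u = "Add tt (Lit 1)"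
  let ?r = "Mul (aless (Lit 0) (Var 0)) (aless (Var 0) ?w)" and ?z = "Sub (Var 0) ?u"
  have row: "aval ?r x (\<lambda>_. p) = of_bool ?row" by (simp add: tt width_def)
  have dems:
    "aval (Lit 1) x (\<lambda>_. p) \<noteq> 0"
    "aval (Add (aeq (Var 0) (Lit 0)) (aeq (Var 0) ?w)) x (\<lambda>_. p) \<noteq> 0 \<longleftrightarrow> p = 0 \<or> p = width t"
    "aval ?r x (\<lambda>_. p) \<noteq> 0 \<longleftrightarrow> ?row"
    "aval (Mul ?r (aeq (Var 0) ?u)) x (\<lambda>_. p) \<noteq> 0 \<longleftrightarrow> ?row \<and> p = t + 1"
    "aval (Mul ?r (Sub (Lit 1) (aeq (Var 0) ?u))) x (\<lambda>_. p) \<noteq> 0 \<longleftrightarrow> ?row \<and> p \<noteq> t + 1"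
    "aval (Mul ?r (Add (aless (Var 0) ?u) (Sub (Lit 1) (aless ?z Len)))) x (\<lambda>_. p) \<noteq> 0 \<longleftrightarrow>
       ?row \<and> (p < t + 1 \<or> t + 1 + length x \<le> p)"
    "aval (Mul ?r (Mul (aless tt (Var 0)) (Mul (aless ?z Len) (Sub (Lit 1) (Bit ?z))))) x (\<lambda>_. p) \<noteq> 0 \<longleftrightarrow>
       ?row \<and> t < p \<and> p - (t + 1) < length x \<and> \<not> x ! (p - (t + 1))"
    "aval (Mul ?r (Mul (aless tt (Var 0)) (Bit ?z))) x (\<lambda>_. p) \<noteq> 0 \<longleftrightarrow>
       ?row \<and> t < p \<and> p - (t + 1) < length x \<and> x ! (p - (t + 1))"
    "aval (Mul ?r (Add (aless (Var 0) ?u) (Sub (Lit 1) (aless (Var 0) (Add ?u l))))) x (\<lambda>_. p) \<noteq> 0 \<longleftrightarrow>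
       ?row \<and> (p < t + 1 \<or> t + 1 + n \<le> p)"
    "aval (aeq (Var 0) (Add (Mul tt ?w) ?u)) x (\<lambda>_. p) \<noteq> 0 \<longleftrightarrow> p = t * width t + t + 1"
    using row by (auto simp: tt l width_def algebra_simps simp del: mult_Suc_right)
  have "(\<forall>(S, d)\<in>set (demands tt l). aval d x (\<lambda>_. p) \<noteq> 0 \<longrightarrow> S a) \<longleftrightarrow>
      (p = 0 \<or> p = width t \<longrightarrow> a = Border) \<and>
      (?row \<longrightarrow> ?C (\<lambda>i q sy hs. i \<and> q = 0 \<and> (\<forall>j<k. 2 \<le> j \<longrightarrow> sy ! j = 0) \<and> sy ! 1 \<le> 2)) \<and>
      (?row \<and> p = t + 1 \<longrightarrow> ?C (\<lambda>i q sy hs. \<forall>j<k. hs ! j)) \<and>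
      (?row \<and> p \<noteq> t + 1 \<longrightarrow> ?C (\<lambda>i q sy hs. \<forall>j<k. \<not> hs ! j)) \<and>
      (?row \<and> (p < t + 1 \<or> t + 1 + length x \<le> p) \<longrightarrow> ?C (\<lambda>i q sy hs. sy ! 0 = 0)) \<and>
      (?row \<and> t < p \<and> p - (t + 1) < length x \<and> \<not> x ! (p - (t + 1)) \<longrightarrow> ?C (\<lambda>i q sy hs. sy ! 0 = 1)) \<and>
      (?row \<and> t < p \<and> p - (t + 1) < length x \<and> x ! (p - (t + 1)) \<longrightarrow> ?C (\<lambda>i q sy hs. sy ! 0 = 2)) \<and>
      (?row \<and> (p < t + 1 \<or> t + 1 + n \<le> p) \<longrightarrow> ?C (\<lambda>i q sy hs. sy ! 1 = 0)) \<and>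
      (p = t * width t + t + 1 \<longrightarrow> accepting a)"
    unfolding demands_def Let_def
    by (simp only: list.set ball_simps prod.case dems simp_thms)
  also have "\<dots> \<longleftrightarrow> initial x n t p a \<and> (p = t * width t + t + 1 \<longrightarrow> accepting a)"
  proof (cases a)
    case Border
    then show ?thesis by (auto simp: initial_def)
  next
    case (Cell i q s sy hs)
    show ?thesis unfolding initial_def Cell tile.case tape[symmetric]
      by (cases ?row; cases "p = t + 1") (simp_all, (blast+)?)
  qed
  finally show ?thesis .
qed

lemma ex_cnf:
  assumes tt: "avars tt = {}" and l: "avars l = {}"
  shows "\<exists>F P m. cnf_bounded F P m \<and> (\<forall>x. (\<exists>\<beta>. sat F P x \<beta>) \<longleftrightarrow>
    (\<exists>\<tau>. tiling x (aval l x (\<lambda>_. 0)) (aval tt x (\<lambda>_. 0)) \<tau>))"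
proof -
  obtain gs where gs: "set gs = tiles" "distinct gs" using finite_distinct_list[OF finite_tiles] by blast
  define W where "W = Add (Mul (Lit 2) tt) (Lit 2)"
  define P where "P = Mul (Add tt (Lit 3)) W"
  define N where "N = Mul (Add tt (Lit 1)) W"
  \<comment> \<open>A clause at \<open>p < P\<close> speaks of positions up to
    \<open>p + W + 1\<close>, with \<open>length gs\<close> variables each.\<close>
  define m where "m = Mul (Add P (Add W (Lit 2))) (Lit (length gs))"
  define F where "F = tiling_cnf gs (demands tt l) fits N W"
  have closed: "avars W = {}" "avars P = {}" "avars N = {}" "avars m = {}"
    using tt by (simp_all add: W_def P_def N_def m_def)
  define tv lv where tv: "tv x = aval tt x (\<lambda>_. 0)" and lv: "lv x = aval l x (\<lambda>_. 0)" for x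
  have val: "aval W x env = width (tv x)" "aval tt x env = tv x" "aval l x env = lv x" for x env
    using aval_closed[OF tt, of x env "\<lambda>_. 0"] aval_closed[OF l, of x env "\<lambda>_. 0"]
    by (simp_all add: W_def width_def tv lv)
  have valP: "aval P x env = (tv x + 3) * width (tv x)"
      "aval N x env = (tv x + 1) * width (tv x)"
      "aval m x env = (aval P x (\<lambda>_. 0) + width (tv x) + 2) * length gs" for x env
    by (simp_all add: P_def N_def m_def val)
  have "gs \<noteq> []" using gs by (auto simp: tiles_def)
  then have K: "0 < length gs" by simp
  have "(\<exists>\<beta>. sat F P x \<beta>) \<longleftrightarrow> (\<exists>\<tau>. tiling x (lv x) (tv x) \<tau>)" for x
  proof -
    let ?t = "tv x"
    have acc: "?t * width ?t + ?t + 1 < (?t + 3) * width ?t"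
      by (simp add: width_def algebra_simps)
    have "(\<exists>\<beta>. sat F P x \<beta>) \<longleftrightarrow> (\<exists>\<tau>. (\<forall>p < (?t + 3) * width ?t. \<tau> p \<in> tiles \<and>
        initial x (lv x) ?t p (\<tau> p) \<and> (p = ?t * width ?t + ?t + 1 \<longrightarrow> accepting (\<tau> p))) \<and>
       (\<forall>p < (?t + 1) * width ?t. fits (\<tau> p) (\<tau> (p + 1)) (\<tau> (p + 2)) (\<tau> (p + width ?t + 1))))"
    proof -
      have dem: "(\<forall>(S, d)\<in>set (demands tt l). aval d x (\<lambda>_. p) \<noteq> 0 \<longrightarrow> S a) \<longleftrightarrow>
          initial x (lv x) ?t p a \<and> (p = ?t * width ?t + ?t + 1 \<longrightarrow> accepting a)" for p a
        by (rule demands_iff) (simp_all add: val)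
      have "(\<lambda>_. True, Lit 1) \<in> set (demands tt l)" by (simp add: demands_def Let_def)
      moreover have "aval N x (\<lambda>_. 0) + aval W x (\<lambda>_. 0) < aval P x (\<lambda>_. 0)" "aval N x (\<lambda>_. 0) + 1 < aval P x (\<lambda>_. 0)"
        by (simp_all add: valP val width_def algebra_simps)
      ultimately show ?thesis
        using sat_tiling_cnf[OF closed(3,1) _ _ gs(2), of x P "demands tt l" fits] unfolding F_def dem gs(1) valP val
        by blast
    qed
    also have "\<dots> \<longleftrightarrow> (\<exists>\<tau>. tiling x (lv x) ?t \<tau>)"
      unfolding tiling_def using acc by blast
    finally show ?thesis .
  qed
  moreover have "cnf_bounded F P m"
  proof -
    have ne: "F \<noteq> []" by (simp add: F_def tiling_cnf_def demands_def Let_def)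
    define good where "good ls d \<longleftrightarrow> avars d \<subseteq> {0} \<and> (\<forall>a\<in>set ls. avars a \<subseteq> {0}) \<and> (\<forall>x. length ls \<le> aval m x (\<lambda>_. 0) \<and>
        (\<forall>a\<in>set ls. \<forall>p < aval P x (\<lambda>_. 0). aval a x (\<lambda>_. p) < aval m x (\<lambda>_. 0)))" for ls d
    let ?K = "length gs"
    have var: "aval (tile_var ?K e i) x (\<lambda>_. p) < aval m x (\<lambda>_. 0)"
      if "i < ?K" "p < aval P x (\<lambda>_. 0)" "aval e x (\<lambda>_. p) \<le> width (tv x) + 1" for e i p x
    proof -
      have "(p + aval e x (\<lambda>_. p)) * ?K + i < (p + aval e x (\<lambda>_. p) + 1) * ?K" using that by simp
      also have "\<dots> \<le> (aval P x (\<lambda>_. 0) + width (tv x) + 2) * ?K"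
        using that by (intro mult_right_mono) auto
      finally show ?thesis by (simp add: tile_var_def valP)
    qed
    have w2: "2 \<le> width t" for t by (simp add: width_def)
    \<comment> \<open>Window clauses have four literals, demands at most one for each tile.\<close>
    have m4: "4 \<le> aval m x (\<lambda>_. 0)" "?K \<le> aval m x (\<lambda>_. 0)" for x
    proof -
      have "4 * 1 \<le> (aval P x (\<lambda>_. 0) + width (tv x) + 2) * ?K"
        using K w2[of "tv x"] by (intro mult_mono) (auto simp: Suc_le_eq)
      then show "4 \<le> aval m x (\<lambda>_. 0)" by (simp add: valP)
      have "1 * ?K \<le> (aval P x (\<lambda>_. 0) + width (tv x) + 2) * ?K" by (intro mult_mono) auto
      then show "?K \<le> aval m x (\<lambda>_. 0)" by (simp add: valP)
    qed
    have vars: "avars (tile_var ?K e i) = {0} \<union> avars e" for e i by (simp add: tile_var_def)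
    have "good (map (tile_var ?K (Lit 0)) (filter (\<lambda>i. S (gs ! i)) [0..<?K])) d" if "(S, d) \<in> set (demands tt l)" for S d
    proof -
      have "length (filter (\<lambda>i. S (gs ! i)) [0..<?K]) \<le> aval m x (\<lambda>_. 0)" for x
        using length_filter_le[of _ "[0..<?K]"] m4(2)[of x] by (metis diff_zero le_trans length_upt)
      then show ?thesis using avars_demands[OF that] tt l var by (auto simp: good_def vars)
    qed
    moreover have "good [tile_var ?K (Lit 0) i, tile_var ?K (Lit 0) j] (Lit c)" if "i < ?K" "j < ?K" for i j c
    proof -
      have "Suc (Suc 0) \<le> aval m x (\<lambda>_. 0)" for x using m4(1)[of x] by linarith
      then show ?thesis using that var unfolding good_def by (simp add: vars)
    qed
    moreover have "good [tile_var ?K (Lit 0) a, tile_var ?K (Lit 1) b, tile_var ?K (Lit 2) c, tile_var ?K (Add W (Lit 1)) e]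
        (Mul (Lit z) (aless (Var 0) N))" if "a < ?K" "b < ?K" "c < ?K" "e < ?K" for a b c e z
    proof -
      have "2 \<le> Suc (width t)" for t using w2[of t] by linarith
      moreover have "Suc (Suc (Suc (Suc 0))) \<le> aval m x (\<lambda>_. 0)" for x using m4(1)[of x] by linarith
      ultimately show ?thesis using that var m4(1) closed unfolding good_def by (simp add: vars val)
    qed
    ultimately have all: "\<forall>(s, ls, d)\<in>set F. good ls d"
      unfolding F_def tiling_cnf_def Let_def set_append ball_Un by (intro conjI) auto
    have "0 < aval P x (\<lambda>_. 0)" "0 < aval m x (\<lambda>_. 0)" for x
      using K by (simp_all add: valP width_def)
    moreover have "\<forall>(s, ls, d)\<in>set F. avars d \<subseteq> {0} \<and> (\<forall>l\<in>set ls. avars l \<subseteq> {0})"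
      using all unfolding good_def by (simp add: case_prod_beta)
    moreover have "\<forall>(s, ls, d)\<in>set F. length ls \<le> aval m x (\<lambda>_. 0) \<and>
        (\<forall>l\<in>set ls. \<forall>p < aval P x (\<lambda>_. 0). aval l x (\<lambda>_. p) < aval m x (\<lambda>_. 0))" for x
      using all unfolding good_def by (simp add: case_prod_beta)
    ultimately show ?thesis unfolding cnf_bounded_def using ne closed by simp
  qed
  ultimately show ?thesis unfolding tv lv by blast
qed

end

theorem cook_levin:
  assumes "in_NP A"
  shows "\<exists>F P m. cnf_bounded F P m \<and> (\<forall>x. x \<in> A \<longleftrightarrow> (\<exists>\<beta>. sat F P x \<beta>))"
proof -
  obtain R and q :: "nat poly" where R: "poly_time 2 (\<lambda>ws. [R (ws ! 0) (ws ! 1)])"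
    and A: "\<And>x. x \<in> A \<longleftrightarrow> (\<exists>w. length w \<le> poly q (length x) \<and> R x w)"
    using assms unfolding in_NP_def by blast
  obtain M and p :: "nat poly" where M: "tm_wf M" "2 \<le> tm_tapes M"
    and out: "\<And>ws. length ws = 2 \<Longrightarrow> tm_outputs M ws (poly p (sum_list (map length ws))) [R (ws ! 0) (ws ! 1)]"
    using R unfolding poly_time_def by blast
  interpret tableau M "tm_tapes M" using M by unfold_locales auto
  obtain l where l: "avars l = {}" "\<And>x env. aval l x env = poly q (length x)"
    using ex_poly_aexp[of Len q] by auto
  obtain t where t: "avars t = {}" "\<And>x env. aval t x env = poly p (length x + poly q (length x))"
    using ex_poly_aexp[of "Add Len l" p] l by auto
  \<comment> \<open>\<open>t\<close> bounds the running time on all admissible witnesses; adding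
    \<open>l\<close> makes the rows long enough to hold the witness.\<close>
  define tt where "tt = Add t l"
  obtain F P m where F: "cnf_bounded F P m" and
    sat: "\<And>x. (\<exists>\<beta>. sat F P x \<beta>) \<longleftrightarrow> (\<exists>\<tau>. tiling x (aval l x (\<lambda>_. 0)) (aval tt x (\<lambda>_. 0)) \<tau>)"
    using ex_cnf[of tt l] l(1) t(1) by (auto simp: tt_def)
  have "x \<in> A \<longleftrightarrow> (\<exists>\<beta>. sat F P x \<beta>)" for x
  proof -
    have "tm_outputs M [x, w] (aval tt x (\<lambda>_. 0)) [R x w]" if w: "length w \<le> aval l x (\<lambda>_. 0)" for w
    proof (rule tm_outputs_mono)
      show "tm_outputs M [x, w] (poly p (length x + length w)) [R x w]" using out[of "[x, w]"] by simp
      show "poly p (length x + length w) \<le> aval tt x (\<lambda>_. 0)"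
        using poly_mono_nat[of "length x + length w" "length x + poly q (length x)" p] w
        by (simp add: tt_def t l)
    qed
    from tiling_iff[of "aval l x (\<lambda>_. 0)" "aval tt x (\<lambda>_. 0)" x "R x", OF _ this] show ?thesis
      unfolding A sat by (simp add: tt_def l)
  qed
  with F show ?thesis by blast
qed

section \<open>Generating instances\<close>

definition gcat :: "gen list \<Rightarrow> gen" where
  "gcat gs = foldr Cat gs (Emit [])"

lemma gsem_gcat [simp]: "gsem (gcat gs) x env = concat (map (\<lambda>g. gsem g x env) gs)"
  by (induction gs) (auto simp: gcat_def)

lemma gen_wf_gcat [simp]: "gen_wf (gcat gs) \<longleftrightarrow> (\<forall>g\<in>set gs. gen_wf g)"
  by (induction gs) (auto simp: gcat_def)

lemma loopvars_gcat [simp]: "loopvars (gcat gs) = (\<Union>g\<in>set gs. loopvars g)"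
  by (induction gs) (auto simp: gcat_def)

lemma enc_rat_of_int: "enc_rat (of_int z) = (z < 0) # enc_nat (nat \<bar>z\<bar>) @ enc_nat 1"
  by (simp add: enc_rat_def quotient_of_int)

lemma rat_magnitude_of_int: "rat_magnitude (of_int z) = max (nat \<bar>z\<bar>) 1"
  by (simp add: rat_magnitude_def quotient_of_int)

definition gnum :: "aexp \<Rightarrow> gen" where
  "gnum a = gcat [Emit [False], Num a, Emit (enc_nat 1)]"

text \<open>The sign bit of \<open>enc_rat\<close> is set for negative numbers only, hence the
  separate code for 0.\<close>

definition gneg :: "aexp \<Rightarrow> gen" where
  "gneg a = Branch a (gcat [Emit [True], Num a, Emit (enc_nat 1)]) (Emit (enc_rat 0))"

lemma gsem_gnum [simp]: "gsem (gnum a) x env = enc_rat (of_nat (aval a x env))"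
  using enc_rat_of_int[of "int (aval a x env)"] by (simp add: gnum_def)

lemma gsem_gneg [simp]: "gsem (gneg a) x env = enc_rat (- of_nat (aval a x env))"
  using enc_rat_of_int[of "- int (aval a x env)"] enc_rat_of_int[of 0] by (simp add: gneg_def)

lemma gen_gnum [simp]: "gen_wf (gnum a)" "loopvars (gnum a) = {}" "gen_wf (gneg a)" "loopvars (gneg a) = {}"
  by (auto simp: gnum_def gneg_def)

definition gconst :: "int \<Rightarrow> gen" where
  "gconst z = Emit (enc_rat (of_int z))"

lemma gen_gconst [simp]: "gsem (gconst z) x env = enc_rat (of_int z)" "gen_wf (gconst z)" "loopvars (gconst z) = {}"
  by (auto simp: gconst_def)

text \<open>The layout of \<open>enc_instance_inst\<close>. The literal 1 is the number of samples;
  the loops produce the zero matrices of W and the zero sample.\<close>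

definition ginst :: "aexp \<Rightarrow> aexp \<Rightarrow> aexp \<Rightarrow> gen \<Rightarrow> gen \<Rightarrow> gen \<Rightarrow> gen \<Rightarrow> gen \<Rightarrow> gen \<Rightarrow> gen \<Rightarrow> gen" where
  "ginst m n l gq gQ gw gt gh grad gthr = gcat [Num m, Num n, Num l, Emit (enc_nat 1), gq, gQ, gw,
     For 3 m (For 2 l (For 1 n (gconst 0))), gt, gh, For 1 m (gconst 0), grad, gthr]"

lemma gen_wf_ginst:
  "gen_wf (ginst m n l gq gQ gw gt gh grad gthr) \<longleftrightarrow>
     gen_wf gq \<and> gen_wf gQ \<and> gen_wf gw \<and> gen_wf gt \<and> gen_wf gh \<and> gen_wf grad \<and> gen_wf gthr"
  by (auto simp: ginst_def)

lemma gsem_ginst: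
  assumes "avars m = {}" "avars n = {}" "avars l = {}"
    and "M = aval m x (\<lambda>_. 0)" "N = aval n x (\<lambda>_. 0)" "L = aval l x (\<lambda>_. 0)"
    and "gsem gq x (\<lambda>_. 0) = concat (map (\<lambda>i. enc_rat (qf i)) [0..<N])"
    and "gsem gQ x (\<lambda>_. 0) = concat (map (\<lambda>i. concat (map (\<lambda>j. enc_rat (Qf i j)) [0..<M])) [0..<N])"
    and "gsem gw x (\<lambda>_. 0) = concat (map (\<lambda>r. concat (map (\<lambda>i. enc_rat (wt r i)) [0..<N])) [0..<L])"
    and "gsem gt x (\<lambda>_. 0) = concat (map (\<lambda>r. concat (map (\<lambda>j. enc_rat (tf r j)) [0..<M])) [0..<L])"
    and "gsem gh x (\<lambda>_. 0) = concat (map (\<lambda>r. enc_rat (hf r)) [0..<L])"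
    and "gsem grad x (\<lambda>_. 0) = enc_rat rad" "gsem gthr x (\<lambda>_. 0) = enc_rat thr"
  shows "gsem (ginst m n l gq gQ gw gt gh grad gthr) x (\<lambda>_. 0) = enc_instance (inst M N L qf Qf wt tf hf rad thr)"
proof -
  have "aval m x env = M" "aval n x env = N" "aval l x env = L" for env
    using assms(1-6) aval_closed by metis+
  then show ?thesis
    by (simp add: ginst_def enc_instance_inst assms(7-13) del: upt_Suc)
qed

lemma concat_map_upt_mult:
  "concat (map f [0..<n * k]) = concat (map (\<lambda>p. concat (map (\<lambda>s. f (p * k + s)) [0..<k])) [0..<n])"
proof (induction n)
  case (Suc n)
  have "[0..<Suc n * k] = [0..<n * k] @ map (\<lambda>s. n * k + s) [0..<k]"
    using upt_add_eq_append[of 0 "n * k" k] map_add_upt[of "n * k" k] by (simp add: add.commute)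
  then have "concat (map f [0..<Suc n * k]) =
      concat (map f [0..<n * k]) @ concat (map (\<lambda>s. f (n * k + s)) [0..<k])"
    by (simp only: map_append concat_append map_map o_def)
  then show ?case by (simp add: Suc.IH)
qed simp

text \<open>A loop over \<open>p\<close> whose body runs through a fixed list produces rows numbered
  \<open>p * length xs + s\<close>; quotient and remainder recover \<open>p\<close> and the entry.
  This is how the instances number clauses and rows.\<close>

lemma concat_map_rows:
  "concat (map (\<lambda>i. g (i div length xs) (xs ! (i mod length xs))) [0..<n * length xs]) =
     concat (map (\<lambda>p. concat (map (g p) xs)) [0..<n])"
proof -
  have "map (\<lambda>s. g ((p * length xs + s) div length xs) (xs ! ((p * length xs + s) mod length xs))) [0..<length xs] = map (g p) xs" for p
  proof (rule nth_equalityI)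
    fix i assume "i < length (map (\<lambda>s. g ((p * length xs + s) div length xs) (xs ! ((p * length xs + s) mod length xs))) [0..<length xs])"
    then have "i < length xs" "xs \<noteq> []" by auto
    then show "map (\<lambda>s. g ((p * length xs + s) div length xs) (xs ! ((p * length xs + s) mod length xs))) [0..<length xs] ! i = map (g p) xs ! i"
      by simp
  qed simp
  then show ?thesis by (simp add: concat_map_upt_mult)
qed

section \<open>Counting the true literals of a clause\<close>

definition acount :: "aexp list \<Rightarrow> aexp" where
  "acount ls = foldr (\<lambda>l. Add (aeq l (Var 1))) ls (Lit 0)"

text \<open>A multiplicity rather than a truth value, since different entries of \<open>ls\<close>
  may evaluate to the same variable; the sum in \<open>sum_count\<close> then counts
  entries.\<close>

definition lit_count :: "bool list \<Rightarrow> aexp list \<Rightarrow> nat \<Rightarrow> nat \<Rightarrow> nat" where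
  "lit_count x ls p j = sum_list (map (\<lambda>l. of_bool (aval l x (\<lambda>_. p) = j)) ls)"

lemma aval_row: "avars a \<subseteq> {0} \<Longrightarrow> env 0 = p \<Longrightarrow> aval a x env = aval a x (\<lambda>_. p)"
  by (rule aval_cong) auto

lemma aval_acount:
  "\<forall>l\<in>set ls. avars l \<subseteq> {0} \<Longrightarrow> aval (acount ls) x env = lit_count x ls (env 0) (env 1)"
  by (induction ls) (auto simp: acount_def lit_count_def aval_row[of _ env "env 0"])

lemma lit_count_le: "lit_count x ls p j \<le> length ls"
  unfolding lit_count_def by (induction ls) auto

lemma sum_count:
  "\<forall>l\<in>set ls. aval l x (\<lambda>_. p) < n \<Longrightarrow>
     (\<Sum>j<n. lit_count x ls p j * of_bool (\<beta> j)) = length (filter (\<lambda>l. \<beta> (aval l x (\<lambda>_. p))) ls)"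
proof (induction ls)
  case (Cons l ls)
  have "(\<Sum>j<n. of_bool (aval l x (\<lambda>_. p) = j) * of_bool (\<beta> j)) = (\<Sum>j<n. if j = aval l x (\<lambda>_. p) then of_bool (\<beta> j) else 0 :: nat)"
    by (intro sum.cong) auto
  then have "(\<Sum>j<n. of_bool (aval l x (\<lambda>_. p) = j) * of_bool (\<beta> j)) = (of_bool (\<beta> (aval l x (\<lambda>_. p))) :: nat)"
    using Cons.prems by simp
  moreover have "lit_count x (l # ls) p j = of_bool (aval l x (\<lambda>_. p) = j) + lit_count x ls p j" for j
    by (simp add: lit_count_def)
  ultimately show ?case
    using Cons by (simp add: distrib_right sum.distrib del: sum_mult_of_bool_eq sum_of_bool_mult_eq)
qed (simp add: lit_count_def)

lemma length_filter_less_iff: "length (filter P xs) < length xs \<longleftrightarrow> (\<exists>a\<in>set xs. \<not> P a)"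
  by (metis filter_True length_filter_le length_filter_less not_less_iff_gr_or_eq not_less)

lemma length_filter_pos_iff: "0 < length (filter P xs) \<longleftrightarrow> (\<exists>a\<in>set xs. P a)"
  by (induction xs) auto

text \<open>Combines \<open>cook_levin\<close> with \<open>poly_time_gen\<close>. For each problem
  it remains to generate, uniformly in \<open>x\<close>, an instance that is a yes-instance iff the
  schemes are satisfiable.\<close>

lemma NP_hardI:
  assumes "\<And>F P m A. cnf_bounded F P m \<Longrightarrow>
     \<exists>g. gen_wf g \<and> (\<forall>x. \<exists>a\<in>I. gsem g x (\<lambda>_. 0) = enc a \<and> (yes a \<longleftrightarrow> (\<exists>\<beta>. sat F P x \<beta>)))"
  shows "NP_hard I yes enc"
  unfolding NP_hard_def
proof (intro allI impI)
  fix A assume "in_NP A"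
  then obtain F P m where F: "cnf_bounded F P m" and A: "\<And>x. x \<in> A \<longleftrightarrow> (\<exists>\<beta>. sat F P x \<beta>)"
    using cook_levin by blast
  obtain g where g: "gen_wf g" "\<And>x. \<exists>a\<in>I. gsem g x (\<lambda>_. 0) = enc a \<and> (yes a \<longleftrightarrow> (\<exists>\<beta>. sat F P x \<beta>))"
    using assms[OF F] by blast
  show "\<exists>f. poly_time 1 (\<lambda>ws. f (ws ! 0)) \<and> (\<forall>x. \<exists>a\<in>I. f x = enc a \<and> (x \<in> A \<longleftrightarrow> yes a))"
  proof (intro exI conjI allI)
    show "poly_time 1 (\<lambda>ws. gsem g (ws ! 0) (\<lambda>_. 0))" by (rule poly_time_gen[OF g(1)])
    show "\<exists>a\<in>I. gsem g x (\<lambda>_. 0) = enc a \<and> (x \<in> A \<longleftrightarrow> yes a)" for x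
      unfolding A using g(2)[of x] by metis
  qed
qed

lemma length_concat_ge: "(\<And>a. a \<in> set xs \<Longrightarrow> f a \<noteq> []) \<Longrightarrow> length xs \<le> length (concat (map f xs))"
proof (induction xs)
  case (Cons a xs)
  then have "0 < length (f a)" "length xs \<le> length (concat (map f xs))" by auto
  then show ?case by (simp del: length_greater_0_conv)
qed simp

lemma enc_rat_Nil: "enc_rat r \<noteq> []"
  by (auto simp: enc_rat_def split: prod.splits)

text \<open>Every number takes at least one bit. This turns bounds on entries in terms of the
  dimensions into bounds in terms of the encoding length, as strong hardness requires.\<close>

lemma length_enc_inst: "m + n \<le> length (enc_instance (inst m n l qf Qf wt tf hf rad thr))"
proof -
  have "n \<le> length (concat (map (\<lambda>i. enc_rat (qf i)) [0..<n]))"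
    using length_concat_ge[of "[0..<n]" "\<lambda>i. enc_rat (qf i)"] enc_rat_Nil by simp
  moreover have "m \<le> length (concat (map (\<lambda>i. enc_rat 0) [0..<m]))"
    using length_concat_ge[of "[0..<m]" "\<lambda>i. enc_rat 0"] enc_rat_Nil by simp
  ultimately show ?thesis unfolding enc_instance_inst by simp
qed

lemma max_number_inst_le:
  assumes "\<And>i. i < n \<Longrightarrow> rat_magnitude (qf i) \<le> b" "\<And>i j. i < n \<Longrightarrow> j < m \<Longrightarrow> rat_magnitude (Qf i j) \<le> b"
    and "\<And>r i. r < l \<Longrightarrow> i < n \<Longrightarrow> rat_magnitude (wt r i) \<le> b"
    and "\<And>r j. r < l \<Longrightarrow> j < m \<Longrightarrow> rat_magnitude (tf r j) \<le> b" "\<And>r. r < l \<Longrightarrow> rat_magnitude (hf r) \<le> b"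
    and "rat_magnitude 0 \<le> b" "rat_magnitude rad \<le> b" "rat_magnitude thr \<le> b"
  shows "max_number (inst m n l qf Qf wt tf hf rad thr) \<le> b"
  unfolding max_number_def data_numbers_inst using assms
  by (intro Max.boundedI) (auto simp del: upt_Suc split: if_splits)

section \<open>Uncertain objectives\<close>

locale bounded_cnf =
  fixes F :: cnf and P m :: aexp
  assumes F: "cnf_bounded F P m"
begin

abbreviation "size_F \<equiv> length F"
abbreviation "np x \<equiv> aval P x (\<lambda>_. 0)"
abbreviation "nm x \<equiv> aval m x (\<lambda>_. 0)"

lemma closed: "avars P = {}" "avars m = {}"
  using F by (auto simp: cnf_bounded_def)

lemma F_pos: "F \<noteq> []" "0 < np x" "0 < nm x"
  using F by (auto simp: cnf_bounded_def)

lemma F_vars: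
  assumes "(s, ls, d) \<in> set F"
  shows "avars d \<subseteq> {0}" "\<forall>l\<in>set ls. avars l \<subseteq> {0}"
proof -
  have "\<forall>(s, ls, d)\<in>set F. avars d \<subseteq> {0} \<and> (\<forall>l\<in>set ls. avars l \<subseteq> {0})"
    using F by (simp add: cnf_bounded_def)
  from bspec[OF this assms] show "avars d \<subseteq> {0}" "\<forall>l\<in>set ls. avars l \<subseteq> {0}" by simp_all
qed

lemma F_bounds:
  assumes "(s, ls, d) \<in> set F"
  shows "length ls \<le> nm x" "p < np x \<Longrightarrow> \<forall>l\<in>set ls. aval l x (\<lambda>_. p) < nm x"
proof -
  have "\<forall>(s, ls, d)\<in>set F. length ls \<le> nm x \<and> (\<forall>l\<in>set ls. \<forall>p < np x. aval l x (\<lambda>_. p) < nm x)"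
    using F by (simp add: cnf_bounded_def)
  from bspec[OF this assms] show "length ls \<le> nm x" "p < np x \<Longrightarrow> \<forall>l\<in>set ls. aval l x (\<lambda>_. p) < nm x" by simp_all
qed

lemma aval_P_m [simp]: "aval P x (env(v := i)) = aval P x env" "aval m x (env(v := i)) = aval m x env"
  using closed by (auto intro: aval_closed)

definition demand :: "bool list \<Rightarrow> aexp \<Rightarrow> nat \<Rightarrow> nat" where
  "demand x d p = of_bool (aval d x (\<lambda>_. p) \<noteq> 0)"

lemma row_in_F: "i < np x * size_F \<Longrightarrow> F ! (i mod size_F) \<in> set F \<and> i div size_F < np x"
  using F_pos by (simp add: less_mult_imp_div_less)

lemma sat_rows:
  "sat F P x \<beta> \<longleftrightarrow> (\<forall>i < np x * size_F. case F ! (i mod size_F) of (s, ls, d) \<Rightarrow>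
     aval d x (\<lambda>_. i div size_F) \<noteq> 0 \<longrightarrow> (\<exists>l\<in>set ls. \<beta> (aval l x (\<lambda>_. i div size_F)) = s))"
proof -
  let ?c = "\<lambda>p (s, ls, d). aval d x (\<lambda>_. p) \<noteq> 0 \<longrightarrow> (\<exists>l\<in>set ls. \<beta> (aval l x (\<lambda>_. p)) = s)"
  have "sat F P x \<beta> \<longleftrightarrow> (\<forall>c\<in>set F. \<forall>p<np x. ?c p c)"
    by (simp add: sat_def case_prod_beta)
  also have "\<dots> \<longleftrightarrow> (\<forall>i<np x * size_F. ?c (i div size_F) (F ! (i mod size_F)))"
  proof (intro iffI ballI allI impI)
    fix c p assume all: "\<forall>i<np x * size_F. ?c (i div size_F) (F ! (i mod size_F))" and c: "c \<in> set F" "p < np x"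
    obtain s where s: "s < size_F" "c = F ! s" using c(1) by (metis in_set_conv_nth)
    have "p * size_F + s < (p + 1) * size_F" using s by simp
    also have "\<dots> \<le> np x * size_F" using c(2) by (intro mult_right_mono) auto
    finally have lt: "p * size_F + s < np x * size_F" .
    have "?c ((p * size_F + s) div size_F) (F ! ((p * size_F + s) mod size_F))" by (rule all[THEN spec, THEN mp, OF lt])
    then show "?c p c" using s F_pos(1) by simp
  next
    fix i assume "\<forall>c\<in>set F. \<forall>p<np x. ?c p c" "i < np x * size_F"
    from this(1)[THEN bspec, of "F ! (i mod size_F)", THEN spec, THEN mp, of "i div size_F"] row_in_F[OF this(2)]
    show "?c (i div size_F) (F ! (i mod size_F))" by (simp only:)
  qed
  finally show ?thesis .
qed

text \<open>As its literals have one sign, a clause bounds the number of its true variables: from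
  below by the demand if positive, from above by the length minus the demand if negative. An
  inactive clause has demand 0 and holds trivially.\<close>

lemma sat_counts:
  "sat F P x \<beta> \<longleftrightarrow> (\<forall>i < np x * size_F. case F ! (i mod size_F) of (s, ls, d) \<Rightarrow>
     if s then demand x d (i div size_F) \<le> length (filter (\<lambda>l. \<beta> (aval l x (\<lambda>_. i div size_F))) ls)
     else demand x d (i div size_F) + length (filter (\<lambda>l. \<beta> (aval l x (\<lambda>_. i div size_F))) ls) \<le> length ls)"
proof -
  let ?c = "\<lambda>p (s, ls, d). aval d x (\<lambda>_. p) \<noteq> 0 \<longrightarrow> (\<exists>l\<in>set ls. \<beta> (aval l x (\<lambda>_. p)) = s)"
  let ?r = "\<lambda>p (s, ls, d). if s then demand x d p \<le> length (filter (\<lambda>l. \<beta> (aval l x (\<lambda>_. p))) ls)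
      else demand x d p + length (filter (\<lambda>l. \<beta> (aval l x (\<lambda>_. p))) ls) \<le> length ls"
  have c: "?c p c \<longleftrightarrow> ?r p c" for p c
  proof -
    obtain s ls d where "c = (s, ls, d)" by (metis prod_cases3)
    then show ?thesis
      using length_filter_pos_iff[of "\<lambda>l. \<beta> (aval l x (\<lambda>_. p))" ls]
        length_filter_less_iff[of "\<lambda>l. \<beta> (aval l x (\<lambda>_. p))" ls]
        length_filter_le[of "\<lambda>l. \<beta> (aval l x (\<lambda>_. p))" ls]
      by (cases s; cases "aval d x (\<lambda>_. p) = 0") (auto simp: demand_def Suc_le_eq)
  qed
  show ?thesis unfolding sat_rows by (simp only: c)
qed

lemma gsem_rows:
  assumes "\<And>t p. t \<in> set ts \<Longrightarrow> gsem (G t) x ((\<lambda>_. 0)(0 := p)) = f p t"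
  shows "gsem (For 0 P (gcat (map G ts))) x (\<lambda>_. 0) =
    concat (map (\<lambda>i. f (i div length ts) (ts ! (i mod length ts))) [0..<np x * length ts])"
proof -
  have "gsem (For 0 P (gcat (map G ts))) x (\<lambda>_. 0) = concat (map (\<lambda>p. concat (map (f p) ts)) [0..<np x])"
    using assms by (auto simp: o_def intro!: arg_cong[of _ _ concat] map_cong)
  then show ?thesis unfolding concat_map_rows[symmetric] .
qed

text \<open>With \<open>objective_coeff\<close> this puts the inequality of
  \<open>sat_counts\<close> into the form that a cost is nonnegative.\<close>

definition objective_const :: "bool list \<Rightarrow> nat \<Rightarrow> bool \<times> aexp list \<times> aexp \<Rightarrow> int" where
  "objective_const x p = (\<lambda>(s, ls, d). (if s then 0 else int (length ls)) - int (demand x d p))"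

definition objective_coeff :: "bool list \<Rightarrow> nat \<Rightarrow> bool \<times> aexp list \<times> aexp \<Rightarrow> nat \<Rightarrow> int" where
  "objective_coeff x p = (\<lambda>(s, ls, d) j. (if s then 1 else - 1) * int (lit_count x ls p j))"

definition objective_inst :: "rat \<Rightarrow> bool list \<Rightarrow> instance_data" where
  "objective_inst rad x = inst (nm x) (np x * size_F) 1
     (\<lambda>i. of_int (objective_const x (i div size_F) (F ! (i mod size_F))))
     (\<lambda>i j. of_int (objective_coeff x (i div size_F) (F ! (i mod size_F)) j))
     (\<lambda>_ _. 0) (\<lambda>_ _. 0) (\<lambda>_. 0) rad 0"

definition objective_const_gen :: "bool \<times> aexp list \<times> aexp \<Rightarrow> gen" where
  "objective_const_gen = (\<lambda>(s, ls, d). let n = if s then 0 else int (length ls) in Branch d (gconst (n - 1)) (gconst n))"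

definition objective_coeff_gen :: "bool \<times> aexp list \<times> aexp \<Rightarrow> gen" where
  "objective_coeff_gen = (\<lambda>(s, ls, d). For 1 m ((if s then gnum else gneg) (acount ls)))"

definition objective_gen :: "aexp \<Rightarrow> gen" where
  "objective_gen rad = ginst m (Mul P (Lit size_F)) (Lit 1)
     (For 0 P (gcat (map objective_const_gen F))) (For 0 P (gcat (map objective_coeff_gen F)))
     (For 2 (Lit 1) (For 1 (Mul P (Lit size_F)) (gconst 0)))
     (For 2 (Lit 1) (For 1 m (gconst 0))) (For 2 (Lit 1) (gconst 0)) (gnum rad) (gconst 0)"

lemma gen_wf_objective: "gen_wf (objective_gen rad)"
  by (auto simp: objective_gen_def objective_const_gen_def objective_coeff_gen_def gen_wf_ginst Let_def split: if_splits)

lemma gsem_objective: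
  assumes "aval rad x (\<lambda>_. 0) = r"
  shows "gsem (objective_gen rad) x (\<lambda>_. 0) = enc_instance (objective_inst (of_nat r) x)"
  unfolding objective_gen_def objective_inst_def
proof (rule gsem_ginst)
  show "gsem (For 0 P (gcat (map objective_const_gen F))) x (\<lambda>_. 0) =
      concat (map (\<lambda>i. enc_rat (of_int (objective_const x (i div size_F) (F ! (i mod size_F))))) [0..<np x * size_F])"
  proof (rule gsem_rows)
    fix c p assume c: "c \<in> set F"
    obtain s ls d where "c = (s, ls, d)" by (metis prod_cases3)
    then show "gsem (objective_const_gen c) x ((\<lambda>_. 0)(0 := p)) = enc_rat (of_int (objective_const x p c))"
      using c aval_row[OF F_vars(1), of s ls d "(\<lambda>_. 0)(0 := p)" p x]
      by (simp add: demand_def objective_const_gen_def objective_const_def Let_def)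
  qed
  show "gsem (For 0 P (gcat (map objective_coeff_gen F))) x (\<lambda>_. 0) =
      concat (map (\<lambda>i. concat (map (\<lambda>j. enc_rat (of_int (objective_coeff x (i div size_F) (F ! (i mod size_F)) j))) [0..<nm x])) [0..<np x * size_F])"
  proof (rule gsem_rows)
    fix c p assume c: "c \<in> set F"
    obtain s ls d where "c = (s, ls, d)" by (metis prod_cases3)
    then show "gsem (objective_coeff_gen c) x ((\<lambda>_. 0)(0 := p)) =
        concat (map (\<lambda>j. enc_rat (of_int (objective_coeff x p c j))) [0..<nm x])"
      using c aval_acount[OF F_vars(2), of s ls d x] by (simp add: objective_coeff_gen_def objective_coeff_def)
  qed
qed (use closed assms in simp_all)

lemma yes_objective_inst:
  assumes nrm: "norm_on (nm x) nrm"
    and le: "\<And>\<xi> \<xi>'. \<xi> \<in> hypercube (nm x) \<Longrightarrow> \<xi>' \<in> hypercube (nm x) \<Longrightarrow> nrm (\<xi> - \<xi>') \<le> real r"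
  shows "yes_instance nrm (objective_inst (of_nat r) x) \<longleftrightarrow> (\<exists>\<beta>. sat F P x \<beta>)"
proof -
  have key: "0 \<le> objective_const x (i div size_F) (F ! (i mod size_F)) +
      (\<Sum>j<nm x. objective_coeff x (i div size_F) (F ! (i mod size_F)) j * of_bool (\<beta> j)) \<longleftrightarrow>
      (case F ! (i mod size_F) of (s, ls, d) \<Rightarrow>
     if s then demand x d (i div size_F) \<le> length (filter (\<lambda>l. \<beta> (aval l x (\<lambda>_. i div size_F))) ls)
     else demand x d (i div size_F) + length (filter (\<lambda>l. \<beta> (aval l x (\<lambda>_. i div size_F))) ls) \<le> length ls)"
    if i: "i < np x * size_F" for i \<beta>
  proof -
    obtain s ls d where c: "F ! (i mod size_F) = (s, ls, d)" by (metis prod_cases3)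
    define p where "p = i div size_F"
    have "(s, ls, d) \<in> set F" "p < np x" using row_in_F[OF i] c by (auto simp: p_def)
    then have "\<forall>l\<in>set ls. aval l x (\<lambda>_. p) < nm x" using F_bounds(2) by blast
    from arg_cong[OF sum_count[OF this, of \<beta>], of int]
    have sum: "(\<Sum>j<nm x. int (lit_count x ls p j) * of_bool (\<beta> j)) = int (length (filter (\<lambda>l. \<beta> (aval l x (\<lambda>_. p))) ls))"
      by (simp add: of_nat_sum del: sum_mult_of_bool_eq sum_of_bool_mult_eq)
    have "(\<Sum>j<nm x. (if s then 1 else - 1) * int (lit_count x ls p j) * of_bool (\<beta> j)) =
        (if s then 1 else - 1) * (\<Sum>j<nm x. int (lit_count x ls p j) * of_bool (\<beta> j))"
      by (simp only: sum_distrib_left mult.assoc)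
    then show ?thesis unfolding c p_def[symmetric] objective_const_def objective_coeff_def
      by (auto simp: sum simp del: sum_mult_of_bool_eq sum_of_bool_mult_eq)
  qed
  show ?thesis unfolding objective_inst_def sat_counts
    by (subst yes_inst_objective[OF nrm]; (intro ex_cong1 all_cong1 imp_cong refl key)?) (use le in auto)
qed

lemma objective_inst_props:
  "objective_inst (of_nat r) x \<in> instances" "objective_uncertainty (problem_of (objective_inst (of_nat r) x))"
  "nm x \<le> length (enc_instance (objective_inst (of_nat r) x))"
  unfolding objective_inst_def
  using F_pos by (auto intro!: inst_in_instances objective_uncertainty_inst add_leD1[OF length_enc_inst] simp: Suc_le_eq)

text \<open>Constants and coefficients are bounded by clause lengths up to 1, and clause lengths by
  the number of variables.\<close>

lemma max_number_objective_inst: "max_number (objective_inst (of_nat r) x) \<le> nm x + 1 + r"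
  unfolding objective_inst_def
proof (rule max_number_inst_le)
  fix i assume "i < np x * size_F"
  then obtain s ls d where c: "F ! (i mod size_F) = (s, ls, d)" "(s, ls, d) \<in> set F"
    using row_in_F by (metis prod_cases3)
  show "rat_magnitude (of_int (objective_const x (i div size_F) (F ! (i mod size_F)))) \<le> nm x + 1 + r"
    using F_bounds(1)[OF c(2), of x] unfolding rat_magnitude_of_int objective_const_def
    by (cases s; cases "aval d x (\<lambda>_. i div size_F) = 0") (auto simp: c demand_def nat_le_iff)
  fix j
  show "rat_magnitude (of_int (objective_coeff x (i div size_F) (F ! (i mod size_F)) j)) \<le> nm x + 1 + r"
    using F_bounds(1)[OF c(2), of x] lit_count_le[of x ls "i div size_F" j]
    unfolding rat_magnitude_of_int objective_coeff_def by (auto simp: c abs_mult)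
qed (use rat_magnitude_of_int[of 0] rat_magnitude_of_int[of "int r"] in auto)

end

section \<open>Uncertain right-hand sides\<close>

context bounded_cnf
begin

text \<open>One row for each literal of clause \<open>c\<close> and one for its condition: \<open>(c, g, l, e)\<close> is the
  constraint \<open>y\<^sub>c \<ge> g * \<xi>\<^sub>l + e\<close>.\<close>

definition clause_rows :: "nat \<Rightarrow> (nat \<times> int \<times> aexp \<times> aexp) list" where
  "clause_rows c = (case F ! c of (s, ls, d) \<Rightarrow>
     (c, 0, Lit 0, aeq d (Lit 0)) # map (\<lambda>l. (c, if s then 1 else - 1, l, Lit (of_bool (\<not> s)))) ls)"

definition rhs_rows :: "(nat \<times> int \<times> aexp \<times> aexp) list" where
  "rhs_rows = concat (map clause_rows [0..<size_F])"

lemma in_clause_rows: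
  "(c', t) \<in> set (clause_rows c) \<longleftrightarrow> c' = c \<and> (case F ! c of (s, ls, d) \<Rightarrow>
     t = (0, Lit 0, aeq d (Lit 0)) \<or> (\<exists>l\<in>set ls. t = (if s then 1 else - 1, l, Lit (of_bool (\<not> s)))))"
  by (cases "F ! c") (auto simp: clause_rows_def)

abbreviation "size_R \<equiv> length rhs_rows"
abbreviation (input) "rhs_row r \<equiv> rhs_rows ! (r mod size_R)"

lemma in_rhs_rows:
  "(c, t) \<in> set rhs_rows \<longleftrightarrow> c < size_F \<and> (case F ! c of (s, ls, d) \<Rightarrow>
     t = (0, Lit 0, aeq d (Lit 0)) \<or> (\<exists>l\<in>set ls. t = (if s then 1 else - 1, l, Lit (of_bool (\<not> s)))))"
  by (auto simp: rhs_rows_def in_clause_rows)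

lemma size_R_pos: "0 < size_R"
proof -
  obtain s ls d where "F ! 0 = (s, ls, d)" by (metis prod_cases3)
  then have "(0, 0, Lit 0, aeq d (Lit 0)) \<in> set rhs_rows" using F_pos(1) by (simp add: in_rhs_rows)
  then show ?thesis by (metis length_pos_if_in_set)
qed

text \<open>\<open>g = 0\<close> marks the row for the condition of a clause. It is true when the
  clause is inactive, so that such a clause counts as satisfied and the threshold can be the number
  of all clauses.\<close>

definition row_true :: "bool list \<Rightarrow> nat \<Rightarrow> (nat \<times> int \<times> aexp \<times> aexp) \<Rightarrow> (nat \<Rightarrow> bool) \<Rightarrow> bool" where
  "row_true x p = (\<lambda>(c, g, l, e) \<beta>. if g = 0 then aval e x (\<lambda>_. p) \<noteq> 0 else \<beta> (aval l x (\<lambda>_. p)) = (g = 1))"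

definition row_coeff :: "bool list \<Rightarrow> nat \<Rightarrow> (nat \<times> int \<times> aexp \<times> aexp) \<Rightarrow> nat \<Rightarrow> int" where
  "row_coeff x p = (\<lambda>(c, g, l, e) j. g * of_bool (aval l x (\<lambda>_. p) = j))"

definition row_const :: "bool list \<Rightarrow> nat \<Rightarrow> (nat \<times> int \<times> aexp \<times> aexp) \<Rightarrow> int" where
  "row_const x p = (\<lambda>(c, g, l, e). int (aval e x (\<lambda>_. p)))"

text \<open>A negative literal has the value 1 - \<xi>, so its row has coefficient -1 and constant
  1.\<close>

lemma row_value:
  assumes t: "t \<in> set rhs_rows" and p: "p < np x"
  shows "(\<Sum>j<nm x. row_coeff x p t j * of_bool (\<beta> j)) + row_const x p t = of_bool (row_true x p t \<beta>)"
proof -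
  obtain c g l e where t': "t = (c, g, l, e)" by (metis prod_cases4)
  obtain s ls d where c: "F ! c = (s, ls, d)" by (metis prod_cases3)
  have "(s, ls, d) \<in> set F" using t c unfolding t' in_rhs_rows by (metis nth_mem)
  from t c have "l \<in> set ls \<and> g = (if s then 1 else - 1) \<and> e = Lit (of_bool (\<not> s)) \<or> g = 0 \<and> e = aeq d (Lit 0)"
    unfolding t' in_rhs_rows by auto
  then show ?thesis
  proof
    assume l: "l \<in> set ls \<and> g = (if s then 1 else - 1) \<and> e = Lit (of_bool (\<not> s))"
    let ?a = "aval l x (\<lambda>_. p)"
    have "?a < nm x" using F_bounds(2)[OF \<open>(s, ls, d) \<in> set F\<close> p] l by blast
    moreover have "(\<Sum>j<nm x. row_coeff x p t j * of_bool (\<beta> j)) = (\<Sum>j<nm x. if j = ?a then g * of_bool (\<beta> ?a) else 0)"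
      by (intro sum.cong) (auto simp: row_coeff_def t')
    ultimately have "(\<Sum>j<nm x. row_coeff x p t j * of_bool (\<beta> j)) = g * of_bool (\<beta> ?a)" by simp
    then show ?thesis using l by (auto simp: row_const_def row_true_def t')
  next
    assume "g = 0 \<and> e = aeq d (Lit 0)"
    then show ?thesis by (simp add: row_coeff_def row_const_def row_true_def t')
  qed
qed

lemma rhs_row_in: "r < np x * size_R \<Longrightarrow> rhs_row r \<in> set rhs_rows \<and> r div size_R < np x"
  using size_R_pos by (simp add: less_mult_imp_div_less)

text \<open>Rows and clauses are numbered with different periods, \<open>size_R\<close> and
  \<open>size_F\<close>; a row with parameter \<open>p\<close> and scheme \<open>c\<close> belongs
  to clause \<open>p * size_F + c\<close>.\<close>

lemma sat_rhs_rows: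
  "sat F P x \<beta> \<longleftrightarrow> (\<forall>i < np x * size_F. \<exists>r < np x * size_R.
     r div size_R * size_F + fst (rhs_row r) = i \<and> row_true x (r div size_R) (rhs_row r) \<beta>)"
  unfolding sat_rows
proof (intro all_cong1 imp_cong refl)
  fix i assume i: "i < np x * size_F"
  define p where "p = i div size_F"
  define c where "c = i mod size_F"
  have pc: "i = p * size_F + c" "c < size_F" "p < np x"
    using row_in_F[OF i] F_pos(1) by (simp_all add: p_def c_def)
  obtain s ls d where Fc: "F ! c = (s, ls, d)" by (metis prod_cases3)
  have "(aval d x (\<lambda>_. p) \<noteq> 0 \<longrightarrow> (\<exists>l\<in>set ls. \<beta> (aval l x (\<lambda>_. p)) = s)) \<longleftrightarrow>
      (\<exists>t. (c, t) \<in> set rhs_rows \<and> row_true x p (c, t) \<beta>)"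
  proof -
    have "(\<exists>t. (c, t) \<in> set rhs_rows \<and> row_true x p (c, t) \<beta>) \<longleftrightarrow>
        row_true x p (c, 0, Lit 0, aeq d (Lit 0)) \<beta> \<or>
        (\<exists>l\<in>set ls. row_true x p (c, if s then 1 else - 1, l, Lit (of_bool (\<not> s))) \<beta>)"
      unfolding in_rhs_rows Fc prod.case using pc(2) by blast
    then show ?thesis by (cases s) (auto simp: row_true_def)
  qed
  also have "\<dots> \<longleftrightarrow> (\<exists>r < np x * size_R. r div size_R * size_F + fst (rhs_row r) = i \<and>
      row_true x (r div size_R) (rhs_row r) \<beta>)"
  proof
    assume "\<exists>t. (c, t) \<in> set rhs_rows \<and> row_true x p (c, t) \<beta>"
    then obtain t k where t: "k < size_R" "rhs_rows ! k = (c, t)" "row_true x p (c, t) \<beta>"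
      by (metis in_set_conv_nth)
    have "p * size_R + k < (p + 1) * size_R" using t by simp
    also have "\<dots> \<le> np x * size_R" using pc(3) by (intro mult_right_mono) auto
    finally have lt: "p * size_R + k < np x * size_R" .
    have "(p * size_R + k) div size_R = p" "(p * size_R + k) mod size_R = k"
      using t(1) size_R_pos by simp_all
    then show "\<exists>r < np x * size_R. r div size_R * size_F + fst (rhs_row r) = i \<and>
        row_true x (r div size_R) (rhs_row r) \<beta>"
      using t pc(1) lt by (intro exI[of _ "p * size_R + k"]) simp
  next
    assume "\<exists>r < np x * size_R. r div size_R * size_F + fst (rhs_row r) = i \<and>
        row_true x (r div size_R) (rhs_row r) \<beta>"
    then obtain r where r: "r < np x * size_R" "r div size_R * size_F + fst (rhs_row r) = i"
      "row_true x (r div size_R) (rhs_row r) \<beta>" by blast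
    obtain c' t where t: "rhs_row r = (c', t)" by (metis surj_pair)
    have mem: "(c', t) \<in> set rhs_rows" using rhs_row_in[OF r(1)] t by simp
    then have c': "c' < size_F" by (simp add: in_rhs_rows)
    have "i = r div size_R * size_F + c'" using r(2) t by simp
    then have "p = r div size_R" "c = c'" using c' F_pos(1) by (simp_all add: p_def c_def)
    then show "\<exists>t. (c, t) \<in> set rhs_rows \<and> row_true x p (c, t) \<beta>" using mem r(3) unfolding t by blast
  qed
  finally show "(case F ! (i mod size_F) of (s, ls, d) \<Rightarrow>
      aval d x (\<lambda>_. i div size_F) \<noteq> 0 \<longrightarrow> (\<exists>l\<in>set ls. \<beta> (aval l x (\<lambda>_. i div size_F)) = s)) \<longleftrightarrow>
      (\<exists>r < np x * size_R. r div size_R * size_F + fst (rhs_row r) = i \<and>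
      row_true x (r div size_R) (rhs_row r) \<beta>)"
    unfolding p_def[symmetric] c_def[symmetric] Fc prod.case .
qed

definition rhs_inst :: "rat \<Rightarrow> bool list \<Rightarrow> instance_data" where
  "rhs_inst rad x = inst (nm x) (np x * size_F) (np x * size_R) (\<lambda>_. 1) (\<lambda>_ _. 0)
     (\<lambda>r i. of_bool (i = r div size_R * size_F + fst (rhs_row r)))
     (\<lambda>r j. of_int (row_coeff x (r div size_R) (rhs_row r) j))
     (\<lambda>r. of_int (row_const x (r div size_R) (rhs_row r))) rad (of_nat (np x * size_F))"

definition selector_gen :: "nat \<times> int \<times> aexp \<times> aexp \<Rightarrow> gen" where
  "selector_gen = (\<lambda>t. For 1 (Mul P (Lit size_F)) (gnum (aeq (Var 1) (Add (Mul (Var 0) (Lit size_F)) (Lit (fst t))))))"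

definition row_coeff_gen :: "nat \<times> int \<times> aexp \<times> aexp \<Rightarrow> gen" where
  "row_coeff_gen = (\<lambda>(c, g, l, e). For 1 m (if g = 0 then gconst 0 else (if g = 1 then gnum else gneg) (aeq l (Var 1))))"

definition rhs_gen :: "aexp \<Rightarrow> gen" where
  "rhs_gen rad = (let n = Mul P (Lit size_F) in ginst m n (Mul P (Lit size_R))
     (For 1 n (gconst 1)) (For 2 n (For 1 m (gconst 0)))
     (For 0 P (gcat (map selector_gen rhs_rows))) (For 0 P (gcat (map row_coeff_gen rhs_rows)))
     (For 0 P (gcat (map (\<lambda>t. gnum (snd (snd (snd t)))) rhs_rows))) (gnum rad) (gnum n))"

lemma gen_wf_rhs: "gen_wf (rhs_gen rad)"
  by (auto simp: rhs_gen_def selector_gen_def row_coeff_gen_def Let_def gen_wf_ginst split: if_splits)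

lemma rhs_rows_vars:
  assumes "(c, g, l, e) \<in> set rhs_rows"
  shows "avars l \<subseteq> {0}" "avars e \<subseteq> {0}" "g \<in> {- 1, 0, 1}"
proof -
  obtain s ls d where Fc: "F ! c = (s, ls, d)" by (metis prod_cases3)
  moreover from this have "(s, ls, d) \<in> set F" using assms unfolding in_rhs_rows by (metis nth_mem)
  ultimately show "avars l \<subseteq> {0}" "avars e \<subseteq> {0}" "g \<in> {- 1, 0, 1}"
    using assms F_vars[of s ls d] unfolding in_rhs_rows by (auto split: if_splits)
qed

lemma gsem_rhs:
  assumes "aval rad x (\<lambda>_. 0) = r"
  shows "gsem (rhs_gen rad) x (\<lambda>_. 0) = enc_instance (rhs_inst (of_nat r) x)"
  unfolding rhs_gen_def Let_def rhs_inst_def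
proof (rule gsem_ginst)
  show "gsem (For 0 P (gcat (map selector_gen rhs_rows))) x (\<lambda>_. 0) =
      concat (map (\<lambda>r. concat (map (\<lambda>i. enc_rat (of_bool (i = r div size_R * size_F + fst (rhs_row r)))) [0..<np x * size_F])) [0..<np x * size_R])"
    by (rule gsem_rows) (simp add: selector_gen_def)
  show "gsem (For 0 P (gcat (map row_coeff_gen rhs_rows))) x (\<lambda>_. 0) =
      concat (map (\<lambda>r. concat (map (\<lambda>j. enc_rat (of_int (row_coeff x (r div size_R) (rhs_row r) j))) [0..<nm x])) [0..<np x * size_R])"
  proof (rule gsem_rows)
    fix t p assume t: "t \<in> set rhs_rows"
    obtain c g l e where t': "t = (c, g, l, e)" by (metis prod_cases4)
    have "aval l x ((\<lambda>_. 0)(0 := p, 1 := j)) = aval l x (\<lambda>_. p)" for j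
      by (rule aval_row[OF rhs_rows_vars(1)[OF t[unfolded t']]]) simp
    then show "gsem (row_coeff_gen t) x ((\<lambda>_. 0)(0 := p)) =
        concat (map (\<lambda>j. enc_rat (of_int (row_coeff x p t j))) [0..<nm x])"
      using rhs_rows_vars(3)[OF t[unfolded t']]
      by (auto simp: t' row_coeff_gen_def row_coeff_def of_bool_def intro!: arg_cong[of _ _ concat] map_cong)
  qed
  show "gsem (For 0 P (gcat (map (\<lambda>t. gnum (snd (snd (snd t)))) rhs_rows))) x (\<lambda>_. 0) =
      concat (map (\<lambda>r. enc_rat (of_int (row_const x (r div size_R) (rhs_row r)))) [0..<np x * size_R])"
  proof (rule gsem_rows)
    fix t p assume t: "t \<in> set rhs_rows"
    obtain c g l e where t': "t = (c, g, l, e)" by (metis prod_cases4)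
    show "gsem (gnum (snd (snd (snd t)))) x ((\<lambda>_. 0)(0 := p)) = enc_rat (of_int (row_const x p t))"
      using aval_row[OF rhs_rows_vars(2)[OF t[unfolded t']], of "(\<lambda>_. 0)(0 := p)" p x] by (simp add: row_const_def t')
  qed
qed (use closed assms in simp_all)

lemma yes_rhs_inst:
  assumes nrm: "norm_on (nm x) nrm"
    and le: "\<And>\<xi> \<xi>'. \<xi> \<in> hypercube (nm x) \<Longrightarrow> \<xi>' \<in> hypercube (nm x) \<Longrightarrow> nrm (\<xi> - \<xi>') \<le> real r"
  shows "yes_instance nrm (rhs_inst (of_nat r) x) \<longleftrightarrow> (\<exists>\<beta>. sat F P x \<beta>)"
  unfolding rhs_inst_def sat_rhs_rows
proof (rule yes_inst_rhs[OF nrm])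
  fix r assume r: "r < np x * size_R"
  have t: "rhs_row r \<in> set rhs_rows" "r div size_R < np x" using rhs_row_in[OF r] by auto
  have "fst (rhs_row r) < size_F"
    using in_rhs_rows[of "fst (rhs_row r)" "snd (rhs_row r)"] t(1) by simp
  then have "r div size_R * size_F + fst (rhs_row r) < (r div size_R + 1) * size_F" by simp
  also have "\<dots> \<le> np x * size_F" using t(2) by (intro mult_right_mono) auto
  finally show "r div size_R * size_F + fst (rhs_row r) < np x * size_F" .
  show "(\<Sum>j<nm x. row_coeff x (r div size_R) (rhs_row r) j * of_bool (\<beta> j)) +
      row_const x (r div size_R) (rhs_row r) =
      of_bool (row_true x (r div size_R) (rhs_row r) \<beta>)" for \<beta>
    by (rule row_value[OF t])
qed (use le in auto)

lemma rhs_inst_props: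
  "rhs_inst (of_nat r) x \<in> instances" "rhs_uncertainty (problem_of (rhs_inst (of_nat r) x))"
  "nm x + np x * size_F \<le> length (enc_instance (rhs_inst (of_nat r) x))"
  unfolding rhs_inst_def
  using F_pos size_R_pos by (auto intro!: inst_in_instances rhs_uncertainty_inst length_enc_inst simp: Suc_le_eq)

text \<open>The threshold accounts for \<open>np x * size_F\<close>, which is the number of
  second-stage variables and thus also below the encoding length.\<close>

lemma max_number_rhs_inst: "max_number (rhs_inst (of_nat r) x) \<le> nm x + np x * size_F + 1 + r"
  unfolding rhs_inst_def
proof (rule max_number_inst_le)
  fix k assume "k < np x * size_R"
  then obtain c g l e where t: "rhs_row k = (c, g, l, e)" "(c, g, l, e) \<in> set rhs_rows"
    using rhs_row_in[of k x] by (metis prod_cases4)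
  obtain s ls d where Fc: "F ! c = (s, ls, d)" by (metis prod_cases3)
  have "aval e x env \<le> 1" for env using t(2) Fc by (auto simp: in_rhs_rows)
  then show "rat_magnitude (of_int (row_const x (k div size_R) (rhs_row k))) \<le> nm x + np x * size_F + 1 + r"
    unfolding rat_magnitude_of_int t(1) row_const_def by (simp add: trans_le_add2)
  fix j
  have "\<bar>row_coeff x (k div size_R) (rhs_row k) j\<bar> \<le> 1"
    using rhs_rows_vars(3)[OF t(2)] by (auto simp: row_coeff_def t(1))
  then show "rat_magnitude (of_int (row_coeff x (k div size_R) (rhs_row k) j)) \<le> nm x + np x * size_F + 1 + r"
    unfolding rat_magnitude_of_int by (simp add: nat_le_iff)
qed (use rat_magnitude_of_int[of 0] rat_magnitude_of_int[of 1] rat_magnitude_of_int[of "int r"]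
    rat_magnitude_of_int[of "int (np x * size_F)"] in \<open>auto simp: of_bool_def simp del: of_nat_mult\<close>)

end

section \<open>Aggregation of equations\<close>

definition digits :: "nat \<Rightarrow> nat \<Rightarrow> bool list" where
  "digits e v = map (\<lambda>i. odd (v div 2 ^ i)) [0..<e]"

text \<open>The part above the lowest \<open>e\<close> bits is positive, so all of these bits are
  written, zeros included.\<close>

lemma bits_add_power: "v < 2 ^ e \<Longrightarrow> 0 < t \<Longrightarrow> bits (v + 2 ^ e * t) = digits e v @ bits t"
proof (induction e arbitrary: v)
  case (Suc e)
  have "v div 2 < 2 ^ e" using Suc.prems(1) by auto
  then have IH: "bits (v div 2 + 2 ^ e * t) = digits e (v div 2) @ bits t" using Suc.IH Suc.prems(2) by blast
  have "(v + 2 ^ Suc e * t) div 2 = v div 2 + 2 ^ e * t"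
    using div_mult_self2[of 2 v "2 ^ e * t"] by (simp add: mult.assoc)
  moreover have "odd (v + 2 ^ Suc e * t) = odd v" by simp
  moreover have "v + 2 ^ Suc e * t \<noteq> 0" using Suc.prems(2) by simp
  ultimately have "bits (v + 2 ^ Suc e * t) = odd v # digits e (v div 2) @ bits t"
    using IH by (subst bits.simps) simp
  moreover have "digits (Suc e) v = odd v # digits e (v div 2)"
    unfolding digits_def upt_conv_Cons[OF zero_less_Suc] map_Suc_upt[symmetric]
    by (simp add: div_mult2_eq o_def)
  ultimately show ?case by simp
qed (simp add: digits_def)

text \<open>\<open>n\<close> digits in base \<open>b\<close> below a top part \<open>t\<close>,
  which may exceed the base.\<close>

definition number :: "nat \<Rightarrow> (nat \<Rightarrow> nat) \<Rightarrow> nat \<Rightarrow> nat \<Rightarrow> nat" where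
  "number b f n t = (\<Sum>r<n. f r * b ^ r) + b ^ n * t"

lemma number_Suc: "number b f (Suc n) t = number b f n (f n + b * t)"
  by (simp add: number_def algebra_simps)

lemma number_pos: "0 < b \<Longrightarrow> 0 < t \<Longrightarrow> 0 < number b f n t"
  by (simp add: number_def)

text \<open>Reducing modulo \<open>b\<close> isolates one digit; everything above it belongs to the
  unrestricted top part.\<close>

lemma number_eq_iff:
  assumes "\<And>r. r < n \<Longrightarrow> f r < b" "\<And>r. r < n \<Longrightarrow> g r < b"
  shows "number b f n t = number b g n u \<longleftrightarrow> (\<forall>r<n. f r = g r) \<and> t = u"
  using assms
proof (induction n arbitrary: t u)
  case 0
  then show ?case by (simp add: number_def)
next
  case (Suc n)
  have "f n + b * t = g n + b * u \<longleftrightarrow> f n = g n \<and> t = u"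
  proof
    assume eq: "f n + b * t = g n + b * u"
    have "f n = (f n + b * t) mod b" "g n = (g n + b * u) mod b" using Suc.prems[of n] by simp_all
    then have "f n = g n" using eq by simp
    then show "f n = g n \<and> t = u" using eq Suc.prems(1)[of n] by simp
  qed simp
  then show ?case using Suc unfolding number_Suc by (auto simp: less_Suc_eq)
qed

text \<open>Digit sums may exceed the base here; they have to stay below it only where
  \<open>number_eq_iff\<close> is applied.\<close>

lemma sum_number:
  "(\<Sum>j\<in>A. number b (f j) n (t j) * c j) = number b (\<lambda>r. \<Sum>j\<in>A. f j r * c j) n (\<Sum>j\<in>A. t j * c j)"
proof -
  have "(\<Sum>j\<in>A. (\<Sum>r<n. f j r * b ^ r) * c j) = (\<Sum>r<n. (\<Sum>j\<in>A. f j r * c j) * b ^ r)"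
    unfolding sum_distrib_right by (subst sum.swap) (simp add: ac_simps)
  moreover have "(\<Sum>j\<in>A. b ^ n * t j * c j) = b ^ n * (\<Sum>j\<in>A. t j * c j)"
    by (simp add: sum_distrib_left ac_simps)
  ultimately show ?thesis by (simp add: number_def distrib_right sum.distrib)
qed

definition digit_code :: "nat \<Rightarrow> nat \<Rightarrow> bool list" where
  "digit_code e v = concat (map (\<lambda>b. [True, b]) (digits e v))"

text \<open>In a base that is a power of two the digits occupy disjoint blocks of bits, least
  significant first, so exponentially large numbers can be written digit by digit.\<close>

lemma enc_nat_number:
  assumes "\<And>r. r < n \<Longrightarrow> f r < 2 ^ e" "0 < t"
  shows "enc_nat (number (2 ^ e) f n t) = concat (map (\<lambda>r. digit_code e (f r)) [0..<n]) @ enc_nat t"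
  using assms
proof (induction n arbitrary: t)
  case (Suc n)
  have "enc_nat (f n + 2 ^ e * t) = digit_code e (f n) @ enc_nat t"
    using bits_add_power[of "f n" e t] Suc.prems by (simp add: enc_nat_def digit_code_def)
  moreover have "0 < f n + 2 ^ e * t" using Suc.prems(2) by simp
  ultimately show ?case using Suc unfolding number_Suc by simp
qed (simp add: number_def)

text \<open>A table lookup, available for digits because the base does not depend on the
  input.\<close>

fun gcase :: "aexp \<Rightarrow> gen list \<Rightarrow> gen" where
  "gcase a [] = Emit []"
| "gcase a (g # gs) = Branch a (gcase (Sub a (Lit 1)) gs) g"

lemma gsem_gcase: "aval a x env < length gs \<Longrightarrow> gsem (gcase a gs) x env = gsem (gs ! aval a x env) x env"
  by (induction a gs rule: gcase.induct) (auto simp: nth_Cons')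

lemma gen_gcase: "gen_wf (gcase a gs) \<longleftrightarrow> (\<forall>g\<in>set gs. gen_wf g)" "loopvars (gcase a gs) = (\<Union>g\<in>set gs. loopvars g)"
  by (induction a gs rule: gcase.induct) auto

lemma sum_lessThan_add:
  fixes n k :: nat and f :: "nat \<Rightarrow> nat"
  shows "(\<Sum>j<n + k. f j) = (\<Sum>j<n. f j) + (\<Sum>j<k. f (n + j))"
  by (induction k) (auto simp: ac_simps)

lemma length_filter_less: "length (filter (\<lambda>i. i < n) [0..<k]) = min n k"
  by (induction k) auto

section \<open>Equations with slack variables\<close>

context bounded_cnf
begin

text \<open>Positive, larger than every clause length and independent of the input: the number of
  slack variables reserved for a clause and, doubled, the exponent of the base.\<close>

definition slack :: nat where
  "slack = Suc (sum_list (map (\<lambda>(s, ls, d). length ls) F))"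

definition base_vars :: aexp where
  "base_vars = Add m (Mul (Mul P (Lit size_F)) (Lit slack))"

text \<open>Each clause owns a block of \<open>slack\<close> variables, so the slack of different
  equations can be chosen independently.\<close>

definition slack_var :: "nat \<Rightarrow> nat \<Rightarrow> aexp" where
  "slack_var c i = Add m (Add (Mul (Add (Mul (Var 0) (Lit size_F)) (Lit c)) (Lit slack)) (Lit i))"

text \<open>The equation for clause \<open>c\<close> says that the number of its variables that are true, plus that
  of its slack variables that are true, is the target.\<close>

definition eq_lits :: "nat \<Rightarrow> aexp list" where
  "eq_lits c = (case F ! c of (s, ls, d) \<Rightarrow> ls @ map (slack_var c) [0..<length ls])"

text \<open>A clause without literals has no slack variables either, hence cannot attain the target 1.\<close>

definition target :: "bool \<Rightarrow> nat \<Rightarrow> nat \<Rightarrow> nat" where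
  "target s n d = (if s then n + d else if n < d then 1 else n - d)"

definition row_target :: "bool list \<Rightarrow> nat \<Rightarrow> nat \<Rightarrow> nat" where
  "row_target x p c = (case F ! c of (s, ls, d) \<Rightarrow> target s (length ls) (demand x d p))"

abbreviation "nb x \<equiv> aval base_vars x (\<lambda>_. 0)"

lemma nb_eq: "nb x = nm x + np x * size_F * slack"
  by (simp add: base_vars_def)

lemma closed_base: "avars base_vars = {}"
  using closed by (simp add: base_vars_def)

lemma aval_base [simp]: "aval base_vars x (env(v := i)) = aval base_vars x env"
  using closed_base by (auto intro: aval_closed)

lemma length_le_slack: "(s, ls, d) \<in> set F \<Longrightarrow> length ls < slack"
  using member_le_sum_list[of "length ls" "map (\<lambda>(s, ls, d). length ls) F"] by (force simp: slack_def less_Suc_eq_le)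

lemma aval_slack_var: "aval (slack_var c i) x (\<lambda>_. p) = nm x + (p * size_F + c) * slack + i"
  using aval_closed[OF closed(2), of x "\<lambda>_. p" "\<lambda>_. 0"] by (simp add: slack_var_def)

lemma eq_lits_vars: "c < size_F \<Longrightarrow> \<forall>l\<in>set (eq_lits c). avars l \<subseteq> {0}"
proof -
  assume "c < size_F"
  obtain s ls d where c: "F ! c = (s, ls, d)" by (metis prod_cases3)
  then have "(s, ls, d) \<in> set F" using \<open>c < size_F\<close> by (metis nth_mem)
  then show ?thesis using F_vars(2)[of s ls d] closed by (auto simp: eq_lits_def c slack_var_def)
qed

lemma eq_lits_bound:
  assumes c: "c < size_F" and p: "p < np x"
  shows "\<forall>l\<in>set (eq_lits c). aval l x (\<lambda>_. p) < nb x"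
proof -
  obtain s ls d where Fc: "F ! c = (s, ls, d)" by (metis prod_cases3)
  then have mem: "(s, ls, d) \<in> set F" using c by (metis nth_mem)
  have "nm x + (p * size_F + c) * slack + i < nb x" if "i < length ls" for i
  proof -
    have "(p * size_F + c) * slack + i < (p * size_F + c + 1) * slack"
      using that length_le_slack[OF mem] by simp
    also have "\<dots> \<le> np x * size_F * slack"
    proof (rule mult_right_mono)
      have "p * size_F + c + 1 \<le> (p + 1) * size_F" using c by simp
      also have "\<dots> \<le> np x * size_F" using p by (intro mult_right_mono) auto
      finally show "p * size_F + c + 1 \<le> np x * size_F" .
    qed simp
    finally show ?thesis by (simp add: nb_eq)
  qed
  then show ?thesis
    using F_bounds(2)[OF mem p] by (auto simp: eq_lits_def Fc aval_slack_var nb_eq intro: trans_less_add1)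
qed

text \<open>With \<open>length_eq_lits\<close> this excludes carries: targets and digit sums are at
  most twice \<open>slack\<close>, hence below the base.\<close>

lemma row_target_less: "c < size_F \<Longrightarrow> row_target x p c < 2 ^ (2 * slack)"
proof -
  assume "c < size_F"
  obtain s ls d where c: "F ! c = (s, ls, d)" by (metis prod_cases3)
  then have "length ls < slack" using \<open>c < size_F\<close> length_le_slack by (metis nth_mem)
  then have "row_target x p c \<le> 2 * slack" by (auto simp: row_target_def c target_def demand_def)
  then show ?thesis using less_exp[of "2 * slack"] by linarith
qed

lemma length_eq_lits: "c < size_F \<Longrightarrow> length (eq_lits c) < 2 ^ (2 * slack)"
proof -
  assume "c < size_F"
  obtain s ls d where c: "F ! c = (s, ls, d)" by (metis prod_cases3)
  then have "length ls < slack" using \<open>c < size_F\<close> length_le_slack by (metis nth_mem)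
  then have "length (eq_lits c) < 2 * slack" by (simp add: eq_lits_def c)
  then show ?thesis using less_exp[of "2 * slack"] by linarith
qed

definition coefficient :: "bool list \<Rightarrow> nat \<Rightarrow> nat" where
  "coefficient x j = number (2 ^ (2 * slack)) (\<lambda>i. lit_count x (eq_lits (i mod size_F)) (i div size_F) j) (np x * size_F) 1"

definition total :: "bool list \<Rightarrow> nat" where
  "total x = number (2 ^ (2 * slack)) (\<lambda>i. row_target x (i div size_F) (i mod size_F)) (np x * size_F) (nb x)"

lemma row_mod_less: "i mod size_F < size_F"
  using F_pos(1) by simp

text \<open>Comparing digits gives one equation for each clause. Comparing the top parts, 1 for each
  coefficient and \<open>nb x\<close> for the total, adds the equation that exactly
  \<open>nb x\<close> of the variables are true.\<close>

lemma subset_sum_iff_rows: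
  "(\<Sum>j<2 * nb x. coefficient x j * of_bool (\<beta> j)) = total x \<longleftrightarrow>
     (\<forall>i < np x * size_F. length (filter (\<lambda>l. \<beta> (aval l x (\<lambda>_. i div size_F))) (eq_lits (i mod size_F))) =
        row_target x (i div size_F) (i mod size_F)) \<and>
     (\<Sum>j<2 * nb x. of_bool (\<beta> j)) = nb x"
proof -
  have row: "(\<Sum>j<2 * nb x. lit_count x (eq_lits (i mod size_F)) (i div size_F) j * of_bool (\<beta> j)) =
      length (filter (\<lambda>l. \<beta> (aval l x (\<lambda>_. i div size_F))) (eq_lits (i mod size_F)))"
    if "i < np x * size_F" for i
    using eq_lits_bound[OF row_mod_less, of "i div size_F" x i] row_in_F[OF that]
    by (intro sum_count) auto
  have less: "(\<Sum>j<2 * nb x. lit_count x (eq_lits (i mod size_F)) (i div size_F) j * of_bool (\<beta> j)) < 2 ^ (2 * slack)"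
    if "i < np x * size_F" for i
    using row[OF that] length_eq_lits[OF row_mod_less, of i]
      length_filter_le[of "\<lambda>l. \<beta> (aval l x (\<lambda>_. i div size_F))" "eq_lits (i mod size_F)"] by linarith
  show ?thesis
    unfolding coefficient_def total_def sum_number
    by (subst number_eq_iff[OF less row_target_less[OF row_mod_less]])
      (use row in \<open>auto simp del: sum_mult_of_bool_eq sum_of_bool_mult_eq\<close>)
qed

text \<open>Let \<open>tr\<close> of \<open>n\<close> literals be true. With at most
  \<open>n\<close> true slack variables the sum \<open>n + d\<close> is attainable iff
  \<open>tr \<ge> d\<close>, and, for \<open>d \<le> n\<close>, the sum \<open>n - d\<close> iff
  \<open>tr \<le> n - d\<close>.\<close>

lemma ex_subset_sum_iff:
  "(\<exists>\<beta>. (\<Sum>j<2 * nb x. coefficient x j * of_bool (\<beta> j)) = total x) \<longleftrightarrow> (\<exists>\<beta>. sat F P x \<beta>)"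
proof
  assume "\<exists>\<beta>. (\<Sum>j<2 * nb x. coefficient x j * of_bool (\<beta> j)) = total x"
  then obtain \<beta> where \<beta>: "\<And>i. i < np x * size_F \<Longrightarrow>
      length (filter (\<lambda>l. \<beta> (aval l x (\<lambda>_. i div size_F))) (eq_lits (i mod size_F))) =
        row_target x (i div size_F) (i mod size_F)"
    unfolding subset_sum_iff_rows by blast
  have "sat F P x \<beta>"
    unfolding sat_counts
  proof (intro allI impI)
    fix i assume i: "i < np x * size_F"
    obtain s ls d where c: "F ! (i mod size_F) = (s, ls, d)" by (metis prod_cases3)
    let ?b = "\<lambda>l. \<beta> (aval l x (\<lambda>_. i div size_F))"
    define sl where "sl = length (filter (?b \<circ> slack_var (i mod size_F)) [0..<length ls])"
    define tr where "tr = length (filter ?b ls)"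
    have "tr + sl = target s (length ls) (demand x d (i div size_F))"
      using \<beta>[OF i] by (simp add: eq_lits_def row_target_def c filter_map sl_def tr_def)
    moreover have "sl \<le> length ls" unfolding sl_def by (metis length_filter_le length_upt diff_zero)
    moreover have "demand x d (i div size_F) \<le> 1" by (simp add: demand_def)
    moreover have "tr \<le> length ls" unfolding tr_def by (rule length_filter_le)
    ultimately show "case F ! (i mod size_F) of (s, ls, d) \<Rightarrow>
       if s then demand x d (i div size_F) \<le> length (filter (\<lambda>l. \<beta> (aval l x (\<lambda>_. i div size_F))) ls)
       else demand x d (i div size_F) + length (filter (\<lambda>l. \<beta> (aval l x (\<lambda>_. i div size_F))) ls) \<le> length ls"
      unfolding c prod.case tr_def[symmetric] by (auto simp: target_def split: if_splits)
  qed
  then show "\<exists>\<beta>. sat F P x \<beta>" by blast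
next
  assume "\<exists>\<beta>. sat F P x \<beta>"
  then obtain \<beta>0 where \<beta>0: "sat F P x \<beta>0" by blast
  define true where "true i = length (filter (\<lambda>l. \<beta>0 (aval l x (\<lambda>_. i div size_F))) (fst (snd (F ! (i mod size_F)))))" for i
  \<comment> \<open>What a clause lacks to its target is supplied by the first slack variables of
    its block; \<open>(j - nm x) div slack\<close> is the number of the clause.\<close>
  define \<beta>1 where "\<beta>1 j \<longleftrightarrow> (if j < nm x then \<beta>0 j else (j - nm x) mod slack <
    row_target x ((j - nm x) div slack div size_F) ((j - nm x) div slack mod size_F) - true ((j - nm x) div slack))" for j
  define t where "t = (\<Sum>j<nb x. of_bool (\<beta>1 j) :: nat)"
  \<comment> \<open>The padding variables raise the number of true variables from \<open>t\<close>
    to \<open>nb x\<close>.\<close>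
  define \<beta> where "\<beta> j \<longleftrightarrow> (if j < nb x then \<beta>1 j else j - nb x < nb x - t)" for j
  have "t \<le> (\<Sum>j<nb x. 1)" unfolding t_def by (intro sum_mono) auto
  then have t: "t \<le> nb x" by simp
  have "(\<Sum>j<2 * nb x. of_bool (\<beta> j)) = (\<Sum>j<nb x. of_bool (\<beta> j)) + (\<Sum>j<nb x. of_bool (\<beta> (nb x + j)) :: nat)"
    unfolding mult_2 by (rule sum_lessThan_add)
  also have "(\<Sum>j<nb x. of_bool (\<beta> (nb x + j)) :: nat) = (\<Sum>j<nb x. of_bool (j < nb x - t))"
    by (simp only: \<beta>_def not_add_less1 if_False diff_add_inverse)
  also have "\<dots> = nb x - t"
  proof -
    have "{..<nb x} \<inter> {j. j < nb x - t} = {..<nb x - t}" by auto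
    then show ?thesis by simp
  qed
  also have "(\<Sum>j<nb x. of_bool (\<beta> j)) = t" unfolding t_def by (intro sum.cong) (auto simp: \<beta>_def)
  finally have sum: "(\<Sum>j<2 * nb x. of_bool (\<beta> j)) = nb x" using t by simp
  have "length (filter (\<lambda>l. \<beta> (aval l x (\<lambda>_. i div size_F))) (eq_lits (i mod size_F))) =
        row_target x (i div size_F) (i mod size_F)" if i: "i < np x * size_F" for i
  proof -
    let ?p = "i div size_F" and ?c = "i mod size_F"
    obtain s ls d where c: "F ! ?c = (s, ls, d)" by (metis prod_cases3)
    have p: "?p < np x" and mem: "(s, ls, d) \<in> set F" using row_in_F[OF i] c by auto
    have tr: "true i = length (filter (\<lambda>l. \<beta>0 (aval l x (\<lambda>_. ?p))) ls)" by (simp add: true_def c)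
    have lits: "aval l x (\<lambda>_. ?p) < nb x" if "l \<in> set (eq_lits ?c)" for l
      using eq_lits_bound[OF row_mod_less p] that by blast
    have ls: "filter (\<lambda>l. \<beta> (aval l x (\<lambda>_. ?p))) ls = filter (\<lambda>l. \<beta>0 (aval l x (\<lambda>_. ?p))) ls"
    proof (rule filter_cong[OF refl])
      fix l assume "l \<in> set ls"
      then have "aval l x (\<lambda>_. ?p) < nm x" using F_bounds(2)[OF mem p] by blast
      then show "\<beta> (aval l x (\<lambda>_. ?p)) = \<beta>0 (aval l x (\<lambda>_. ?p))" by (simp add: \<beta>_def \<beta>1_def nb_eq)
    qed
    have sl: "filter (\<lambda>k. \<beta> (aval (slack_var ?c k) x (\<lambda>_. ?p))) [0..<length ls] =
        filter (\<lambda>k. k < row_target x ?p ?c - true i) [0..<length ls]"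
    proof (rule filter_cong[OF refl])
      fix k assume "k \<in> set [0..<length ls]"
      then have k: "k < length ls" "k < slack" using length_le_slack[OF mem] by auto
      have "aval (slack_var ?c k) x (\<lambda>_. ?p) < nb x"
        using k(1) by (intro lits) (simp add: eq_lits_def c)
      moreover have "aval (slack_var ?c k) x (\<lambda>_. ?p) = nm x + (i * slack + k)"
        by (simp add: aval_slack_var)
      moreover have "(i * slack + k) div slack = i" "(i * slack + k) mod slack = k" using k(2) by simp_all
      ultimately show "\<beta> (aval (slack_var ?c k) x (\<lambda>_. ?p)) = (k < row_target x ?p ?c - true i)"
        by (simp add: \<beta>_def \<beta>1_def)
    qed
    have "length (filter (\<lambda>l. \<beta> (aval l x (\<lambda>_. ?p))) (eq_lits ?c)) =
        true i + min (row_target x ?p ?c - true i) (length ls)"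
      unfolding eq_lits_def c prod.case filter_append length_append filter_map length_map o_def ls sl length_filter_less
      by (simp only: tr)
    moreover have "true i \<le> row_target x ?p ?c \<and> row_target x ?p ?c - true i \<le> length ls"
    proof -
      have "case F ! ?c of (s, ls, d) \<Rightarrow>
         if s then demand x d ?p \<le> length (filter (\<lambda>l. \<beta>0 (aval l x (\<lambda>_. ?p))) ls)
         else demand x d ?p + length (filter (\<lambda>l. \<beta>0 (aval l x (\<lambda>_. ?p))) ls) \<le> length ls"
        by (rule \<beta>0[unfolded sat_counts, THEN spec, THEN mp, OF i])
      then have "if s then demand x d ?p \<le> true i else demand x d ?p + true i \<le> length ls"
        unfolding c by (simp add: tr)
      moreover have "true i \<le> length ls" unfolding tr by (rule length_filter_le)
      ultimately show ?thesis by (auto simp: row_target_def c target_def split: if_splits)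
    qed
    ultimately show ?thesis by simp
  qed
  then have "(\<Sum>j<2 * nb x. coefficient x j * of_bool (\<beta> j)) = total x"
    unfolding subset_sum_iff_rows using sum by blast
  then show "\<exists>\<beta>. (\<Sum>j<2 * nb x. coefficient x j * of_bool (\<beta> j)) = total x" by blast
qed

text \<open>The variables from \<open>nb x\<close> onwards occur in the topmost digit only. They make the equation for this
  digit satisfiable in any case; the purpose of the digit is that every coefficient has a leading 1,
  so that its binary code is the concatenation of the codes of its digits.\<close>

definition sum_inst :: "rat \<Rightarrow> bool list \<Rightarrow> instance_data" where
  "sum_inst rad x = inst (2 * nb x) 2 1 (\<lambda>i. of_int (if i = 0 then - int (total x) else int (total x)))
     (\<lambda>i j. of_int (if i = 0 then int (coefficient x j) else - int (coefficient x j)))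
     (\<lambda>_ _. 0) (\<lambda>_ _. 0) (\<lambda>_. 0) rad 0"

section \<open>Generating the aggregated equation\<close>

definition gsigned :: "bool \<Rightarrow> gen \<Rightarrow> aexp \<Rightarrow> gen" where
  "gsigned s g t = gcat [Emit [s], g, Num t, Emit (enc_nat 1)]"

text \<open>The column is the value of variable 1, which the enclosing loop in
  \<open>sum_gen\<close> sets; the top part is appended by \<open>gsigned\<close>.\<close>

definition coeff_digits :: gen where
  "coeff_digits = For 0 P (gcat (map (\<lambda>c. gcase (acount (eq_lits c))
     (map (\<lambda>v. Emit (digit_code (2 * slack) v)) [0..<2 ^ (2 * slack)])) [0..<size_F]))"

definition total_digits :: gen where
  "total_digits = For 0 P (gcat (map (\<lambda>c. case F ! c of (s, ls, d) \<Rightarrow>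
     Branch d (Emit (digit_code (2 * slack) (target s (length ls) 1)))
       (Emit (digit_code (2 * slack) (target s (length ls) 0)))) [0..<size_F]))"

definition sum_gen :: "aexp \<Rightarrow> gen" where
  "sum_gen rad = (let n = Mul (Lit 2) base_vars in ginst n (Lit 2) (Lit 1)
     (Cat (gsigned True total_digits base_vars) (gsigned False total_digits base_vars))
     (Cat (For 1 n (gsigned False coeff_digits (Lit 1))) (For 1 n (gsigned True coeff_digits (Lit 1))))
     (For 2 (Lit 1) (For 1 (Lit 2) (gconst 0)))
     (For 2 (Lit 1) (For 1 n (gconst 0))) (For 2 (Lit 1) (gconst 0)) (gnum rad) (gconst 0))"

lemma gen_wf_sum: "gen_wf (sum_gen rad)"
  by (auto simp: sum_gen_def Let_def gen_wf_ginst gsigned_def coeff_digits_def total_digits_def gen_gcase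
      split: prod.splits)

lemma concat_map_rows_upt:
  "concat (map (\<lambda>i. g (i div size_F) (i mod size_F)) [0..<n * size_F]) =
     concat (map (\<lambda>p. concat (map (g p) [0..<size_F])) [0..<n])"
proof -
  have "concat (map (\<lambda>i. g (i div size_F) (i mod size_F)) [0..<n * size_F]) =
      concat (map (\<lambda>i. g (i div size_F) ([0..<size_F] ! (i mod size_F))) [0..<n * size_F])"
    using row_mod_less by (intro arg_cong[of _ _ concat] map_cong) (auto simp del: upt_Suc)
  then show ?thesis using concat_map_rows[of g "[0..<size_F]" n] by simp
qed

lemma gsem_coefficient:
  "gsem (gsigned s coeff_digits (Lit 1)) x (env(1 := j)) = s # enc_nat (coefficient x j) @ enc_nat 1"
proof -
  have less: "lit_count x (eq_lits c) p j < 2 ^ (2 * slack)" if "c < size_F" for c p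
    using lit_count_le[of x "eq_lits c" p j] length_eq_lits[OF that] by linarith
  have val: "aval (acount (eq_lits c)) x (env(1 := j, 0 := p)) = lit_count x (eq_lits c) p j" if "c < size_F" for c p
    by (simp add: aval_acount[OF eq_lits_vars[OF that]])
  have "gsem (gcase (acount (eq_lits c)) (map (\<lambda>v. Emit (digit_code (2 * slack) v)) [0..<2 ^ (2 * slack)])) x (env(1 := j, 0 := p)) =
      digit_code (2 * slack) (lit_count x (eq_lits c) p j)" if "c < size_F" for c p
    using less[OF that, of p] val[OF that, of p] by (subst gsem_gcase) (simp_all del: upt_Suc fun_upd_apply)
  then have "gsem coeff_digits x (env(1 := j)) =
      concat (map (\<lambda>p. concat (map (\<lambda>c. digit_code (2 * slack) (lit_count x (eq_lits c) p j)) [0..<size_F])) [0..<np x])"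
    unfolding coeff_digits_def using aval_closed[OF closed(1), of x "env(1 := j)" "\<lambda>_. 0"]
    by (auto simp: o_def intro!: arg_cong[of _ _ concat] map_cong)
  also have "\<dots> = concat (map (\<lambda>i. digit_code (2 * slack) (lit_count x (eq_lits (i mod size_F)) (i div size_F) j)) [0..<np x * size_F])"
    by (rule concat_map_rows_upt[symmetric])
  finally show ?thesis
    unfolding gsigned_def coefficient_def by (subst enc_nat_number) (use less row_mod_less in \<open>simp_all\<close>)
qed

lemma gsem_total:
  "gsem (gsigned s total_digits base_vars) x (\<lambda>_. 0) = s # enc_nat (total x) @ enc_nat 1"
proof -
  have "gsem (case F ! c of (s, ls, d) \<Rightarrow> Branch d (Emit (digit_code (2 * slack) (target s (length ls) 1)))
       (Emit (digit_code (2 * slack) (target s (length ls) 0)))) x ((\<lambda>_. 0)(0 := p)) =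
      digit_code (2 * slack) (row_target x p c)" if "c < size_F" for c p
  proof -
    obtain s ls d where c: "F ! c = (s, ls, d)" by (metis prod_cases3)
    then have "(s, ls, d) \<in> set F" using that by (metis nth_mem)
    then have "aval d x ((\<lambda>_. 0)(0 := p)) = aval d x (\<lambda>_. p)" by (intro aval_row F_vars) auto
    then show ?thesis by (simp add: c row_target_def demand_def)
  qed
  then have "gsem total_digits x (\<lambda>_. 0) =
      concat (map (\<lambda>p. concat (map (\<lambda>c. digit_code (2 * slack) (row_target x p c)) [0..<size_F])) [0..<np x])"
    unfolding total_digits_def by (auto simp: o_def intro!: arg_cong[of _ _ concat] map_cong)
  also have "\<dots> = concat (map (\<lambda>i. digit_code (2 * slack) (row_target x (i div size_F) (i mod size_F))) [0..<np x * size_F])"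
    by (rule concat_map_rows_upt[symmetric])
  finally show ?thesis
    unfolding gsigned_def total_def
    by (subst enc_nat_number) (use row_target_less[OF row_mod_less] F_pos in \<open>simp_all add: nb_eq\<close>)
qed

lemma gsem_sum:
  assumes "aval rad x (\<lambda>_. 0) = r"
  shows "gsem (sum_gen rad) x (\<lambda>_. 0) = enc_instance (sum_inst (of_nat r) x)"
  unfolding sum_gen_def Let_def sum_inst_def
proof (rule gsem_ginst)
  have two: "[0..<2] = [0, 1]" by (simp add: upt_rec)
  \<comment> \<open>Positivity justifies the fixed sign bits \<open>True\<close> and
    \<open>False\<close> of the two rows; a zero would take \<open>False\<close> in both.\<close>
  have pos: "0 < total x" "0 < coefficient x j" for j
    using number_pos F_pos by (simp_all add: total_def coefficient_def nb_eq)
  show "gsem (Cat (gsigned True total_digits base_vars) (gsigned False total_digits base_vars)) x (\<lambda>_. 0) =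
    concat (map (\<lambda>i. enc_rat (of_int (if i = 0 then - int (total x) else int (total x)))) [0..<2])"
    unfolding two using pos(1) by (simp add: gsem_total enc_rat_of_int[of "- int (total x)", simplified] enc_rat_of_int[of "int (total x)", simplified])
  show "gsem (Cat (For 1 (Mul (Lit 2) base_vars) (gsigned False coeff_digits (Lit 1)))
      (For 1 (Mul (Lit 2) base_vars) (gsigned True coeff_digits (Lit 1)))) x (\<lambda>_. 0) =
    concat (map (\<lambda>i. concat (map (\<lambda>j. enc_rat (of_int (if i = 0 then int (coefficient x j) else - int (coefficient x j)))) [0..<2 * nb x])) [0..<2])"
    unfolding two using pos(2)
    by (simp add: gsem_coefficient[simplified] enc_rat_of_int[of "- int (coefficient x j)" for j, simplified]
        enc_rat_of_int[of "int (coefficient x j)" for j, simplified])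
qed (use closed_base assms in simp_all)

lemma yes_sum_inst:
  assumes nrm: "norm_on (2 * nb x) nrm"
    and le: "\<And>\<xi> \<xi>'. \<xi> \<in> hypercube (2 * nb x) \<Longrightarrow> \<xi>' \<in> hypercube (2 * nb x) \<Longrightarrow> nrm (\<xi> - \<xi>') \<le> real r"
  shows "yes_instance nrm (sum_inst (of_nat r) x) \<longleftrightarrow> (\<exists>\<beta>. sat F P x \<beta>)"
proof -
  have key: "(\<forall>i<(2::nat). 0 \<le> (if i = 0 then - int (total x) else int (total x)) +
      (\<Sum>j<2 * nb x. (if i = 0 then int (coefficient x j) else - int (coefficient x j)) * of_bool (\<beta> j))) \<longleftrightarrow>
      (\<Sum>j<2 * nb x. coefficient x j * of_bool (\<beta> j)) = total x" for \<beta> :: "nat \<Rightarrow> bool"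
  proof -
    define c where "c = (\<Sum>j<2 * nb x. coefficient x j * of_bool (\<beta> j))"
    have pos: "(\<Sum>j<2 * nb x. int (coefficient x j) * of_bool (\<beta> j)) = int c"
      unfolding c_def by (simp add: of_nat_sum del: sum_mult_of_bool_eq sum_of_bool_mult_eq)
    have neg: "(\<Sum>j<2 * nb x. - int (coefficient x j) * of_bool (\<beta> j)) = - int c"
      unfolding pos[symmetric] sum_negf[symmetric] by (intro sum.cong) simp_all
    have two: "(\<forall>i<2. R i) \<longleftrightarrow> R 0 \<and> R 1" for R :: "nat \<Rightarrow> bool" by (auto simp: less_2_cases_iff)
    show ?thesis unfolding c_def[symmetric] two
      by (simp only: simp_thms if_True if_False one_neq_zero pos neg) auto
  qed
  show ?thesis unfolding sum_inst_def ex_subset_sum_iff[symmetric]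
    by (subst yes_inst_objective[OF nrm]; (intro ex_cong1 key)?) (use le in auto)
qed

lemma sum_inst_props:
  "sum_inst (of_nat r) x \<in> instances" "objective_uncertainty (problem_of (sum_inst (of_nat r) x))"
  "dim_N2 (sum_inst (of_nat r) x) = 2"
  unfolding sum_inst_def
  using F_pos by (auto intro!: inst_in_instances objective_uncertainty_inst simp: Suc_le_eq nb_eq)

end

theorem theorem6:
  fixes nrm :: "real vec \<Rightarrow> real"
  assumes "\<And>m. norm_on m nrm"
    and "\<exists>p :: nat poly. \<forall>m. \<forall>\<xi> \<in> hypercube m. \<forall>\<xi>' \<in> hypercube m.
           nrm (\<xi> - \<xi>') \<le> real (poly p m)"
  shows
    "strongly_NP_hard {D \<in> instances. objective_uncertainty (problem_of D)}
       (yes_instance nrm) enc_instance max_number \<and>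
     strongly_NP_hard {D \<in> instances. rhs_uncertainty (problem_of D)}
       (yes_instance nrm) enc_instance max_number \<and>
     NP_hard {D \<in> instances. objective_uncertainty (problem_of D) \<and> dim_N2 D = 2}
       (yes_instance nrm) enc_instance"
proof -
  obtain p :: "nat poly" where p: "\<And>m \<xi> \<xi>'. \<xi> \<in> hypercube m \<Longrightarrow> \<xi>' \<in> hypercube m \<Longrightarrow> nrm (\<xi> - \<xi>') \<le> real (poly p m)"
    using assms(2) by blast
  \<comment> \<open>Entries are at most the relevant dimensions plus 1 plus the radius
    \<open>poly p (nm x)\<close>, and these dimensions are at most the encoding length.\<close>
  define q where "q = [:1, 1:] + p"
  have q: "k \<le> poly q n" if "k \<le> n' + 1 + poly p n''" "n' \<le> n" "n'' \<le> n" for k n n' n''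
    using that poly_mono_nat[of n'' n p] by (simp add: q_def)
  have "strongly_NP_hard {D \<in> instances. objective_uncertainty (problem_of D)} (yes_instance nrm) enc_instance max_number"
    unfolding strongly_NP_hard_def
  proof (intro exI[of _ q] NP_hardI)
    fix F P m A assume "cnf_bounded F P m"
    then interpret bounded_cnf F P m by unfold_locales
    obtain rad where rad: "\<And>x. aval rad x (\<lambda>_. 0) = poly p (nm x)" using ex_poly_aexp[of m p] by blast
    show "\<exists>g. gen_wf g \<and> (\<forall>x. \<exists>a\<in>{a \<in> {D \<in> instances. objective_uncertainty (problem_of D)}.
        max_number a \<le> poly q (length (enc_instance a))}. gsem g x (\<lambda>_. 0) = enc_instance a \<and>
        (yes_instance nrm a \<longleftrightarrow> (\<exists>\<beta>. sat F P x \<beta>)))"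
    proof (intro exI[of _ "objective_gen rad"] conjI allI gen_wf_objective)
      fix x
      let ?D = "objective_inst (of_nat (poly p (nm x))) x"
      have "max_number ?D \<le> poly q (length (enc_instance ?D))"
        by (rule q[OF max_number_objective_inst]) (rule objective_inst_props(3))+
      then show "\<exists>a\<in>{a \<in> {D \<in> instances. objective_uncertainty (problem_of D)}.
          max_number a \<le> poly q (length (enc_instance a))}. gsem (objective_gen rad) x (\<lambda>_. 0) = enc_instance a \<and>
          (yes_instance nrm a \<longleftrightarrow> (\<exists>\<beta>. sat F P x \<beta>))"
        using objective_inst_props gsem_objective[OF rad] yes_objective_inst[OF assms(1) p]
        by (intro bexI[of _ ?D]) auto
    qed
  qed
  moreover have "strongly_NP_hard {D \<in> instances. rhs_uncertainty (problem_of D)} (yes_instance nrm) enc_instance max_number"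
    unfolding strongly_NP_hard_def
  proof (intro exI[of _ q] NP_hardI)
    fix F P m A assume "cnf_bounded F P m"
    then interpret bounded_cnf F P m by unfold_locales
    obtain rad where rad: "\<And>x. aval rad x (\<lambda>_. 0) = poly p (nm x)" using ex_poly_aexp[of m p] by blast
    show "\<exists>g. gen_wf g \<and> (\<forall>x. \<exists>a\<in>{a \<in> {D \<in> instances. rhs_uncertainty (problem_of D)}.
        max_number a \<le> poly q (length (enc_instance a))}. gsem g x (\<lambda>_. 0) = enc_instance a \<and>
        (yes_instance nrm a \<longleftrightarrow> (\<exists>\<beta>. sat F P x \<beta>)))"
    proof (intro exI[of _ "rhs_gen rad"] conjI allI gen_wf_rhs)
      fix x
      let ?D = "rhs_inst (of_nat (poly p (nm x))) x"
      have "max_number ?D \<le> poly q (length (enc_instance ?D))"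
        by (rule q[OF max_number_rhs_inst]) (use rhs_inst_props(3)[of x "poly p (nm x)"] in linarith)+
      then show "\<exists>a\<in>{a \<in> {D \<in> instances. rhs_uncertainty (problem_of D)}.
          max_number a \<le> poly q (length (enc_instance a))}. gsem (rhs_gen rad) x (\<lambda>_. 0) = enc_instance a \<and>
          (yes_instance nrm a \<longleftrightarrow> (\<exists>\<beta>. sat F P x \<beta>))"
        using rhs_inst_props gsem_rhs[OF rad] yes_rhs_inst[OF assms(1) p]
        by (intro bexI[of _ ?D]) auto
    qed
  qed
  \<comment> \<open>Only plain hardness: the coefficients are exponential in the number of clauses.
    The radius belongs to dimension \<open>2 * nb x\<close>, which includes slack and padding
    variables.\<close>
  moreover have "NP_hard {D \<in> instances. objective_uncertainty (problem_of D) \<and> dim_N2 D = 2} (yes_instance nrm) enc_instance"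
  proof (rule NP_hardI)
    fix F P m A assume "cnf_bounded F P m"
    then interpret bounded_cnf F P m by unfold_locales
    obtain rad where rad: "\<And>x. aval rad x (\<lambda>_. 0) = poly p (2 * nb x)"
      using ex_poly_aexp[of "Mul (Lit 2) base_vars" p] by auto
    show "\<exists>g. gen_wf g \<and> (\<forall>x. \<exists>a\<in>{D \<in> instances. objective_uncertainty (problem_of D) \<and> dim_N2 D = 2}.
        gsem g x (\<lambda>_. 0) = enc_instance a \<and> (yes_instance nrm a \<longleftrightarrow> (\<exists>\<beta>. sat F P x \<beta>)))"
    proof (intro exI[of _ "sum_gen rad"] conjI allI gen_wf_sum)
      fix x
      show "\<exists>a\<in>{D \<in> instances. objective_uncertainty (problem_of D) \<and> dim_N2 D = 2}.
          gsem (sum_gen rad) x (\<lambda>_. 0) = enc_instance a \<and> (yes_instance nrm a \<longleftrightarrow> (\<exists>\<beta>. sat F P x \<beta>))"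
        using sum_inst_props gsem_sum[OF rad] yes_sum_inst[OF assms(1) p]
        by (intro bexI[of _ "sum_inst (of_nat (poly p (2 * nb x))) x"]) auto
    qed
  qed
  ultimately show ?thesis by blast
qed

end
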